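(* Consider the real-power model with gap $\Delta>0$ and the RMPE algorithm using the ESPRIT routine and the real-power gapped rule for $m_\ell$ (described in the context). Let $\epsilon>0$, $\rho\in(0,1)$. Let $\tilde\Delta<\min\{\frac{1}{8S(2S-1)},\Delta\}$, let $K>4/\tilde\Delta$ be an even integer, let $C\in(2,\frac{K\tilde\Delta}{2})$, and set $$A=\frac{80S^2}{\beta}\sqrt{\frac{C^3(2+K)}{(C-1)^3K}}\left(1-\frac{2CS}{(C-1)K}\right)^{-1}.$$ Let $\eta$ satisfy $A\omega<\eta<\frac{1}{8S(2S-1)}$, let $\alpha>0$ satisfy $$\alpha<\min\left\{\frac{C\beta}{8(C-1)\sqrt{2S}}\sqrt{1-\frac{2(C-1)S}{CK}},\ \frac{\eta}{A}\right\}-\omega,$$ and let $N_{\mathrm{HR}}=2\left\lceil\frac{4}{\alpha^2}\left(\log\frac4\rho+\log\left(\left\lceil\log_2\frac{\eta}{\epsilon}\right\rceil+1\right)+\log(K+1)\right)\right\rceil$. Then with probability at least $1-\rho$ the output satisfies $\Lambda\subset E_L\subset B(\Lambda,\epsilon)$, and $T_{\max}=O(\eta K\epsilon^{-1})$, $T_{\mathrm{total}}=O(\eta K^2N_{\mathrm{HR}}\epsilon^{-1})$.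
   Context: Real-power model: $H$ Hermitian with eigenvalues in $[0,1]$; for every real $t\ge0$ one can apply controlled-$U^t$, $U^t:=e^{-2\pi iHt}$, at cost $t$. Initial state $|\psi\rangle=\sum_{s=1}^Sc_s|\psi_s\rangle+c_{\mathrm{res}}|\psi_{\mathrm{res}}\rangle$, $|\psi_s\rangle$ orthonormal with $H|\psi_s\rangle=\lambda_s|\psi_s\rangle$, $|\psi_{\mathrm{res}}\rangle$ a unit vector orthogonal to all $|\psi_s\rangle$, $\min_s|c_s|^2\ge\beta>0$, $|c_{\mathrm{res}}|^2\le\omega<\beta$; $\Lambda=\{\lambda_1,\dots,\lambda_S\}\subset[0,0.9]$ (assumed). Gap: $\Delta=\min_{s\ne s'}\min_{n\in\mathbb{Z}}|\lambda_s-\lambda_{s'}-n|$. Notation: $\mathbb{T}=\mathbb{R}/\mathbb{Z}$; $B(T,r)=\bigcup_{x\in T}[x-r,x+r]$ in $\mathbb{R}$; $B_{\mathbb{T}}$ the analogue modulo 1. Hadamard test: one run with time $t$ returns an independent $\pm1$ with mean $\mathrm{Re}\langle\psi|U^t|\psi\rangle$ or (second variant) $\mathrm{Im}\langle\psi|U^t|\psi\rangle$, at cost $t$. RMPE algorithm (parameters $\eta,K,N_{\mathrm{HR}}$, target $\epsilon$): $E_{-1}=[0,0.9]$, $M_0=1$. For $\ell=0,1,2,\dots$: (i) if $\ell\ge1$ choose $m_\ell$ by the rule below, $M_\ell=M_{\ell-1}m_\ell$; (ii) for $k=0,\dots,K$ run the Hadamard test with $t=M_\ell k$ $N_{\mathrm{HR}}/2$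 times per variant, $y_\ell(k)=$ (real average)$+i\,$(imaginary average); (iii) compute $Y_\ell\subset\mathbb{T}$ by the routine; (iv) write $Y_\ell$ as disjoint closed arcs, lift to intervals of $\mathbb{R}$, divide by $M_\ell$ to get $I'_{\ell,i}$; pick integers $q_{\ell,i}$ with $(I'_{\ell,i}+q_{\ell,i}/M_\ell)\cap E_{\ell-1}\ne\varnothing$ and set $E_\ell=\bigcup_i(I'_{\ell,i}+q_{\ell,i}/M_\ell)$; (v) if $\eta/M_\ell\le\epsilon$, stop and output $E_L:=E_\ell$. $T_{\max}$: largest $t$ used; $T_{\mathrm{total}}$: sum of $t$ over all runs. ESPRIT routine ($K$ even): form the $(K/2+1)\times(K/2+1)$ Hankel matrix with entries $y_\ell(i+j)$, $0\le i,j\le K/2$; take its SVD and let $U_\ell$ consist of the left singular vectors of the $S$ largest singular values; let $U^{(0)}_\ell$, $U^{(1)}_\ell$ be its first and last $K/2$ rows; let $\mu_1,\dots,\mu_S$ be the eigenvalues of $(U^{(0)}_\ell)^\dagger U^{(1)}_\ell$ ($\dagger$ = Moore–Penrose pseudo-inverse); $\tilde\Lambda_\ell=\{-\frac{1}{2\pi}\arg\mu_j \bmod 1\}$ and $Y_\ell=B_{\mathbb{T}}(\tilde\Lambda_\ell,\eta/2)$. Rule for $m_\ell$ (real-power, gapped): choose $m_\ell\in[2,4]$ such that, with $G=B(E_{\ell-1},\max\{\tilde\Delta/2,\eta/4\}/M_{\ell-1})$, $(G+\frac{q}{M_{\ell-1}m_\ell})\cap G=\varnothing$ for all $q\in\m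athbb{Z}\setminus\{0\}$.
   Formalization: The formal theorem assumes ε < 2η (and S ≥ 1): for ε ≥ 2η the quantity ⌈log₂(η/ε)⌉+1 is at most 0, so the logarithm in N_HR, and hence N_HR itself, is undefined. *)

theory Defs
  imports "HOL-Probability.Probability"
          "Jordan_Normal_Form.Spectral_Radius"
          "Jordan_Normal_Form.Schur_Decomposition"
begin

definition mat_exp :: "complex mat \<Rightarrow> complex mat" where
  "mat_exp A = mat (dim_row A) (dim_col A)
      (\<lambda>(i,j). (\<Sum>k. (A ^\<^sub>m k) $$ (i,j) / of_nat (fact k)))"

definition U_pow :: "complex mat \<Rightarrow> real \<Rightarrow> complex mat" where
  "U_pow H t = mat_exp ((- (2 * of_real pi * \<i> * of_real t)) \<cdot>\<^sub>m H)"

text \<open>Hadamard-test signal: <psi| U^t |psi>.  (v \<bullet>c w = sum_i v_i * cnj w_i.)\<close>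
definition signal :: "complex mat \<Rightarrow> complex Matrix.vec \<Rightarrow> real \<Rightarrow> complex" where
  "signal H \<psi> t = (U_pow H t *\<^sub>v \<psi>) \<bullet>c \<psi>"

definition real_power_model ::
  "nat \<Rightarrow> complex mat \<Rightarrow> nat \<Rightarrow> (nat \<Rightarrow> real) \<Rightarrow> (nat \<Rightarrow> complex Matrix.vec)
   \<Rightarrow> (nat \<Rightarrow> complex) \<Rightarrow> complex \<Rightarrow> complex Matrix.vec \<Rightarrow> complex Matrix.vec
   \<Rightarrow> real \<Rightarrow> real \<Rightarrow> bool" where
  "real_power_model n H S lam psis c cres psires psi \<beta> \<omega> \<longleftrightarrow>
     H \<in> carrier_mat n n \<and> mat_adjoint H = H \<and>
     (\<forall>\<mu>. eigenvalue H \<mu> \<longrightarrow> (\<exists>x\<in>{0..1}. \<mu> = complex_of_real x)) \<and>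
     (\<forall>s<S. psis s \<in> carrier_vec n \<and> H *\<^sub>v psis s = complex_of_real (lam s) \<cdot>\<^sub>v psis s) \<and>
     (\<forall>s<S. \<forall>s'<S. psis s \<bullet>c psis s' = (if s = s' then 1 else 0)) \<and>
     psires \<in> carrier_vec n \<and> psires \<bullet>c psires = 1 \<and>
     (\<forall>s<S. psires \<bullet>c psis s = 0) \<and>
     psi = Matrix.vec n (\<lambda>i. (\<Sum>s<S. c s * psis s $ i) + cres * psires $ i) \<and>
     psi \<bullet>c psi = 1 \<and>
     \<beta> > 0 \<and> (\<forall>s<S. (cmod (c s))\<^sup>2 \<ge> \<beta>) \<and> (cmod cres)\<^sup>2 \<le> \<omega> \<and> \<omega> < \<beta> \<and>
     (\<forall>s<S. lam s \<in> {0..0.9})"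

definition dist_Z :: "real \<Rightarrow> real" where
  "dist_Z x = (INF m::int. \<bar>x - of_int m\<bar>)"

definition ballR :: "real set \<Rightarrow> real \<Rightarrow> real set" where
  "ballR T r = (\<Union>x\<in>T. {x - r .. x + r})"

text \<open>B_T(T,r): a subset of the torus R/Z, represented by its (1-periodic) preimage in R\<close>
definition ballT :: "real set \<Rightarrow> real \<Rightarrow> real set" where
  "ballT T r = {x. \<exists>y\<in>T. dist_Z (x - y) \<le> r}"

definition pm1_pmf :: "real \<Rightarrow> real pmf" where
  "pm1_pmf a = map_pmf (\<lambda>b. if b then 1 else -1) (bernoulli_pmf ((1 + a) / 2))"

primrec sum_pm1 :: "nat \<Rightarrow> real \<Rightarrow> real pmf" where
  "sum_pm1 0 a = return_pmf 0"
| "sum_pm1 (Suc m) a = bind_pmf (pm1_pmf a) (\<lambda>x. map_pmf (\<lambda>s. x + s) (sum_pm1 m a))"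

definition hadamard_estimate :: "(real \<Rightarrow> complex) \<Rightarrow> nat \<Rightarrow> real \<Rightarrow> complex pmf" where
  "hadamard_estimate f N t =
     bind_pmf (sum_pm1 (N div 2) (Re (f t))) (\<lambda>r.
     bind_pmf (sum_pm1 (N div 2) (Im (f t))) (\<lambda>s.
     return_pmf (Complex (r / real (N div 2)) (s / real (N div 2)))))"

primrec sample_list :: "(nat \<Rightarrow> 'a pmf) \<Rightarrow> nat list \<Rightarrow> 'a list pmf" where
  "sample_list g [] = return_pmf []"
| "sample_list g (k # ks) = bind_pmf (g k) (\<lambda>x. map_pmf (\<lambda>xs. x # xs) (sample_list g ks))"

definition hankel :: "nat \<Rightarrow> (nat \<Rightarrow> complex) \<Rightarrow> complex mat" where
  "hankel K y = mat (K div 2 + 1) (K div 2 + 1) (\<lambda>(i,j). y (i + j))"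

definition is_svd :: "complex mat \<Rightarrow> complex mat \<Rightarrow> complex mat \<Rightarrow> complex mat \<Rightarrow> bool" where
  "is_svd A W Sg V \<longleftrightarrow>
     W \<in> carrier_mat (dim_row A) (dim_row A) \<and> V \<in> carrier_mat (dim_col A) (dim_col A) \<and>
     Sg \<in> carrier_mat (dim_row A) (dim_col A) \<and>
     mat_adjoint W * W = 1\<^sub>m (dim_row A) \<and> mat_adjoint V * V = 1\<^sub>m (dim_col A) \<and>
     (\<forall>i<dim_row A. \<forall>j<dim_col A. i \<noteq> j \<longrightarrow> Sg $$ (i,j) = 0) \<and>
     (\<forall>i<min (dim_row A) (dim_col A). Im (Sg $$ (i,i)) = 0 \<and> Re (Sg $$ (i,i)) \<ge> 0) \<and>
     (\<forall>i j. i \<le> j \<and> j < min (dim_row A) (dim_col A) \<longrightarrow> Re (Sg $$ (j,j)) \<le> Re (Sg $$ (i,i))) \<and>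
     A = W * Sg * mat_adjoint V"

definition is_pinv :: "complex mat \<Rightarrow> complex mat \<Rightarrow> bool" where
  "is_pinv A X \<longleftrightarrow> X \<in> carrier_mat (dim_col A) (dim_row A) \<and>
     A * X * A = A \<and> X * A * X = X \<and>
     mat_adjoint (A * X) = A * X \<and> mat_adjoint (X * A) = X * A"

definition pinv :: "complex mat \<Rightarrow> complex mat" where
  "pinv A = (THE X. is_pinv A X)"

text \<open>All possible outputs \<tilde>Lambda of the ESPRIT routine (SVD is not unique), as subsets of [0,1)
  representing points of the torus.\<close>
definition esprit_outputs :: "nat \<Rightarrow> nat \<Rightarrow> (nat \<Rightarrow> complex) \<Rightarrow> real set set" where
  "esprit_outputs K S y =
     {L. \<exists>W Sg V. is_svd (hankel K y) W Sg V \<and>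
        (let U  = mat (K div 2 + 1) S (\<lambda>(i,j). W $$ (i,j));
             U0 = mat (K div 2) S (\<lambda>(i,j). U $$ (i,j));
             U1 = mat (K div 2) S (\<lambda>(i,j). U $$ (i + 1, j))
         in L = {frac (- Arg \<mu> / (2 * pi)) | \<mu>. eigenvalue (pinv U0 * U1) \<mu>})}"

definition m_rule_ok :: "real \<Rightarrow> real \<Rightarrow> real \<Rightarrow> real set \<Rightarrow> real \<Rightarrow> bool" where
  "m_rule_ok Dt \<eta> Mp Ep m \<longleftrightarrow> 2 \<le> m \<and> m \<le> 4 \<and>
     (let G = ballR Ep (max (Dt / 2) (\<eta> / 4) / Mp) in
      \<forall>q::int. q \<noteq> 0 \<longrightarrow> ((\<lambda>x. x + of_int q / (Mp * m)) ` G) \<inter> G = {})"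

text \<open>Admissible E_l from Y_l (given by its 1-periodic lift Y), M = M_l and E_{l-1}.
  The connected components of {x. M x \<in> Y} are exactly the intervals I'_{l,i} + q/M;
  two of them belong to the same arc iff they differ by a translation by j/M.
  For each arc one chooses one such interval meeting E_{l-1} (arcs with no such interval
  contribute nothing), and E_l is the union of the chosen intervals.\<close>
definition same_arc :: "real \<Rightarrow> real set \<Rightarrow> real set \<Rightarrow> bool" where
  "same_arc M C C' \<longleftrightarrow> (\<exists>j::int. C' = (\<lambda>x. x + of_int j / M) ` C)"

definition E_update_ok :: "real \<Rightarrow> real set \<Rightarrow> real set \<Rightarrow> real set \<Rightarrow> bool" where
  "E_update_ok M Y Ep E \<longleftrightarrow>
     (let P = {x. M * x \<in> Y} in
      \<exists>F. F \<subseteq> components P \<and> E = \<Union>F \<and> (\<forall>C\<in>F. C \<inter> Ep \<noteq> {}) \<and>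
          (\<forall>C\<in>components P. (\<exists>C'\<in>components P. same_arc M C C' \<and> C' \<inter> Ep \<noteq> {}) \<longrightarrow>
               (\<exists>!C'. C' \<in> F \<and> same_arc M C C')))"

text \<open>State: (stopped, E_{l-1} (resp. E_L once stopped), list [M_0,...,M_{l-1}]).
  The choice functions selm, sele, selE resolve the non-determinism of the algorithm
  (choice of m_l, of the SVD, of the integers q_{l,i}).\<close>
type_synonym rmpe_state = "bool \<times> real set \<times> real list"

definition rmpe_step ::
  "(real \<Rightarrow> complex) \<Rightarrow> nat \<Rightarrow> nat \<Rightarrow> real \<Rightarrow> real
   \<Rightarrow> (nat \<Rightarrow> real \<Rightarrow> real set \<Rightarrow> real)
   \<Rightarrow> (nat \<Rightarrow> real \<Rightarrow> real set \<Rightarrow> (nat \<Rightarrow> complex) \<Rightarrow> real set)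
   \<Rightarrow> (nat \<Rightarrow> real \<Rightarrow> real set \<Rightarrow> real set \<Rightarrow> real set)
   \<Rightarrow> rmpe_state \<Rightarrow> rmpe_state pmf" where
  "rmpe_step f K N \<eta> \<epsilon> selm sele selE st =
     (case st of (stopped, Ep, Ms) \<Rightarrow>
       if stopped then return_pmf st else
       (let l = length Ms;
            M = (if l = 0 then 1 else last Ms * selm l (last Ms) Ep)
        in map_pmf (\<lambda>ys.
              let y = (\<lambda>k. ys ! k);
                  Lt = sele l M Ep y;
                  Y = ballT Lt (\<eta> / 2);
                  E = selE l M Ep Y
              in (\<eta> / M \<le> \<epsilon>, E, Ms @ [M]))
           (sample_list (\<lambda>k. hadamard_estimate f N (M * real k)) [0..<K + 1])))"

primrec rmpe_iter ::
  "(real \<Rightarrow> complex) \<Rightarrow> nat \<Rightarrow> nat \<Rightarrow> real \<Rightarrow> real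
   \<Rightarrow> (nat \<Rightarrow> real \<Rightarrow> real set \<Rightarrow> real)
   \<Rightarrow> (nat \<Rightarrow> real \<Rightarrow> real set \<Rightarrow> (nat \<Rightarrow> complex) \<Rightarrow> real set)
   \<Rightarrow> (nat \<Rightarrow> real \<Rightarrow> real set \<Rightarrow> real set \<Rightarrow> real set)
   \<Rightarrow> nat \<Rightarrow> rmpe_state pmf" where
  "rmpe_iter f K N \<eta> \<epsilon> selm sele selE 0 = return_pmf (False, {0..0.9}, [])"
| "rmpe_iter f K N \<eta> \<epsilon> selm sele selE (Suc i) =
     bind_pmf (rmpe_iter f K N \<eta> \<epsilon> selm sele selE i) (rmpe_step f K N \<eta> \<epsilon> selm sele selE)"

text \<open>Run the loop for ceil(log2(eta/eps)) + 1 iterations; since every m_l \<ge> 2, the algorithm has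
  stopped by then (this is asserted in the theorem through the 'stopped' flag).\<close>
definition rmpe_output ::
  "(real \<Rightarrow> complex) \<Rightarrow> nat \<Rightarrow> nat \<Rightarrow> real \<Rightarrow> real
   \<Rightarrow> (nat \<Rightarrow> real \<Rightarrow> real set \<Rightarrow> real)
   \<Rightarrow> (nat \<Rightarrow> real \<Rightarrow> real set \<Rightarrow> (nat \<Rightarrow> complex) \<Rightarrow> real set)
   \<Rightarrow> (nat \<Rightarrow> real \<Rightarrow> real set \<Rightarrow> real set \<Rightarrow> real set) \<Rightarrow> rmpe_state pmf" where
  "rmpe_output f K N \<eta> \<epsilon> selm sele selE =
     rmpe_iter f K N \<eta> \<epsilon> selm sele selE (nat \<lceil>log 2 (\<eta> / \<epsilon>)\<rceil> + 1)"

definition T_max :: "nat \<Rightarrow> real list \<Rightarrow> real" where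
  "T_max K Ms = Max {M * real k | M k. M \<in> set Ms \<and> k \<le> K}"

definition T_total :: "nat \<Rightarrow> nat \<Rightarrow> real list \<Rightarrow> real" where
  "T_total K N Ms = (\<Sum>l<length Ms. \<Sum>k\<le>K. real N * (Ms ! l * real k))"

end

theory Submission
  imports Defs "HOL-Complex_Analysis.Complex_Analysis"
begin

unbundle no vec_syntax
no_notation fps_nth (infixl \<open>$\<close> 75)

text \<open>
  At level \<open>\<ell>\<close> the exact signal is, up to \<open>\<omega>\<close>, the exponential sum with nodes
  \<open>z\<^sub>s = exp (-2\<pi>i M\<lambda>\<^sub>s)\<close> and weights \<open>|c\<^sub>s|\<^sup>2\<close>. If \<open>U\<close> spans the leading left singular space of the
  noisy Hankel matrix, then \<open>U = V B + E\<close> with \<open>V\<close> the Vandermonde matrix and \<open>E\<close> of norm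
  \<open>O(\<delta>/\<beta>)\<close>, and the ESPRIT matrix is \<open>B\<close>-conjugate to \<open>diag(z\<^sub>s) + F\<close> with \<open>F\<close> of norm
  \<open>O(\<surd>S \<delta>/\<beta>)\<close>. So every eigenvalue is close to a node; conversely, the maximum modulus
  principle for a diagonal entry of the resolvent, on a circle around \<open>z\<^sub>s\<close> that stays away from all
  nodes, yields an eigenvalue close to \<open>z\<^sub>s\<close> at the price of a factor \<open>2S - 1\<close>.

  The constant \<open>80\<close> leaves enough room to bring the phase error down to \<open>3\<eta>/10\<close>, and this is
  essential: an error of \<open>\<eta>/2\<close> would not exclude that the arc of \<open>\<lambda>\<^sub>s\<close> merges with the arc of
  some \<open>\<lambda>\<^sub>t + q/M\<close>, which would make the choice of the lift ambiguous. With \<open>3\<eta>/10\<close> each level keeps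
  \<open>E\<close> between the \<open>\<eta>/(5M)\<close>- and the \<open>4\<eta>/(5M)\<close>-neighbourhood of \<open>\<Lambda>\<close>. An admissible factor \<open>m\<close>
  exists because the bad values of \<open>1/m\<close> cover less than the length \<open>1/4\<close> of \<open>[1/4, 1/2]\<close>. Hoeffding's
  inequality and a union bound give the probability; as \<open>m \<ge> 2\<close>, the cost is a geometric sum.
\<close>

section \<open>Linear algebra over the complex numbers\<close>

text \<open>The number 3/10 has to stay below 1/3 for two independent reasons. Suppose the phases
  are known up to \<kappa>\<eta>. Then each level leaves \<open>E\<close> between radius (1/2 -
  \<kappa>)\<eta>/M and (1/2 + \<kappa>)\<eta>/M about \<Lambda>. The rule for m pads
  \<open>E\<close> by at least \<eta>/4 on the old scale; since m \<ge> 2, translates of \<Lambda>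
  by nonzero multiples of 1/M are then (3 - 4\<kappa>)\<eta>/M away from \<Lambda> on the new scale.
  Arcs of different translates stay apart if this exceeds (1 + 2\<kappa>)\<eta>/M, that is, if
  \<kappa> < 1/3. On the other side, the bad values of 1/m have measure below 3(2 + 2\<kappa>)/32,
  which fits into 1/4 precisely when \<kappa> \<le> 1/3. The padding by \<open>Dt / 2\<close> has
  another purpose: it preserves the gap modulo 1 after multiplication by M, so that ESPRIT meets the
  same hypothesis at every level. The estimates are measured in the coordinates \<open>B w\<close>.
  There the noise-free ESPRIT matrix is diagonal with unimodular entries, hence normal, and passing
  between \<open>w\<close> and \<open>B w\<close> costs only a factor of order \<surd>S.\<close>

lemma cdot_sum: "w \<in> carrier_vec n \<Longrightarrow> v \<bullet>c w = (\<Sum>i<n. v $ i * cnj (w $ i))"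
  by (auto simp: scalar_prod_def atLeast0LessThan intro!: sum.cong)

lemma mat_adjoint_dim [simp]: "dim_row (mat_adjoint A) = dim_col A" "dim_col (mat_adjoint A) = dim_row A"
  by (auto simp: mat_adjoint_def)

lemma mat_adjoint_carrier [simp]: "A \<in> carrier_mat n m \<Longrightarrow> mat_adjoint A \<in> carrier_mat m n"
  by (rule carrier_matI) auto

lemma mat_adjoint_index [simp]:
  fixes A :: "complex mat"
  assumes "i < dim_col A" "j < dim_row A" shows "mat_adjoint A $$ (i,j) = cnj (A $$ (j,i))"
  using assms by (simp add: mat_adjoint_def mat_of_rows_def)

lemma mat_adjoint_adjoint [simp]: "mat_adjoint (mat_adjoint (A :: complex mat)) = A"
  by (rule eq_matI) auto

lemma mat_mult_index_sum:
  "A \<in> carrier_mat n m \<Longrightarrow> B \<in> carrier_mat m k \<Longrightarrow> i < n \<Longrightarrow> j < k \<Longrightarrow>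
    (A * B) $$ (i,j) = (\<Sum>l<m. A $$ (i,l) * B $$ (l,j))"
  by (auto simp: scalar_prod_def atLeast0LessThan intro!: sum.cong)

lemma mult_mat_vec_index_sum:
  "A \<in> carrier_mat n m \<Longrightarrow> v \<in> carrier_vec m \<Longrightarrow> i < n \<Longrightarrow> (A *\<^sub>v v) $ i = (\<Sum>l<m. A $$ (i,l) * v $ l)"
  by (auto simp: scalar_prod_def atLeast0LessThan intro!: sum.cong)

lemma mat_adjoint_mult:
  fixes A B :: "complex mat"
  assumes "A \<in> carrier_mat n m" "B \<in> carrier_mat m k"
  shows "mat_adjoint (A * B) = mat_adjoint B * mat_adjoint A"
proof (rule eq_matI)
  fix i j assume "i < dim_row (mat_adjoint B * mat_adjoint A)" "j < dim_col (mat_adjoint B * mat_adjoint A)"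
  hence ij: "i < k" "j < n" using assms by auto
  show "mat_adjoint (A * B) $$ (i,j) = (mat_adjoint B * mat_adjoint A) $$ (i,j)"
    using ij assms mat_mult_index_sum[OF assms ij(2) ij(1)]
      mat_mult_index_sum[of "mat_adjoint B" k m "mat_adjoint A" n i j]
    by (auto simp: mult.commute intro!: sum.cong)
qed (use assms in auto)

lemma mult_mat_vec_cdot:
  fixes A :: "complex mat"
  assumes A: "A \<in> carrier_mat n m" and v: "v \<in> carrier_vec m" and w: "w \<in> carrier_vec n"
  shows "(A *\<^sub>v v) \<bullet>c w = v \<bullet>c (mat_adjoint A *\<^sub>v w)"
proof -
  have A': "mat_adjoint A \<in> carrier_mat m n" using A by simp
  have "(A *\<^sub>v v) \<bullet>c w = (\<Sum>i<n. \<Sum>l<m. A $$ (i,l) * v $ l * cnj (w $ i))"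
    using mult_mat_vec_index_sum[OF A v] by (simp add: cdot_sum[OF w] sum_distrib_right)
  also have "\<dots> = (\<Sum>l<m. \<Sum>i<n. A $$ (i,l) * v $ l * cnj (w $ i))" by (rule sum.swap)
  also have "\<dots> = (\<Sum>l<m. v $ l * cnj (\<Sum>i<n. mat_adjoint A $$ (l,i) * w $ i))"
    using A by (auto simp: sum_distrib_left intro!: sum.cong)
  also have "\<dots> = v \<bullet>c (mat_adjoint A *\<^sub>v w)"
    using mult_mat_vec_index_sum[OF A' w] A' w
    by (subst cdot_sum[where n=m]) (auto intro!: sum.cong)
  finally show ?thesis .
qed

section \<open>Euclidean norm and isometries\<close>

definition vnorm :: "complex Matrix.vec \<Rightarrow> real" where
  "vnorm v = L2_set (\<lambda>i. cmod (v $ i)) {..<dim_vec v}"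

lemma vnorm_nonneg [simp]: "vnorm v \<ge> 0"
  by (simp add: vnorm_def)

lemma vnorm_zero [simp]: "vnorm (0\<^sub>v n) = 0"
  by (simp add: vnorm_def L2_set_def)

lemma vnorm_sq: "v \<in> carrier_vec n \<Longrightarrow> (vnorm v)\<^sup>2 = (\<Sum>i<n. (cmod (v $ i))\<^sup>2)"
  by (auto simp: vnorm_def L2_set_def sum_nonneg)

lemma cdot_self: "v \<in> carrier_vec n \<Longrightarrow> v \<bullet>c v = complex_of_real ((vnorm v)\<^sup>2)"
  by (simp add: cdot_sum vnorm_sq complex_norm_square del: of_real_power)

lemma vnorm_eq_0: "v \<in> carrier_vec n \<Longrightarrow> vnorm v = 0 \<longleftrightarrow> v = 0\<^sub>v n"
  by (auto simp: vnorm_def L2_set_eq_0_iff intro!: eq_vecI)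

lemma vnorm_pos: "v \<in> carrier_vec n \<Longrightarrow> v \<noteq> 0\<^sub>v n \<Longrightarrow> vnorm v > 0"
  using vnorm_eq_0[of v n] vnorm_nonneg[of v] by linarith

lemma vnorm_add: "v \<in> carrier_vec n \<Longrightarrow> w \<in> carrier_vec n \<Longrightarrow> vnorm (v + w) \<le> vnorm v + vnorm w"
proof -
  assume vw: "v \<in> carrier_vec n" "w \<in> carrier_vec n"
  have "vnorm (v + w) \<le> L2_set (\<lambda>i. cmod (v $ i) + cmod (w $ i)) {..<n}"
    using vw by (auto simp: vnorm_def norm_triangle_ineq intro!: L2_set_mono)
  also have "\<dots> \<le> vnorm v + vnorm w"
    using vw L2_set_triangle_ineq[of "\<lambda>i. cmod (v $ i)" "\<lambda>i. cmod (w $ i)" "{..<n}"] by (auto simp: vnorm_def)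
  finally show ?thesis .
qed

lemma vnorm_smult: "vnorm (a \<cdot>\<^sub>v v) = cmod a * vnorm v"
proof -
  have "vnorm (a \<cdot>\<^sub>v v) = L2_set (\<lambda>i. cmod a * cmod (v $ i)) {..<dim_vec v}"
    by (auto simp: vnorm_def norm_mult intro!: L2_set_cong)
  thus ?thesis by (simp add: vnorm_def L2_set_right_distrib)
qed

lemma vnorm_uminus: "vnorm (- v) = vnorm v"
  by (auto simp: vnorm_def intro!: L2_set_cong)

lemma vnorm_minus_le: "v \<in> carrier_vec n \<Longrightarrow> w \<in> carrier_vec n \<Longrightarrow> vnorm (v - w) \<le> vnorm v + vnorm w"
  using vnorm_add[of v n "- w"] by (simp add: vnorm_uminus minus_add_uminus_vec)

lemma vnorm_add_ge:
  assumes "v \<in> carrier_vec n" "w \<in> carrier_vec n" shows "vnorm (v + w) \<ge> vnorm v - vnorm w"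
proof -
  have "v = (v + w) - w" using assms by auto
  thus ?thesis using vnorm_minus_le[of "v + w" n w] assms by (metis add_carrier_vec diff_le_eq)
qed

lemma vnorm_component: "v \<in> carrier_vec n \<Longrightarrow> i < n \<Longrightarrow> cmod (v $ i) \<le> vnorm v"
  unfolding vnorm_def by (rule member_le_L2_set) auto

lemma cdot_Cauchy_Schwarz:
  assumes "v \<in> carrier_vec n" "w \<in> carrier_vec n" shows "cmod (v \<bullet>c w) \<le> vnorm v * vnorm w"
proof -
  have "cmod (v \<bullet>c w) \<le> (\<Sum>i<n. \<bar>cmod (v $ i)\<bar> * \<bar>cmod (w $ i)\<bar>)"
    unfolding cdot_sum[OF assms(2)] by (rule order.trans[OF norm_sum]) (simp add: norm_mult)
  also have "\<dots> \<le> vnorm v * vnorm w"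
    using assms L2_set_mult_ineq[of "\<lambda>i. cmod (v $ i)" "\<lambda>i. cmod (w $ i)" "{..<n}"] by (simp add: vnorm_def)
  finally show ?thesis .
qed

lemma isometry_vnorm:
  assumes Q: "Q \<in> carrier_mat n m" and U: "mat_adjoint Q * Q = 1\<^sub>m m" and v: "v \<in> carrier_vec m"
  shows "vnorm (Q *\<^sub>v v) = vnorm v"
proof -
  have Qv: "Q *\<^sub>v v \<in> carrier_vec n" using Q v by simp
  have "(Q *\<^sub>v v) \<bullet>c (Q *\<^sub>v v) = v \<bullet>c (mat_adjoint Q *\<^sub>v (Q *\<^sub>v v))"
    by (rule mult_mat_vec_cdot[OF Q v Qv])
  also have "mat_adjoint Q *\<^sub>v (Q *\<^sub>v v) = v"
    using Q v U by (metis assoc_mult_mat_vec mat_adjoint_carrier one_mult_mat_vec)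
  finally have "complex_of_real ((vnorm (Q *\<^sub>v v))\<^sup>2) = complex_of_real ((vnorm v)\<^sup>2)"
    using cdot_self[OF Qv] cdot_self[OF v] by simp
  hence "(vnorm (Q *\<^sub>v v))\<^sup>2 = (vnorm v)\<^sup>2" by (simp only: of_real_eq_iff)
  thus ?thesis by (simp add: power2_eq_iff_nonneg)
qed

lemma unitary_right:
  assumes "Q \<in> carrier_mat n n" "mat_adjoint Q * Q = 1\<^sub>m n" shows "Q * mat_adjoint Q = 1\<^sub>m n"
  using mat_mult_left_right_inverse[OF _ assms(1) assms(2)] assms(1) by simp

lemma injective_inverse:
  fixes G :: "complex mat"
  assumes G: "G \<in> carrier_mat n n" and inj: "\<And>v. v \<in> carrier_vec n \<Longrightarrow> G *\<^sub>v v = 0\<^sub>v n \<Longrightarrow> v = 0\<^sub>v n"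
  obtains Gi where "Gi \<in> carrier_mat n n" "G * Gi = 1\<^sub>m n" "Gi * G = 1\<^sub>m n"
proof -
  have d: "Determinant.det G \<noteq> 0" using det_0_iff_vec_prod_zero[OF G] inj by auto
  note ad = adj_mat[OF G]
  let ?Gi = "(1 / Determinant.det G) \<cdot>\<^sub>m adj_mat G"
  have s: "(1 / Determinant.det G) \<cdot>\<^sub>m (Determinant.det G \<cdot>\<^sub>m 1\<^sub>m n) = 1\<^sub>m n"
    by (rule eq_matI) (use d in auto)
  have "G * ?Gi = 1\<^sub>m n"
    by (simp only: mult_smult_distrib[OF G ad(1)] ad(2) s)
  moreover have "?Gi * G = 1\<^sub>m n"
    by (simp only: mult_smult_assoc_mat[OF ad(1) G] ad(3) s)
  moreover have "?Gi \<in> carrier_mat n n" using ad(1) by simp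
  ultimately show ?thesis using that by blast
qed

lemma injective_imp_surjective_mat:
  fixes B :: "complex mat"
  assumes B: "B \<in> carrier_mat n n" and inj: "\<And>v. v \<in> carrier_vec n \<Longrightarrow> B *\<^sub>v v = 0\<^sub>v n \<Longrightarrow> v = 0\<^sub>v n"
    and y: "y \<in> carrier_vec n"
  obtains w where "w \<in> carrier_vec n" "B *\<^sub>v w = y"
proof -
  obtain Bi where Bi: "Bi \<in> carrier_mat n n" "B * Bi = 1\<^sub>m n"
    using injective_inverse[OF B inj] by blast
  have "B *\<^sub>v (Bi *\<^sub>v y) = y" using assoc_mult_mat_vec[OF B Bi(1) y] Bi(2) y by simp
  thus ?thesis using that[OF mult_mat_vec_carrier[OF Bi(1) y]] by blast
qed

section \<open>Orthonormal systems and their completion\<close>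

definition orthonormal :: "nat \<Rightarrow> nat \<Rightarrow> (nat \<Rightarrow> complex Matrix.vec) \<Rightarrow> bool" where
  "orthonormal n k q \<longleftrightarrow> (\<forall>i<k. q i \<in> carrier_vec n) \<and> (\<forall>i<k. \<forall>j<k. q i \<bullet>c q j = (if i = j then 1 else 0))"

definition col_mat :: "nat \<Rightarrow> nat \<Rightarrow> (nat \<Rightarrow> complex Matrix.vec) \<Rightarrow> complex mat" where
  "col_mat n k q = mat n k (\<lambda>(i,j). q j $ i)"

lemma col_mat_carrier [simp]: "col_mat n k q \<in> carrier_mat n k"
  by (simp add: col_mat_def)

lemma col_mat_adjoint_mult_vec:
  assumes "j < k" "v \<in> carrier_vec n" "q j \<in> carrier_vec n"
  shows "(mat_adjoint (col_mat n k q) *\<^sub>v v) $ j = v \<bullet>c q j"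
  using assms mult_mat_vec_index_sum[of "mat_adjoint (col_mat n k q)" k n v j]
  by (auto simp: cdot_sum col_mat_def mult.commute intro!: sum.cong)

lemma mult_col_mat:
  assumes A: "A \<in> carrier_mat m n" and "\<And>j. j < k \<Longrightarrow> q j \<in> carrier_vec n"
  shows "A * col_mat n k q = col_mat m k (\<lambda>j. A *\<^sub>v q j)"
proof (rule eq_matI)
  fix i j assume "i < dim_row (col_mat m k (\<lambda>j. A *\<^sub>v q j))" "j < dim_col (col_mat m k (\<lambda>j. A *\<^sub>v q j))"
  hence ij: "i < m" "j < k" by (auto simp: col_mat_def)
  show "(A * col_mat n k q) $$ (i,j) = col_mat m k (\<lambda>j. A *\<^sub>v q j) $$ (i,j)"
    using mat_mult_index_sum[OF A col_mat_carrier ij, of q] ij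
      mult_mat_vec_index_sum[OF A assms(2)[OF ij(2)] ij(1)] by (simp add: col_mat_def)
qed (use A in \<open>auto simp: col_mat_def\<close>)

lemma orthonormal_isometry:
  assumes "orthonormal n k q" shows "mat_adjoint (col_mat n k q) * col_mat n k q = 1\<^sub>m k"
proof (rule eq_matI)
  fix i j assume "i < dim_row (1\<^sub>m k :: complex mat)" "j < dim_col (1\<^sub>m k :: complex mat)"
  hence ij: "i < k" "j < k" by auto
  have "(mat_adjoint (col_mat n k q) * col_mat n k q) $$ (i,j) = (\<Sum>l<n. cnj (q i $ l) * q j $ l)"
    using ij by (subst mat_mult_index_sum[of _ k n _ k]) (auto simp: col_mat_def)
  also have "\<dots> = q j \<bullet>c q i"
    using assms ij by (subst cdot_sum[of _ n]) (auto simp: orthonormal_def mult.commute)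
  finally show "(mat_adjoint (col_mat n k q) * col_mat n k q) $$ (i,j) = 1\<^sub>m k $$ (i,j)"
    using assms ij by (simp add: orthonormal_def)
qed (auto simp: col_mat_def)

lemma orthonormal_complete:
  assumes o: "orthonormal n n q" and v: "v \<in> carrier_vec n" and z: "\<And>i. i < n \<Longrightarrow> v \<bullet>c q i = 0"
  shows "v = 0\<^sub>v n"
proof -
  let ?Q = "col_mat n n q"
  have "mat_adjoint ?Q *\<^sub>v v = 0\<^sub>v n"
  proof (rule eq_vecI)
    fix i assume i: "i < dim_vec (0\<^sub>v n :: complex Matrix.vec)"
    show "(mat_adjoint ?Q *\<^sub>v v) $ i = 0\<^sub>v n $ i"
      using i o col_mat_adjoint_mult_vec[of i n v n q] v z by (auto simp: orthonormal_def)
  qed (auto simp: col_mat_def)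
  hence "(?Q * mat_adjoint ?Q) *\<^sub>v v = ?Q *\<^sub>v 0\<^sub>v n"
    using v by (metis assoc_mult_mat_vec col_mat_carrier mat_adjoint_carrier)
  hence "1\<^sub>m n *\<^sub>v v = ?Q *\<^sub>v 0\<^sub>v n"
    using unitary_right[OF col_mat_carrier orthonormal_isometry[OF o]] by simp
  moreover have "?Q *\<^sub>v 0\<^sub>v n = 0\<^sub>v n" by (intro eq_vecI) (auto simp: col_mat_def scalar_prod_def)
  ultimately show ?thesis using v by simp
qed

text \<open>Padding the k equations with zero rows gives a square matrix \<open>A\<close>. Its row k
  vanishes, so the adjoint annihilates the k-th unit vector, and the determinants of the adjoint and
  of \<open>A\<close> are both zero.\<close>

lemma nontrivial_kernel:
  fixes f :: "nat \<Rightarrow> nat \<Rightarrow> complex"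
  assumes "k < n"
  obtains v where "v \<in> carrier_vec n" "v \<noteq> 0\<^sub>v n" "\<And>i. i < k \<Longrightarrow> (\<Sum>j<n. f i j * v $ j) = 0"
proof -
  define A where "A = mat n n (\<lambda>(i,j). if i < k then f i j else 0)"
  have A: "A \<in> carrier_mat n n" by (simp add: A_def)
  have "mat_adjoint A *\<^sub>v unit_vec n k = 0\<^sub>v n"
  proof (rule eq_vecI)
    fix i assume "i < dim_vec (0\<^sub>v n :: complex Matrix.vec)"
    hence i: "i < n" by simp
    show "(mat_adjoint A *\<^sub>v unit_vec n k) $ i = 0\<^sub>v n $ i"
      using mult_mat_vec_index_sum[of "mat_adjoint A" n n "unit_vec n k" i] A i assms
      by (auto simp: A_def unit_vec_def intro!: sum.neutral)
  qed (auto simp: A_def)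
  hence "Determinant.det (mat_adjoint A) = 0"
    using det_0_iff_vec_prod_zero[of "mat_adjoint A" n] A assms unit_vec_carrier[of n k]
    by (metis mat_adjoint_carrier unit_vec_nonzero)
  moreover have "Determinant.det (mat_adjoint A) = cnj (Determinant.det A)"
  proof -
    have "mat_adjoint A = transpose_mat (map_mat cnj A)"
      by (rule eq_matI) auto
    hence "Determinant.det (mat_adjoint A) = Determinant.det (map_mat cnj A)"
      using A by (simp add: det_transpose[of _ n])
    also have "\<dots> = cnj (Determinant.det A)"
      using A by (subst (1 2) det_def') (auto simp: permutes_def intro!: sum.cong prod.cong arg_cong2[where f="(*)"] simp flip: of_int_eq_iff)
    finally show ?thesis .
  qed
  ultimately have "Determinant.det A = 0" by simp
  then obtain v where v: "v \<in> carrier_vec n" "v \<noteq> 0\<^sub>v n" "A *\<^sub>v v = 0\<^sub>v n"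
    using det_0_iff_vec_prod_zero[OF A] by auto
  have "(\<Sum>j<n. f i j * v $ j) = 0" if "i < k" for i
  proof -
    have "(\<Sum>j<n. f i j * v $ j) = (A *\<^sub>v v) $ i"
      using mult_mat_vec_index_sum[OF A v(1), of i] that assms by (simp add: A_def)
    thus ?thesis using that assms v(3) by simp
  qed
  thus ?thesis using that v by blast
qed

lemma vnorm_normalize:
  assumes "v \<in> carrier_vec n" "v \<noteq> 0\<^sub>v n"
  shows "((1 / complex_of_real (vnorm v)) \<cdot>\<^sub>v v) \<bullet>c ((1 / complex_of_real (vnorm v)) \<cdot>\<^sub>v v) = 1"
  using vnorm_pos[OF assms] assms(1)
  by (subst cdot_self[of _ n]) (auto simp: vnorm_smult norm_divide)

lemma smult_cdot: "v \<in> carrier_vec n \<Longrightarrow> w \<in> carrier_vec n \<Longrightarrow> (a \<cdot>\<^sub>v v) \<bullet>c w = a * (v \<bullet>c w)"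
  by (simp add: cdot_sum sum_distrib_left mult.assoc)

lemma cdot_smult: "v \<in> carrier_vec n \<Longrightarrow> w \<in> carrier_vec n \<Longrightarrow> v \<bullet>c (a \<cdot>\<^sub>v w) = cnj a * (v \<bullet>c w)"
  by (simp add: cdot_sum[of _ n] sum_distrib_left mult_ac)

lemma cdot_commute: "v \<in> carrier_vec n \<Longrightarrow> w \<in> carrier_vec n \<Longrightarrow> v \<bullet>c w = cnj (w \<bullet>c v)"
  by (simp add: cdot_sum[of _ n] mult.commute)

lemma orthonormal_Suc:
  assumes "orthonormal n k q" "v \<in> carrier_vec n" "v \<bullet>c v = 1" "\<And>i. i < k \<Longrightarrow> v \<bullet>c q i = 0"
  shows "orthonormal n (Suc k) (q(k := v))"
proof -
  have "q i \<bullet>c v = 0" if "i < k" for i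
    using cdot_commute[of "q i" n v] that assms by (simp add: orthonormal_def)
  thus ?thesis using assms by (auto simp: orthonormal_def less_Suc_eq)
qed

lemma orthonormal_extend:
  assumes o: "orthonormal n k q" and kn: "k < n"
  obtains v where "orthonormal n (Suc k) (q(k := v))"
proof -
  obtain v where v: "v \<in> carrier_vec n" "v \<noteq> 0\<^sub>v n" "\<And>i. i < k \<Longrightarrow> (\<Sum>j<n. cnj (q i $ j) * v $ j) = 0"
    using nontrivial_kernel[OF kn, of "\<lambda>i j. cnj (q i $ j)"] by auto
  let ?v = "(1 / complex_of_real (vnorm v)) \<cdot>\<^sub>v v"
  have "v \<bullet>c q i = 0" if "i < k" for i
    using v(3)[OF that] o that by (simp add: orthonormal_def cdot_sum[of _ n] mult.commute)
  hence "?v \<bullet>c q i = 0" if "i < k" for i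
    using smult_cdot[OF v(1), of "q i"] o that by (simp add: orthonormal_def)
  hence "orthonormal n (Suc k) (q(k := ?v))"
    using o v vnorm_normalize[OF v(1,2)] by (intro orthonormal_Suc) auto
  thus ?thesis using that by blast
qed

lemma orthonormal_completion:
  assumes "orthonormal n k q" "k \<le> n"
  shows "\<exists>q'. orthonormal n n q' \<and> (\<forall>i<k. q' i = q i)"
  using assms
proof (induction "n - k" arbitrary: k q)
  case 0 thus ?case by auto
next
  case (Suc d)
  hence kn: "k < n" by simp
  obtain v where v: "orthonormal n (Suc k) (q(k := v))" using orthonormal_extend[OF Suc.prems(1) kn] .
  have "\<exists>q'. orthonormal n n q' \<and> (\<forall>i<Suc k. q' i = (q(k := v)) i)"
    using Suc.hyps(2) kn by (intro Suc.hyps(1)[OF _ v]) auto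
  thus ?case by (metis fun_upd_other less_Suc_eq less_irrefl_nat)
qed

section \<open>Spectral theorem for Hermitian matrices\<close>

lemma complex_eigenvector:
  fixes A :: "complex mat"
  assumes A: "A \<in> carrier_mat n n" and "n > 0"
  obtains \<mu> v where "v \<in> carrier_vec n" "v \<noteq> 0\<^sub>v n" "A *\<^sub>v v = \<mu> \<cdot>\<^sub>v v"
proof -
  obtain \<mu> where "eigenvalue A \<mu>"
    using spectrum_non_empty[OF A] assms(2) by (auto simp: spectrum_def)
  thus ?thesis using that A by (auto simp: eigenvalue_def eigenvector_def)
qed


lemma hermitian_real_eigenvalue:
  assumes A: "A \<in> carrier_mat n n" "mat_adjoint A = A" and v: "v \<in> carrier_vec n" "v \<noteq> 0\<^sub>v n"
    and e: "A *\<^sub>v v = \<mu> \<cdot>\<^sub>v v"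
  shows "\<mu> = complex_of_real (Re \<mu>)"
proof -
  have "\<mu> * (v \<bullet>c v) = cnj \<mu> * (v \<bullet>c v)"
    using mult_mat_vec_cdot[OF A(1) v(1) v(1)] A(2) e v(1) by (simp add: smult_cdot cdot_smult)
  moreover have "v \<bullet>c v \<noteq> 0" using vnorm_pos[OF v] v(1) by (simp add: cdot_self[of _ n])
  ultimately have "\<mu> = cnj \<mu>" by simp
  thus ?thesis by (simp add: complex_eq_iff)
qed

text \<open>The columns of \<open>V\<close> span the orthogonal complement of the eigenvectors found
  so far. A Hermitian \<open>A\<close> maps this complement into itself, so an eigenvector of the
  compression \<open>C\<close> lifts through \<open>V\<close> to an eigenvector of
  \<open>A\<close>.\<close>

lemma hermitian_eigenvector_extend:
  assumes A: "A \<in> carrier_mat n n" "mat_adjoint A = A" and o: "orthonormal n k q" and k: "k < n"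
    and ev: "\<And>i. i < k \<Longrightarrow> A *\<^sub>v q i = complex_of_real (d i) \<cdot>\<^sub>v q i"
  obtains v x where "orthonormal n (Suc k) (q(k := v))" "A *\<^sub>v v = complex_of_real x \<cdot>\<^sub>v v"
proof -
  obtain q' where q': "orthonormal n n q'" "\<And>i. i < k \<Longrightarrow> q' i = q i"
    using orthonormal_completion[OF o] k by auto
  have qc: "q' i \<in> carrier_vec n" if "i < n" for i using q' that by (simp add: orthonormal_def)
  define V where "V = col_mat n (n - k) (\<lambda>j. q' (k + j))"
  have V: "V \<in> carrier_mat n (n - k)" by (simp add: V_def)
  have V': "mat_adjoint V \<in> carrier_mat (n - k) n" using V by simp
  have "orthonormal n (n - k) (\<lambda>j. q' (k + j))" using q' by (auto simp: orthonormal_def)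
  hence VV: "mat_adjoint V * V = 1\<^sub>m (n - k)" unfolding V_def by (rule orthonormal_isometry)
  define C where "C = mat_adjoint V * (A * V)"
  have C: "C \<in> carrier_mat (n - k) (n - k)"
    unfolding C_def using V V' A by (meson mult_carrier_mat)
  obtain \<mu> y where y: "y \<in> carrier_vec (n - k)" "y \<noteq> 0\<^sub>v (n - k)" "C *\<^sub>v y = \<mu> \<cdot>\<^sub>v y"
    using complex_eigenvector[OF C] zero_less_diff[of n k] k by blast
  define v where "v = V *\<^sub>v y"
  have v: "v \<in> carrier_vec n" using V y by (simp add: v_def)
  have Av: "A *\<^sub>v v \<in> carrier_vec n" using A v by simp
  have "vnorm v = vnorm y" unfolding v_def by (rule isometry_vnorm[OF V VV y(1)])
  hence v0: "v \<noteq> 0\<^sub>v n" using vnorm_pos[OF y(1,2)] by auto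
  have vq: "v \<bullet>c q' i = 0" if "i < k" for i
  proof -
    have "mat_adjoint V *\<^sub>v q' i = 0\<^sub>v (n - k)"
    proof (rule eq_vecI)
      fix j assume "j < dim_vec (0\<^sub>v (n - k) :: complex Matrix.vec)"
      hence j: "j < n - k" by simp
      have "(mat_adjoint V *\<^sub>v q' i) $ j = q' i \<bullet>c q' (k + j)"
        unfolding V_def using j that k by (intro col_mat_adjoint_mult_vec) (auto intro: qc)
      moreover have "q' i \<bullet>c q' (k + j) = 0" using q'(1) j that by (simp add: orthonormal_def)
      ultimately show "(mat_adjoint V *\<^sub>v q' i) $ j = 0\<^sub>v (n - k) $ j" using j by simp
    qed (use V in simp)
    hence "v \<bullet>c q' i = y \<bullet>c 0\<^sub>v (n - k)"
      using mult_mat_vec_cdot[OF V y(1) qc[of i]] that k by (simp add: v_def)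
    thus ?thesis using y by (simp add: cdot_sum[of _ "n - k"])
  qed
  have Avq: "(A *\<^sub>v v) \<bullet>c q' i = 0" if "i < k" for i
    using mult_mat_vec_cdot[OF A(1) v qc[of i]] that k vq[OF that] ev[OF that] q'(2)[OF that] A(2) qc[of i]
    by (simp add: cdot_smult[OF v])
  have "mat_adjoint V *\<^sub>v (A *\<^sub>v v) = \<mu> \<cdot>\<^sub>v y"
  proof -
    have AV: "A * V \<in> carrier_mat n (n - k)" using A V by simp
    have "mat_adjoint V *\<^sub>v (A *\<^sub>v v) = mat_adjoint V *\<^sub>v ((A * V) *\<^sub>v y)"
      using assoc_mult_mat_vec[OF A(1) V y(1)] by (simp add: v_def)
    also have "\<dots> = C *\<^sub>v y"
      unfolding C_def by (rule assoc_mult_mat_vec[OF V' AV y(1), symmetric])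
    finally show ?thesis using y by simp
  qed
  moreover have "mat_adjoint V *\<^sub>v v = y"
    using VV y(1) V V' by (metis assoc_mult_mat_vec one_mult_mat_vec v_def)
  ultimately have e2: "(A *\<^sub>v v) \<bullet>c q' (k + j) = \<mu> * (v \<bullet>c q' (k + j))" if "j < n - k" for j
    using col_mat_adjoint_mult_vec[of j "n - k" "A *\<^sub>v v" n "\<lambda>j. q' (k + j)"]
      col_mat_adjoint_mult_vec[of j "n - k" v n "\<lambda>j. q' (k + j)"] that Av v qc[of "k + j"] y(1)
    by (auto simp: V_def)
  \<comment> \<open>Tested against the basis: both terms are orthogonal to the first k vectors, and
    along the remaining ones they agree because \<open>y\<close> is an eigenvector of the
    compression.\<close>
  have "A *\<^sub>v v - \<mu> \<cdot>\<^sub>v v = 0\<^sub>v n"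
  proof (rule orthonormal_complete[OF q'(1)])
    fix i assume i: "i < n"
    have "(A *\<^sub>v v - \<mu> \<cdot>\<^sub>v v) \<bullet>c q' i = (A *\<^sub>v v) \<bullet>c q' i - \<mu> * (v \<bullet>c q' i)"
      using Av v qc[OF i] A by (simp add: cdot_sum[of _ n] sum_distrib_left algebra_simps sum_subtractf)
    also have "\<dots> = 0"
      using vq[of i] Avq[of i] e2[of "i - k"] i by (cases "i < k") auto
    finally show "(A *\<^sub>v v - \<mu> \<cdot>\<^sub>v v) \<bullet>c q' i = 0" .
  qed (use Av v in auto)
  hence e: "A *\<^sub>v v = \<mu> \<cdot>\<^sub>v v"
  proof (intro eq_vecI)
    fix i assume "i < dim_vec (\<mu> \<cdot>\<^sub>v v)"
    hence i: "i < n" using v by simp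
    have "(A *\<^sub>v v - \<mu> \<cdot>\<^sub>v v) $ i = 0" using \<open>A *\<^sub>v v - \<mu> \<cdot>\<^sub>v v = 0\<^sub>v n\<close> i by simp
    thus "(A *\<^sub>v v) $ i = (\<mu> \<cdot>\<^sub>v v) $ i" using i Av v by (simp del: index_mult_mat_vec)
  qed (use A v in simp)
  let ?a = "1 / complex_of_real (vnorm v)"
  have "orthonormal n (Suc k) (q(k := ?a \<cdot>\<^sub>v v))"
    using o v vnorm_normalize[OF v v0] vq q'(2) qc k
    by (intro orthonormal_Suc) (auto simp: smult_cdot orthonormal_def)
  moreover have "A *\<^sub>v (?a \<cdot>\<^sub>v v) = complex_of_real (Re \<mu>) \<cdot>\<^sub>v (?a \<cdot>\<^sub>v v)"
    using mult_mat_vec[OF A(1) v, of ?a] e hermitian_real_eigenvalue[OF A v v0 e]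
    by (simp add: smult_smult_assoc mult.commute)
  ultimately show ?thesis using that by blast
qed

theorem hermitian_spectral:
  assumes A: "A \<in> carrier_mat n n" "mat_adjoint A = A"
  obtains q d where "orthonormal n n q" "\<And>i. i < n \<Longrightarrow> A *\<^sub>v q i = complex_of_real (d i) \<cdot>\<^sub>v q i"
proof -
  have "\<exists>q d. orthonormal n k q \<and> (\<forall>i<k. A *\<^sub>v q i = complex_of_real (d i) \<cdot>\<^sub>v q i)" if "k \<le> n" for k
    using that
  proof (induction k)
    case 0 thus ?case by (auto simp: orthonormal_def)
  next
    case (Suc k)
    then obtain q d where q: "orthonormal n k q" "\<And>i. i < k \<Longrightarrow> A *\<^sub>v q i = complex_of_real (d i) \<cdot>\<^sub>v q i"
      by auto
    obtain v x where v: "orthonormal n (Suc k) (q(k := v))" "A *\<^sub>v v = complex_of_real x \<cdot>\<^sub>v v"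
      using hermitian_eigenvector_extend[OF A q(1) _ q(2)] Suc.prems by auto
    have "\<forall>i<Suc k. A *\<^sub>v (q(k := v)) i = complex_of_real ((d(k := x)) i) \<cdot>\<^sub>v (q(k := v)) i"
      using v(2) q(2) by (auto simp: less_Suc_eq)
    thus ?case using v(1) by blast
  qed
  thus ?thesis using that by blast
qed

section \<open>Singular value decomposition\<close>

lemma sorting_permutation:
  fixes d :: "nat \<Rightarrow> real"
  obtains p where "bij_betw p {..<n} {..<n}" "\<And>i j. i \<le> j \<Longrightarrow> j < n \<Longrightarrow> d (p j) \<le> d (p i)"
proof -
  let ?xs = "sort_key (\<lambda>i. - d i) [0..<n]"
  have "bij_betw ((!) ?xs) {..<n} {..<n}"
    by (rule bij_betw_nth) (auto simp: atLeast0LessThan)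
  moreover have "d (?xs ! j) \<le> d (?xs ! i)" if "i \<le> j" "j < n" for i j
    using sorted_nth_mono[OF sorted_sort_key[of "\<lambda>i. - d i" "[0..<n]"], of i j] that by simp
  ultimately show ?thesis using that by blast
qed

text \<open>The right singular vectors are eigenvectors of the Gram matrix of \<open>A\<close> in
  decreasing order. The left ones are the normalised images under \<open>A\<close> for the r
  positive eigenvalues, completed to a basis. Existence matters because the selection of an ESPRIT
  output is constrained only when some output exists.\<close>

theorem svd_exists:
  assumes A: "A \<in> carrier_mat n n"
  obtains W Sg V where "is_svd A W Sg V"
proof -
  let ?H = "mat_adjoint A * A"
  have A': "mat_adjoint A \<in> carrier_mat n n" using A by simp
  have H: "?H \<in> carrier_mat n n" "mat_adjoint ?H = ?H" using A by (auto simp: mat_adjoint_mult[OF A' A])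
  obtain q0 d0 where q0: "orthonormal n n q0" "\<And>i. i < n \<Longrightarrow> ?H *\<^sub>v q0 i = complex_of_real (d0 i) \<cdot>\<^sub>v q0 i"
    using hermitian_spectral[OF H] by blast
  obtain p where p: "bij_betw p {..<n} {..<n}" "\<And>i j. i \<le> j \<Longrightarrow> j < n \<Longrightarrow> d0 (p j) \<le> d0 (p i)"
    using sorting_permutation[of n d0] by blast
  define q where "q = (\<lambda>i. q0 (p i))"
  define d where "d = (\<lambda>i. d0 (p i))"
  have pn: "p i < n" if "i < n" for i using p(1) that by (auto simp: bij_betw_def)
  have pinj: "p i = p j \<longleftrightarrow> i = j" if "i < n" "j < n" for i j
    using p(1) that by (auto simp: bij_betw_def inj_on_def)
  have o: "orthonormal n n q" using q0(1) pn pinj by (auto simp: orthonormal_def q_def)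
  have qc: "q i \<in> carrier_vec n" if "i < n" for i using o that by (simp add: orthonormal_def)
  have Hq: "?H *\<^sub>v q i = complex_of_real (d i) \<cdot>\<^sub>v q i" if "i < n" for i
    using q0(2)[OF pn[OF that]] by (simp add: q_def d_def)
  have AA: "(A *\<^sub>v q i) \<bullet>c (A *\<^sub>v q j) = (if i = j then complex_of_real (d i) else 0)" if "i < n" "j < n" for i j
  proof -
    have Aq: "A *\<^sub>v q j \<in> carrier_vec n" using A qc[OF that(2)] by simp
    have "(A *\<^sub>v q i) \<bullet>c (A *\<^sub>v q j) = q i \<bullet>c (?H *\<^sub>v q j)"
      using mult_mat_vec_cdot[OF A qc[OF that(1)] Aq] assoc_mult_mat_vec[OF A' A qc[OF that(2)]] by simp
    also have "\<dots> = complex_of_real (d j) * (q i \<bullet>c q j)"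
      using Hq[OF that(2)] qc that by (simp add: cdot_smult[of _ n])
    finally show ?thesis using o that by (simp add: orthonormal_def)
  qed
  have dnn: "d i = (vnorm (A *\<^sub>v q i))\<^sup>2" if "i < n" for i
    using AA[OF that that] cdot_self[of "A *\<^sub>v q i" n] A qc[OF that] by (simp del: of_real_power flip: of_real_power)
  define r where "r = card {i. i < n \<and> d i > 0}"
  have mono: "d j \<le> d i" if "i \<le> j" "j < n" for i j using p(2)[OF that] by (simp add: d_def)
  have r_iff: "i < r \<longleftrightarrow> d i > 0" if "i < n" for i
  proof
    assume "d i > 0"
    hence "{..i} \<subseteq> {i. i < n \<and> d i > 0}" using mono that by (auto intro: less_le_trans)
    hence "card {..i} \<le> r" unfolding r_def by (intro card_mono) auto
    thus "i < r" by simp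
  next
    assume ir: "i < r"
    show "d i > 0"
    proof (rule ccontr)
      assume n: "\<not> d i > 0"
      have "{j. j < n \<and> d j > 0} \<subseteq> {..<i}"
      proof
        fix j assume j: "j \<in> {j. j < n \<and> d j > 0}"
        show "j \<in> {..<i}" using mono[of i j] n j by (cases "i \<le> j") auto
      qed
      hence "r \<le> card {..<i}" unfolding r_def by (intro card_mono) auto
      thus False using ir by simp
    qed
  qed
  have rn: "r \<le> n" unfolding r_def using card_mono[of "{..<n}" "{i. i < n \<and> d i > 0}"] by auto
  define w where "w = (\<lambda>i. (1 / complex_of_real (sqrt (d i))) \<cdot>\<^sub>v (A *\<^sub>v q i))"
  have wc: "w i \<in> carrier_vec n" if "i < n" for i using A qc[OF that] by (simp add: w_def)
  have "orthonormal n r w"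
    unfolding orthonormal_def
  proof (intro conjI allI impI)
    fix i j assume ij: "i < r" "j < r"
    hence ijn: "i < n" "j < n" using rn by auto
    have "w i \<bullet>c w j = (1 / complex_of_real (sqrt (d i))) * (1 / complex_of_real (sqrt (d j))) * ((A *\<^sub>v q i) \<bullet>c (A *\<^sub>v q j))"
      using A qc ijn by (simp add: w_def smult_cdot[of _ n] cdot_smult[of _ n])
    also have "\<dots> = (if i = j then 1 else 0)"
      using AA[OF ijn] r_iff[OF ijn(1)] ij
      by (auto simp flip: of_real_mult)
    finally show "w i \<bullet>c w j = (if i = j then 1 else 0)" .
  qed (use wc rn in auto)
  then obtain w' where w': "orthonormal n n w'" "\<And>i. i < r \<Longrightarrow> w' i = w i"
    using orthonormal_completion[OF _ rn] by blast
  have w'c: "w' i \<in> carrier_vec n" if "i < n" for i using w' that by (simp add: orthonormal_def)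
  \<comment> \<open>Beyond the rank r the eigenvalue is zero and so is
    \<open>A *\<^sub>v q i\<close>, so the arbitrary completion \<open>w'\<close> does not disturb
    the factorisation.\<close>
  have Aq: "A *\<^sub>v q i = complex_of_real (sqrt (d i)) \<cdot>\<^sub>v w' i" if i: "i < n" for i
  proof (cases "i < r")
    case True
    thus ?thesis using w'(2) r_iff[OF i] by (simp add: w_def smult_smult_assoc)
  next
    case False
    hence "d i = 0" using r_iff[OF i] dnn[OF i] by (metis less_eq_real_def zero_le_power2)
    moreover from this have "A *\<^sub>v q i = 0\<^sub>v n"
      using dnn[OF i] vnorm_eq_0[of "A *\<^sub>v q i" n] A qc[OF i] by simp
    ultimately show ?thesis using w'c[OF i] by auto
  qed
  let ?W = "col_mat n n w'" and ?V = "col_mat n n q"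
  define Sg where "Sg = mat n n (\<lambda>(i,j). if i = j then complex_of_real (sqrt (d i)) else 0)"
  have "A * ?V = ?W * Sg"
  proof -
    have "A * ?V = col_mat n n (\<lambda>j. A *\<^sub>v q j)" by (rule mult_col_mat[OF A]) (rule qc)
    also have "\<dots> = ?W * Sg"
    proof (rule eq_matI)
      fix i j assume "i < dim_row (?W * Sg)" "j < dim_col (?W * Sg)"
      hence ij: "i < n" "j < n" by (auto simp: col_mat_def Sg_def)
      have "(?W * Sg) $$ (i,j) = (\<Sum>l<n. w' l $ i * (if l = j then complex_of_real (sqrt (d l)) else 0))"
        using ij by (subst mat_mult_index_sum[of _ n n _ n]) (auto simp: col_mat_def Sg_def)
      also have "\<dots> = (\<Sum>l<n. if l = j then w' j $ i * complex_of_real (sqrt (d j)) else 0)"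
        by (rule sum.cong) auto
      also have "\<dots> = w' j $ i * complex_of_real (sqrt (d j))"
        using ij by simp
      finally show "col_mat n n (\<lambda>j. A *\<^sub>v q j) $$ (i,j) = (?W * Sg) $$ (i,j)"
        using ij Aq[OF ij(2)] w'c[OF ij(2)] by (simp add: col_mat_def)
    qed (auto simp: col_mat_def Sg_def)
    finally show ?thesis .
  qed
  hence "A * ?V * mat_adjoint ?V = ?W * Sg * mat_adjoint ?V" by simp
  moreover have "A * ?V * mat_adjoint ?V = A"
    using A unitary_right[OF col_mat_carrier orthonormal_isometry[OF o]]
    by (metis assoc_mult_mat col_mat_carrier mat_adjoint_carrier right_mult_one_mat)
  ultimately have eq: "A = ?W * Sg * mat_adjoint ?V" by simp
  have dims: "dim_row A = n" "dim_col A = n" using A by auto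
  have "is_svd A ?W Sg ?V"
    unfolding is_svd_def dims
    using eq orthonormal_isometry[OF o] orthonormal_isometry[OF w'(1)] mono dnn
    by (auto simp: Sg_def)
  thus ?thesis using that by blast
qed

section \<open>Eigenvalues of a perturbed diagonal matrix\<close>

lemma diag_vnorm_ge:
  assumes "x \<in> carrier_vec n" "c \<ge> 0" "\<And>i. i < n \<Longrightarrow> c \<le> cmod (a i)"
  shows "c * vnorm x \<le> vnorm (Matrix.vec n (\<lambda>i. a i * x $ i))"
proof -
  have "c * vnorm x = L2_set (\<lambda>i. c * cmod (x $ i)) {..<n}"
    using assms by (simp add: vnorm_def L2_set_right_distrib)
  also have "\<dots> \<le> L2_set (\<lambda>i. cmod (a i * x $ i)) {..<n}"
    using assms by (intro L2_set_mono) (auto simp: norm_mult intro!: mult_right_mono)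
  also have "\<dots> = vnorm (Matrix.vec n (\<lambda>i. a i * x $ i))" by (simp add: vnorm_def L2_set_def)
  finally show ?thesis .
qed

lemma diag_vnorm_eq:
  assumes "x \<in> carrier_vec n" "\<And>i. i < n \<Longrightarrow> cmod (a i) = 1"
  shows "vnorm (Matrix.vec n (\<lambda>i. a i * x $ i)) = vnorm x"
  using assms by (auto simp: vnorm_def norm_mult intro!: L2_set_cong)

text \<open>Pigeonhole: the S open intervals (2kg, (2k+2)g) are disjoint and \<open>d s = 0\<close>
  lies in none of them, so the remaining S - 1 values cannot hit them all.\<close>

lemma radius_avoiding:
  fixes d :: "nat \<Rightarrow> real"
  assumes "s < S" "d s = 0" "g > 0"
  shows "\<exists>k<S. \<forall>t<S. g \<le> \<bar>d t - (2 * real k + 1) * g\<bar>"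
proof (rule ccontr)
  assume n: "\<not> (\<exists>k<S. \<forall>t<S. g \<le> \<bar>d t - (2 * real k + 1) * g\<bar>)"
  have "\<exists>t<S. \<bar>d t - (2 * real k + 1) * g\<bar> < g" if "k < S" for k
    using n that by (force simp: not_le)
  then obtain t where t: "\<And>k. k < S \<Longrightarrow> t k < S \<and> \<bar>d (t k) - (2 * real k + 1) * g\<bar> < g" by metis
  have "inj_on t {..<S}"
  proof (rule inj_onI)
    fix k k' assume k: "k \<in> {..<S}" "k' \<in> {..<S}" "t k = t k'"
    have "\<bar>(2 * real k + 1) * g - (2 * real k' + 1) * g\<bar> < 2 * g"
      using t[of k] t[of k'] k by (smt (verit, best) lessThan_iff)
    moreover have "(2 * real k + 1) * g - (2 * real k' + 1) * g = (real k - real k') * (2 * g)"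
      by (simp add: algebra_simps)
    ultimately have "\<bar>real k - real k'\<bar> < 1" using assms(3) by (simp add: abs_mult)
    thus "k = k'" by linarith
  qed
  moreover have "t k \<noteq> s" if "k < S" for k
  proof
    assume "t k = s"
    hence "\<bar>(2 * real k + 1) * g\<bar> < g" using t[OF that] assms by simp
    moreover have "(2 * real k + 1) * g \<ge> 1 * g" using assms(3) by (intro mult_right_mono) auto
    ultimately show False by linarith
  qed
  hence "t ` {..<S} \<subseteq> {..<S} - {s}" using t by auto
  ultimately have "card {..<S} \<le> card ({..<S} - {s})" by (intro card_inj_on_le) auto
  thus False using assms(1) by simp
qed

lemma holomorphic_det:
  assumes "\<And>i j. i < n \<Longrightarrow> j < n \<Longrightarrow> (\<lambda>x. F x i j) holomorphic_on X"
  shows "(\<lambda>x. Determinant.det (mat n n (\<lambda>(i,j). F x i j))) holomorphic_on X"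
proof -
  have "Determinant.det (mat n n (\<lambda>(i,j). F x i j))
    = (\<Sum>p | p permutes {0..<n}. of_int (sign p) * (\<Prod>i = 0..<n. F x i (p i)))" for x
    by (subst det_def'[of _ n])
      (auto intro!: sum.cong prod.cong arg_cong2[where f="(*)"] dest: permutes_in_image)
  moreover have "(\<lambda>x. (\<Sum>p | p permutes {0..<n}. of_int (sign p) * (\<Prod>i = 0..<n. F x i (p i)))) holomorphic_on X"
    by (intro holomorphic_on_sum holomorphic_intros assms) (auto dest: permutes_in_image)
  ultimately show ?thesis by simp
qed

context
  fixes S :: nat and Psi B :: "complex mat" and z :: "nat \<Rightarrow> complex" and f :: real
  assumes Psi: "Psi \<in> carrier_mat S S" and B: "B \<in> carrier_mat S S"
    and Binj: "\<And>v. v \<in> carrier_vec S \<Longrightarrow> B *\<^sub>v v = 0\<^sub>v S \<Longrightarrow> v = 0\<^sub>v S"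
    and f: "f \<ge> 0"
    and pert: "\<And>w. w \<in> carrier_vec S \<Longrightarrow>
      vnorm (B *\<^sub>v (Psi *\<^sub>v w) - Matrix.vec S (\<lambda>i. z i * (B *\<^sub>v w) $ i)) \<le> f * vnorm (B *\<^sub>v w)"
begin

text \<open>The assumption \<open>pert\<close> says, without writing an inverse, that the conjugate
  of \<open>Psi\<close> by \<open>B\<close> differs from diag(z) by operator norm at most f. This is
  the Bauer-Fike argument: an eigenvalue at distance c > f from all nodes would stretch
  \<open>B w\<close> by at least c in the very difference that \<open>pert\<close> bounds by
  f.\<close>

lemma perturbed_eigenvalue_near:
  assumes "eigenvalue Psi \<mu>"
  shows "\<exists>s<S. cmod (\<mu> - z s) \<le> f"
proof (rule ccontr)
  assume "\<not> (\<exists>s<S. cmod (\<mu> - z s) \<le> f)"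
  hence n: "\<And>s. s < S \<Longrightarrow> f < cmod (\<mu> - z s)" by auto
  obtain w where w: "w \<in> carrier_vec S" "w \<noteq> 0\<^sub>v S" "Psi *\<^sub>v w = \<mu> \<cdot>\<^sub>v w"
    using assms Psi by (auto simp: eigenvalue_def eigenvector_def)
  let ?x = "B *\<^sub>v w"
  have x: "?x \<in> carrier_vec S" "?x \<noteq> 0\<^sub>v S" using B Binj w by auto
  have S0: "S > 0"
  proof (rule ccontr)
    assume "\<not> S > 0"
    hence "?x = 0\<^sub>v S" by (intro eq_vecI) (use B in auto)
    thus False using x(2) by simp
  qed
  define c where "c = Min ((\<lambda>s. cmod (\<mu> - z s)) ` {..<S})"
  have "c \<in> (\<lambda>s. cmod (\<mu> - z s)) ` {..<S}" unfolding c_def using S0 by (intro Min_in) auto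
  hence c: "f < c" using n by auto
  have "B *\<^sub>v (Psi *\<^sub>v w) = \<mu> \<cdot>\<^sub>v ?x" using w mult_mat_vec[OF B w(1)] by simp
  hence "B *\<^sub>v (Psi *\<^sub>v w) - Matrix.vec S (\<lambda>i. z i * ?x $ i) = Matrix.vec S (\<lambda>i. (\<mu> - z i) * ?x $ i)"
    using x B by (intro eq_vecI) (auto simp: algebra_simps simp del: index_mult_mat_vec)
  moreover have "c * vnorm ?x \<le> vnorm (Matrix.vec S (\<lambda>i. (\<mu> - z i) * ?x $ i))"
    using c f by (intro diag_vnorm_ge[OF x(1)]) (auto simp: c_def)
  ultimately have "c * vnorm ?x \<le> f * vnorm ?x" using pert[OF w(1)] by simp
  thus False using c vnorm_pos[OF x] by simp
qed

text \<open>
  If there were no such eigenvalue, then \<open>h \<zeta> = (\<zeta> - z s) * R \<zeta>\<close>, with \<open>R \<zeta>\<close> the \<open>(s,s)\<close> entry of the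
  resolvent in the basis given by \<open>B\<close>, would be holomorphic on a disc around \<open>z s\<close>, satisfy
  \<open>|h \<zeta> - 1| < 1\<close> on its boundary, and vanish at its centre.
\<close>

lemma perturbed_eigenvalue_exists:
  assumes s: "s < S" and g: "g > 2 * f"
  shows "\<exists>\<mu>. eigenvalue Psi \<mu> \<and> cmod (\<mu> - z s) \<le> (2 * real S - 1) * g"
proof (rule ccontr)
  assume "\<not> (\<exists>\<mu>. eigenvalue Psi \<mu> \<and> cmod (\<mu> - z s) \<le> (2 * real S - 1) * g)"
  hence n: "cmod (\<mu> - z s) > (2 * real S - 1) * g" if "eigenvalue Psi \<mu>" for \<mu>
    using that by force
  have g0: "g > 0" using f g by simp
  \<comment> \<open>The circle of radius r about \<open>z s\<close> keeps distance at least g from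
    every node, and r \<le> (2S - 1)g keeps it inside the disc supposed free of eigenvalues.\<close>
  obtain k where k: "k < S" "\<And>t. t < S \<Longrightarrow> g \<le> \<bar>cmod (z t - z s) - (2 * real k + 1) * g\<bar>"
    using radius_avoiding[of s S "\<lambda>t. cmod (z t - z s)" g] s g0 by auto
  define r where "r = (2 * real k + 1) * g"
  have r0: "r > 0" using g0 by (simp add: r_def)
  have "2 * real k + 1 \<le> 2 * real S - 1" using k(1) by linarith
  hence rS: "r \<le> (2 * real S - 1) * g" unfolding r_def using g0 by (intro mult_right_mono) auto
  define F where "F = (\<lambda>\<zeta> i j. (if i = j then \<zeta> else 0) - Psi $$ (i,j))"
  define M where "M = (\<lambda>\<zeta>. mat S S (\<lambda>(i,j). F \<zeta> i j))"
  have M: "M \<zeta> \<in> carrier_mat S S" for \<zeta> by (simp add: M_def)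
  have Mv: "M \<zeta> *\<^sub>v v = \<zeta> \<cdot>\<^sub>v v - Psi *\<^sub>v v" if v: "v \<in> carrier_vec S" for v \<zeta>
  proof (rule eq_vecI)
    fix i assume "i < dim_vec (\<zeta> \<cdot>\<^sub>v v - Psi *\<^sub>v v)"
    hence i: "i < S" using Psi by simp
    have "(M \<zeta> *\<^sub>v v) $ i = (\<Sum>l<S. (if i = l then \<zeta> else 0) * v $ l) - (\<Sum>l<S. Psi $$ (i,l) * v $ l)"
      using mult_mat_vec_index_sum[OF M v i] i by (simp add: M_def F_def algebra_simps sum_subtractf)
    also have "(\<Sum>l<S. (if i = l then \<zeta> else 0) * v $ l) = (\<Sum>l<S. if i = l then \<zeta> * v $ i else 0)"
      by (rule sum.cong) auto
    finally show "(M \<zeta> *\<^sub>v v) $ i = (\<zeta> \<cdot>\<^sub>v v - Psi *\<^sub>v v) $ i"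
      using i v Psi mult_mat_vec_index_sum[OF Psi v i] by (simp del: index_mult_mat_vec add: index_minus_vec)
  qed (use Psi v M in auto)
  have det0: "Determinant.det (M \<zeta>) \<noteq> 0" if "\<zeta> \<in> cball (z s) r" for \<zeta>
  proof
    assume "Determinant.det (M \<zeta>) = 0"
    then obtain v where v: "v \<in> carrier_vec S" "v \<noteq> 0\<^sub>v S" "M \<zeta> *\<^sub>v v = 0\<^sub>v S"
      using det_0_iff_vec_prod_zero[OF M] by auto
    have "Psi *\<^sub>v v = \<zeta> \<cdot>\<^sub>v v"
    proof (rule eq_vecI)
      fix i assume "i < dim_vec (\<zeta> \<cdot>\<^sub>v v)"
      hence i: "i < S" using v by simp
      have "(\<zeta> \<cdot>\<^sub>v v - Psi *\<^sub>v v) $ i = 0" using Mv[OF v(1), of \<zeta>] v(3) i by (metis index_zero_vec(1))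
      thus "(Psi *\<^sub>v v) $ i = (\<zeta> \<cdot>\<^sub>v v) $ i" using i v(1) Psi by (simp del: index_mult_mat_vec)
    qed (use Psi v in auto)
    hence "eigenvalue Psi \<zeta>" using v Psi by (auto simp: eigenvalue_def eigenvector_def)
    thus False using n that rS by (fastforce simp: dist_norm norm_minus_commute)
  qed
  obtain b where b: "b \<in> carrier_vec S" "B *\<^sub>v b = unit_vec S s"
    using injective_imp_surjective_mat[OF B Binj unit_vec_carrier] by blast
  \<comment> \<open>With the adjugate in place of the inverse, the resolvent applied to
    \<open>b\<close> is \<open>w \<zeta>\<close> divided by the determinant. Both are built from
    determinants of matrices with entries affine in \<zeta>, which makes holomorphy visible.\<close>
  define w where "w = (\<lambda>\<zeta>. adj_mat (M \<zeta>) *\<^sub>v b)"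
  note ad = adj_mat[OF M]
  have w: "w \<zeta> \<in> carrier_vec S" for \<zeta> unfolding w_def by (rule mult_mat_vec_carrier[OF ad(1) b(1)])
  have Mw: "M \<zeta> *\<^sub>v w \<zeta> = Determinant.det (M \<zeta>) \<cdot>\<^sub>v b" for \<zeta>
  proof -
    have "M \<zeta> *\<^sub>v w \<zeta> = (M \<zeta> * adj_mat (M \<zeta>)) *\<^sub>v b"
      unfolding w_def using assoc_mult_mat_vec[OF M ad(1) b(1)] by simp
    thus ?thesis using b(1) by (intro eq_vecI) (auto simp: ad(2))
  qed
  define h where "h = (\<lambda>\<zeta>. (\<zeta> - z s) * ((B *\<^sub>v w \<zeta>) $ s / Determinant.det (M \<zeta>)))"
  have h_holo: "h holomorphic_on cball (z s) r"
  proof -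
    have Fh: "(\<lambda>\<zeta>. F \<zeta> i j) holomorphic_on X" for i j X
      unfolding F_def by (cases "i = j") (auto intro!: holomorphic_intros)
    have adj: "adj_mat (M \<zeta>) $$ (i,j) = (-1) ^ (j + i) * Determinant.det (mat (S - 1) (S - 1)
        (\<lambda>(i',j'). F \<zeta> (if i' < j then i' else Suc i') (if j' < i then j' else Suc j')))"
      if "i < S" "j < S" for i j \<zeta>
    proof -
      have "mat_delete (M \<zeta>) j i = mat (S - 1) (S - 1)
        (\<lambda>(i',j'). F \<zeta> (if i' < j then i' else Suc i') (if j' < i then j' else Suc j'))"
        unfolding mat_delete_def M_def by (rule eq_matI) auto
      thus ?thesis using that M by (simp add: adj_mat_def cofactor_def M_def)
    qed
    have "(B *\<^sub>v w \<zeta>) $ s = (\<Sum>l<S. B $$ (s,l) * (\<Sum>j<S. adj_mat (M \<zeta>) $$ (l,j) * b $ j))" for \<zeta>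
      using mult_mat_vec_index_sum[OF B w s] mult_mat_vec_index_sum[OF ad(1) b(1)] by (simp add: w_def)
    hence "(\<lambda>\<zeta>. (B *\<^sub>v w \<zeta>) $ s) holomorphic_on cball (z s) r"
      by (auto simp: adj intro!: holomorphic_intros holomorphic_on_sum holomorphic_det Fh)
    moreover have "(\<lambda>\<zeta>. Determinant.det (M \<zeta>)) holomorphic_on cball (z s) r"
      unfolding M_def by (intro holomorphic_det Fh)
    ultimately show ?thesis unfolding h_def using det0 by (auto intro!: holomorphic_intros)
  qed
  have bound: "cmod (h \<zeta> - 1) \<le> f / (g - f)" if "\<zeta> \<in> sphere (z s) r" for \<zeta>
  proof -
    have \<zeta>: "cmod (\<zeta> - z s) = r" using that by (simp add: dist_norm norm_minus_commute)
    have d: "Determinant.det (M \<zeta>) \<noteq> 0" using det0[of \<zeta>] that by auto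
    define u where "u = (1 / Determinant.det (M \<zeta>)) \<cdot>\<^sub>v w \<zeta>"
    have u: "u \<in> carrier_vec S" using w by (simp add: u_def)
    have Mu: "M \<zeta> *\<^sub>v u = b"
      using mult_mat_vec[OF M w] Mw d by (simp add: u_def smult_smult_assoc)
    define x where "x = B *\<^sub>v u"
    have x: "x \<in> carrier_vec S" using B u by (simp add: x_def)
    define e where "e = B *\<^sub>v (Psi *\<^sub>v u) - Matrix.vec S (\<lambda>i. z i * x $ i)"
    have e: "e \<in> carrier_vec S" using B Psi u x by (auto simp: e_def)
    have en: "vnorm e \<le> f * vnorm x" using pert[OF u] by (simp add: e_def x_def)
    have "unit_vec S s = B *\<^sub>v (\<zeta> \<cdot>\<^sub>v u - Psi *\<^sub>v u)" using b(2) Mu Mv[OF u] by simp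
    also have "\<dots> = \<zeta> \<cdot>\<^sub>v x - B *\<^sub>v (Psi *\<^sub>v u)"
      using mult_minus_distrib_mat_vec[OF B, of "\<zeta> \<cdot>\<^sub>v u" "Psi *\<^sub>v u"] u Psi mult_mat_vec[OF B u]
      by (simp add: x_def)
    finally have us: "unit_vec S s = \<zeta> \<cdot>\<^sub>v x - B *\<^sub>v (Psi *\<^sub>v u)" .
    \<comment> \<open>In the coordinates \<open>x = B u\<close> the resolvent equation is diagonal
      up to the small vector \<open>e\<close>.\<close>
    have comp: "(\<zeta> - z i) * x $ i = unit_vec S s $ i + e $ i" if i: "i < S" for i
    proof -
      have "unit_vec S s $ i = \<zeta> * x $ i - (B *\<^sub>v (Psi *\<^sub>v u)) $ i"
        using arg_cong[OF us, of "\<lambda>v. v $ i"] i x B by (simp del: index_mult_mat_vec index_unit_vec)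
      moreover have "e $ i = (B *\<^sub>v (Psi *\<^sub>v u)) $ i - z i * x $ i"
        using i B by (simp add: e_def del: index_mult_mat_vec)
      ultimately show ?thesis by (simp del: index_mult_mat_vec index_unit_vec add: left_diff_distrib)
    qed
    have "g * vnorm x \<le> vnorm (Matrix.vec S (\<lambda>i. (\<zeta> - z i) * x $ i))"
    proof (rule diag_vnorm_ge[OF x])
      fix i assume i: "i < S"
      have "\<zeta> - z i = (\<zeta> - z s) - (z i - z s)" by simp
      hence "\<bar>cmod (z i - z s) - r\<bar> \<le> cmod (\<zeta> - z i)"
        using norm_triangle_ineq3[of "\<zeta> - z s" "z i - z s"] \<zeta> by simp
      thus "g \<le> cmod (\<zeta> - z i)" using k(2)[OF i] by (simp add: r_def)
    qed (use g0 in simp)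
    also have "Matrix.vec S (\<lambda>i. (\<zeta> - z i) * x $ i) = unit_vec S s + e"
      using comp e by (intro eq_vecI) auto
    also have "vnorm (unit_vec S s + e) \<le> vnorm (unit_vec S s) + vnorm e"
      using e by (intro vnorm_add) auto
    also have "vnorm (unit_vec S s) = 1"
    proof -
      have "vnorm (unit_vec S s) = L2_set (\<lambda>i. if i = s then 1 else 0) {..<S}"
        unfolding vnorm_def by (intro L2_set_cong) (auto simp: s)
      also have "\<dots> = sqrt (\<Sum>i<S. if i = s then 1 else 0)"
        unfolding L2_set_def by (intro arg_cong[where f=sqrt] sum.cong) auto
      finally show ?thesis using s by simp
    qed
    finally have "vnorm x * (g - f) \<le> 1" using en by (simp add: algebra_simps)
    hence xb: "vnorm x \<le> 1 / (g - f)" using g f by (simp add: field_simps)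
    have "(B *\<^sub>v w \<zeta>) $ s / Determinant.det (M \<zeta>) = x $ s"
      using mult_mat_vec[OF B w] s B by (simp add: x_def u_def del: index_mult_mat_vec)
    hence "h \<zeta> = (\<zeta> - z s) * x $ s" by (simp only: h_def)
    hence "h \<zeta> - 1 = e $ s" using comp[OF s] s by simp
    hence "cmod (h \<zeta> - 1) \<le> vnorm e" using vnorm_component[OF e s] by simp
    also have "\<dots> \<le> f * (1 / (g - f))" using en xb f by (meson mult_left_mono order.trans)
    finally show ?thesis by simp
  qed
  have "cmod (h (z s) - 1) \<le> f / (g - f)"
  proof (rule maximum_modulus_frontier[of "\<lambda>\<zeta>. h \<zeta> - 1" "cball (z s) r"])
    show "(\<lambda>\<zeta>. h \<zeta> - 1) holomorphic_on interior (cball (z s) r)"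
      by (intro holomorphic_intros holomorphic_on_subset[OF h_holo] interior_subset)
    show "continuous_on (closure (cball (z s) r)) (\<lambda>\<zeta>. h \<zeta> - 1)"
      using holomorphic_on_imp_continuous_on[OF h_holo] by (auto intro!: continuous_intros)
    show "cmod (h \<zeta> - 1) \<le> f / (g - f)" if "\<zeta> \<in> frontier (cball (z s) r)" for \<zeta>
      using that bound r0 by (simp add: frontier_cball)
  qed (use r0 in auto)
  moreover have "h (z s) = 0" by (simp add: h_def)
  moreover have "f / (g - f) < 1" using f g by (simp add: field_simps)
  ultimately show False by simp
qed

end

section \<open>Distance to the nearest integer\<close>

lemma dist_Z_le: "dist_Z x \<le> \<bar>x - of_int m\<bar>"
  unfolding dist_Z_def by (rule cINF_lower) (auto intro!: bdd_belowI[of _ 0])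

lemma dist_Z_round: "dist_Z x = \<bar>x - of_int (round x)\<bar>"
proof (rule antisym[OF dist_Z_le])
  show "\<bar>x - of_int (round x)\<bar> \<le> dist_Z x"
    unfolding dist_Z_def by (rule cINF_greatest) (auto intro: round_diff_minimal)
qed

lemma dist_Z_nonneg [simp]: "dist_Z x \<ge> 0"
  by (simp add: dist_Z_round)

lemma dist_Z_le_iff: "dist_Z x \<le> r \<longleftrightarrow> (\<exists>m::int. \<bar>x - of_int m\<bar> \<le> r)"
  using dist_Z_le order.trans by (metis dist_Z_round order_refl)

lemma dist_Z_half: "dist_Z x \<le> 1/2"
  using of_int_round_abs_le[of x] by (simp add: dist_Z_round abs_minus_commute)

lemma dist_Z_minus: "dist_Z (- x) = dist_Z x"
proof -
  have "dist_Z (- x) \<le> dist_Z x" for x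
    using dist_Z_le[of "-x" "- round x"] by (simp add: dist_Z_round)
  from this[of x] this[of "-x"] show ?thesis by simp
qed

lemma dist_Z_commute: "dist_Z (x - y) = dist_Z (y - x)"
  using dist_Z_minus[of "x - y"] by simp

lemma dist_Z_triangle: "dist_Z (x + y) \<le> dist_Z x + dist_Z y"
  using dist_Z_le[of "x + y" "round x + round y"] by (simp add: dist_Z_round)

lemma dist_Z_add_int [simp]: "dist_Z (x + of_int k) = dist_Z x"
proof -
  have "dist_Z (x + of_int k) \<le> dist_Z x" for x k
    using dist_Z_le[of "x + of_int k" "round x + k"] by (simp add: dist_Z_round)
  from this[of x k] this[of "x + of_int k" "-k"] show ?thesis by simp
qed

section \<open>A large-sieve lower bound for Vandermonde matrices\<close>

lemma cos_ge_quadratic: "cos x \<ge> 1 - x\<^sup>2 / 2" for x :: real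
proof -
  have "cos x = 1 - 2 * (sin (x / 2))\<^sup>2" using cos_double_sin[of "x / 2"] by simp
  moreover have "(sin (x / 2))\<^sup>2 \<le> (x / 2)\<^sup>2" using abs_sin_x_le_abs_x[of "x / 2"] by (rule abs_le_square_iff[THEN iffD1])
  ultimately show ?thesis by (simp add: power_divide)
qed

lemma sin_ge_cubic:
  fixes x :: real assumes "x \<ge> 0" shows "sin x \<ge> x - x^3 / 6"
proof -
  have "sin 0 - 0 + 0^3/6 \<le> sin x - x + x^3/6"
  proof (rule DERIV_nonneg_imp_nondecreasing[OF assms])
    fix t :: real
    have "((\<lambda>x. sin x - x + x^3/6) has_real_derivative (cos t - 1 + t\<^sup>2 / 2)) (at t)"
      by (auto intro!: derivative_eq_intros simp: power2_eq_square)
    thus "\<exists>y. ((\<lambda>x. sin x - x + x^3/6) has_real_derivative y) (at t) \<and> 0 \<le> y"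
      using cos_ge_quadratic[of t] by (intro exI conjI) auto
  qed
  thus ?thesis by simp
qed

text \<open>The cubic minorant of sin reduces the claim to (1 - u^2/6)^2 (1 + u^2) \<ge> 1, which
  holds up to u^2 = 3 and thus past u = pi/2.\<close>

lemma csc_square_bound:
  fixes y :: real assumes "0 < \<bar>y\<bar>" "\<bar>y\<bar> \<le> 1/2"
  shows "1 / (sin (pi * y))\<^sup>2 \<le> 1 / (pi * y)\<^sup>2 + 1"
proof -
  define u where "u = pi * \<bar>y\<bar>"
  have u0: "u > 0" using assms by (simp add: u_def)
  have "u \<le> pi * (1/2)" unfolding u_def using assms by (intro mult_left_mono) auto
  hence "u \<le> 1.6" using pi_approx by simp
  hence "u * u \<le> 1.6 * 1.6" using u0 by (intro mult_mono) auto
  hence u2: "u\<^sup>2 \<le> 3" by (simp add: power2_eq_square)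
  have "u * (1 - u\<^sup>2/6) \<le> sin u" using sin_ge_cubic[of u] u0 by (simp add: power3_eq_cube power2_eq_square algebra_simps)
  hence "(u * (1 - u\<^sup>2/6))\<^sup>2 \<le> (sin u)\<^sup>2" using u0 u2 by (intro power_mono) auto
  hence s: "u\<^sup>2 * (1 - u\<^sup>2/6)\<^sup>2 \<le> (sin u)\<^sup>2" by (simp add: power_mult_distrib)
  have "(1 - u\<^sup>2/6)\<^sup>2 * (1 + u\<^sup>2) - 1 = u\<^sup>2 * ((3 - u\<^sup>2) * (8 - u\<^sup>2)) / 36"
    by (simp add: power2_eq_square algebra_simps) (simp add: field_simps)
  moreover have "u\<^sup>2 * ((3 - u\<^sup>2) * (8 - u\<^sup>2)) / 36 \<ge> 0" using u2 by (intro divide_nonneg_nonneg mult_nonneg_nonneg) auto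
  ultimately have "1 \<le> (1 - u\<^sup>2/6)\<^sup>2 * (1 + u\<^sup>2)" by linarith
  hence "u\<^sup>2 \<le> u\<^sup>2 * ((1 - u\<^sup>2/6)\<^sup>2 * (1 + u\<^sup>2))" by (simp add: mult_le_cancel_left1)
  also have "\<dots> \<le> (sin u)\<^sup>2 * (1 + u\<^sup>2)" using s by (simp add: mult.assoc[symmetric] mult_right_mono)
  finally have le: "u\<^sup>2 \<le> (sin u)\<^sup>2 * (1 + u\<^sup>2)" .
  have "sin u > 0" using u0 \<open>u \<le> pi * (1/2)\<close> by (intro sin_gt_zero) auto
  hence "1 / (sin u)\<^sup>2 \<le> 1 / u\<^sup>2 + 1" using le u0 by (simp add: field_simps)
  moreover have "(sin u)\<^sup>2 = (sin (pi * y))\<^sup>2" "u\<^sup>2 = (pi * y)\<^sup>2"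
    by (cases "y \<ge> 0"; simp add: u_def power_mult_distrib)+
  ultimately show ?thesis by simp
qed

section \<open>Sums over separated points and the Dirichlet kernel\<close>

lemma sum_inverse_squares_le:
  assumes "finite J" "0 \<notin> J" shows "(\<Sum>j\<in>J. 1 / (real j)\<^sup>2) \<le> pi\<^sup>2 / 6"
proof -
  have s: "(\<lambda>n. 1 / (real n + 1)\<^sup>2) sums (pi\<^sup>2 / 6)"
    using inverse_squares_sums by (simp add: add.commute)
  have "(\<Sum>j\<in>J. 1 / (real j)\<^sup>2) = (\<Sum>n\<in>(\<lambda>j. j - 1) ` J. 1 / (real n + 1)\<^sup>2)"
  proof (subst sum.reindex)
    show "inj_on (\<lambda>j. j - 1) J" using assms(2) by (auto simp: inj_on_def) (metis Suc_pred gr0I)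
    show "(\<Sum>j\<in>J. 1 / (real j)\<^sup>2) = sum ((\<lambda>n. 1 / (real n + 1)\<^sup>2) \<circ> (\<lambda>j. j - 1)) J"
    proof (rule sum.cong)
      fix j assume "j \<in> J"
      hence "j > 0" using assms(2) by (metis gr0I)
      thus "1 / (real j)\<^sup>2 = ((\<lambda>n. 1 / (real n + 1)\<^sup>2) \<circ> (\<lambda>j. j - 1)) j" by simp
    qed simp
  qed
  also have "\<dots> \<le> pi\<^sup>2 / 6"
    using sum_le_suminf[of "\<lambda>n. 1 / (real n + 1)\<^sup>2" "(\<lambda>j. j - 1) ` J"] s assms(1)
    by (auto simp: sums_iff)
  finally show ?thesis .
qed

text \<open>Points that are \<Delta>-separated fall into distinct bins \<open>j s\<close>, and the
  bins start at 1; so the sum is dominated by the series of inverse squares, scaled by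
  1/\<Delta>^2.\<close>

lemma separated_sum_one_sided:
  fixes y :: "'a \<Rightarrow> real"
  assumes "finite A" "\<Delta> > 0" "\<And>s. s \<in> A \<Longrightarrow> y s \<ge> \<Delta>"
    and sep: "\<And>s t. s \<in> A \<Longrightarrow> t \<in> A \<Longrightarrow> s \<noteq> t \<Longrightarrow> \<bar>y s - y t\<bar> \<ge> \<Delta>"
  shows "(\<Sum>s\<in>A. 1 / (y s)\<^sup>2) \<le> pi\<^sup>2 / (6 * \<Delta>\<^sup>2)"
proof -
  define j where "j = (\<lambda>s. nat \<lfloor>y s / \<Delta>\<rfloor>)"
  have j: "1 \<le> j s" "real (j s) \<le> y s / \<Delta>" "y s / \<Delta> < real (j s) + 1" if "s \<in> A" for s
  proof -
    have "y s / \<Delta> \<ge> 1" using assms(2,3) that by (simp add: field_simps)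
    hence "\<lfloor>y s / \<Delta>\<rfloor> \<ge> 1" by simp
    hence "real (j s) = of_int \<lfloor>y s / \<Delta>\<rfloor>" by (simp add: j_def)
    with \<open>\<lfloor>y s / \<Delta>\<rfloor> \<ge> 1\<close> have "real (j s) = of_int \<lfloor>y s / \<Delta>\<rfloor>" "1 \<le> real (j s)" by auto
    thus "1 \<le> j s" "real (j s) \<le> y s / \<Delta>" "y s / \<Delta> < real (j s) + 1" by linarith+
  qed
  have inj: "inj_on j A"
  proof (rule inj_onI, rule ccontr)
    fix s t assume st: "s \<in> A" "t \<in> A" "j s = j t" "s \<noteq> t"
    have "\<bar>y s / \<Delta> - y t / \<Delta>\<bar> < 1" using j[OF st(1)] j[OF st(2)] st(3) by linarith
    moreover have "y s / \<Delta> - y t / \<Delta> = (y s - y t) / \<Delta>" by (simp add: diff_divide_distrib)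
    ultimately have "\<bar>y s - y t\<bar> < \<Delta>" using assms(2) by (simp add: field_simps abs_divide)
    thus False using sep[OF st(1,2,4)] by simp
  qed
  have "(\<Sum>s\<in>A. 1 / (y s)\<^sup>2) \<le> (\<Sum>s\<in>A. 1 / \<Delta>\<^sup>2 * (1 / (real (j s))\<^sup>2))"
  proof (rule sum_mono)
    fix s assume s: "s \<in> A"
    have "real (j s) * \<Delta> \<le> y s" using j[OF s] assms(2) by (simp add: field_simps)
    hence "(real (j s) * \<Delta>)\<^sup>2 \<le> (y s)\<^sup>2" using assms(2) by (intro power_mono) auto
    moreover have "(real (j s) * \<Delta>)\<^sup>2 > 0" using j[OF s] assms(2) by simp
    ultimately have "1 / (y s)\<^sup>2 \<le> 1 / (real (j s) * \<Delta>)\<^sup>2" by (intro frac_le) auto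
    thus "1 / (y s)\<^sup>2 \<le> 1 / \<Delta>\<^sup>2 * (1 / (real (j s))\<^sup>2)" by (simp add: power_mult_distrib mult.commute)
  qed
  also have "\<dots> = 1 / \<Delta>\<^sup>2 * (\<Sum>k\<in>j ` A. 1 / (real k)\<^sup>2)"
    by (simp add: sum.reindex[OF inj] sum_distrib_left)
  also have "\<dots> \<le> 1 / \<Delta>\<^sup>2 * (pi\<^sup>2 / 6)"
    using assms(1) j(1) by (intro mult_left_mono sum_inverse_squares_le) force+
  finally show ?thesis by (simp add: mult.commute)
qed

lemma separated_sum:
  fixes y :: "'a \<Rightarrow> real"
  assumes "finite A" "\<Delta> > 0" "\<And>s. s \<in> A \<Longrightarrow> \<bar>y s\<bar> \<ge> \<Delta>"
    and sep: "\<And>s t. s \<in> A \<Longrightarrow> t \<in> A \<Longrightarrow> s \<noteq> t \<Longrightarrow> \<bar>y s - y t\<bar> \<ge> \<Delta>"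
  shows "(\<Sum>s\<in>A. 1 / (y s)\<^sup>2) \<le> pi\<^sup>2 / (3 * \<Delta>\<^sup>2)"
proof -
  let ?P = "{s\<in>A. y s > 0}" and ?N = "{s\<in>A. \<not> y s > 0}"
  have "(\<Sum>s\<in>A. 1 / (y s)\<^sup>2) = (\<Sum>s\<in>?P. 1 / (y s)\<^sup>2) + (\<Sum>s\<in>?N. 1 / (y s)\<^sup>2)"
    using assms(1) by (subst sum.union_disjoint[symmetric]) (auto intro!: sum.cong)
  moreover have "(\<Sum>s\<in>?P. 1 / (y s)\<^sup>2) \<le> pi\<^sup>2 / (6 * \<Delta>\<^sup>2)"
    using assms by (intro separated_sum_one_sided) force+
  moreover have "(\<Sum>s\<in>?N. 1 / (- y s)\<^sup>2) \<le> pi\<^sup>2 / (6 * \<Delta>\<^sup>2)"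
  proof (rule separated_sum_one_sided)
    fix s t assume "s \<in> ?N" "t \<in> ?N" "s \<noteq> t"
    thus "\<bar>- y s - - y t\<bar> \<ge> \<Delta>" using sep[of t s] by (simp add: abs_minus_commute)
  next
    fix s assume "s \<in> ?N" thus "- y s \<ge> \<Delta>" using assms(3)[of s] by auto
  qed (use assms in auto)
  ultimately show ?thesis by (simp add: field_simps)
qed

lemma norm_cis_minus_1:
  fixes \<theta> :: real
  defines "y \<equiv> \<theta> - of_int (round \<theta>)"
  shows "cmod (cis (2 * pi * \<theta>) - 1) = 2 * \<bar>sin (pi * y)\<bar>"
proof -
  have "2 * pi * y = 2 * pi * \<theta> - 2 * pi * of_int (round \<theta>)" by (simp add: y_def algebra_simps)
  hence "cis (2 * pi * y) = cis (2 * pi * \<theta>) / cis (2 * pi * of_int (round \<theta>))" by (simp only: cis_divide)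
  hence "cis (2 * pi * y) = cis (2 * pi * \<theta>)" by (simp add: cis_multiple_2pi)
  thus ?thesis using dist_exp_i_1[of "2 * pi * y"] by (simp add: cis_conv_exp)
qed

text \<open>The bound does not depend on m: the numerator of the geometric sum has modulus at most
  2, the denominator is 2|sin(pi y)| with y the nearest residue.\<close>

lemma geometric_kernel_bound:
  fixes \<theta> :: real
  assumes "dist_Z \<theta> > 0"
  shows "(cmod (\<Sum>i<m. cis (2 * pi * \<theta>) ^ i))\<^sup>2 \<le> 1 / (pi * dist_Z \<theta>)\<^sup>2 + 1"
proof -
  let ?y = "\<theta> - of_int (round \<theta>)"
  have y: "\<bar>?y\<bar> = dist_Z \<theta>" by (simp add: dist_Z_round)
  have s0: "sin (pi * ?y) \<noteq> 0"
  proof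
    assume "sin (pi * ?y) = 0"
    then obtain i :: int where "pi * ?y = of_int i * pi" using sin_zero_iff_int2 by blast
    hence "?y = of_int i" by simp
    hence "\<theta> = of_int (i + round \<theta>)" by simp
    hence "dist_Z \<theta> = 0" by (metis dist_Z_round round_of_int diff_self abs_zero)
    thus False using assms by simp
  qed
  have "cmod (\<Sum>i<m. cis (2 * pi * \<theta>) ^ i) * cmod (cis (2 * pi * \<theta>) - 1) = cmod (cis (2 * pi * \<theta>) ^ m - 1)"
    unfolding norm_mult[symmetric] by (simp add: power_diff_1_eq mult.commute)
  also have "\<dots> \<le> 2"
    using norm_triangle_ineq4[of "cis (2 * pi * \<theta>) ^ m" 1] by (simp add: norm_power)
  finally have "cmod (\<Sum>i<m. cis (2 * pi * \<theta>) ^ i) * \<bar>sin (pi * ?y)\<bar> \<le> 1" unfolding norm_cis_minus_1 by simp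
  hence "cmod (\<Sum>i<m. cis (2 * pi * \<theta>) ^ i) \<le> 1 / \<bar>sin (pi * ?y)\<bar>" using s0 by (simp add: field_simps)
  hence "(cmod (\<Sum>i<m. cis (2 * pi * \<theta>) ^ i))\<^sup>2 \<le> (1 / \<bar>sin (pi * ?y)\<bar>)\<^sup>2" by (intro power_mono) auto
  also have "\<dots> = 1 / (sin (pi * ?y))\<^sup>2" by (simp add: power_divide)
  also have "\<dots> \<le> 1 / (pi * ?y)\<^sup>2 + 1"
    using assms y dist_Z_half[of \<theta>] by (intro csc_square_bound) auto
  also have "(pi * ?y)\<^sup>2 = (pi * dist_Z \<theta>)\<^sup>2" using y by (metis power2_abs power_mult_distrib)
  finally show ?thesis .
qed

text \<open>For fixed i the indices i + j form a window, and the last one, 2m - 2, is still below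
  N.\<close>

lemma sum_shifted_le:
  fixes g :: "nat \<Rightarrow> real"
  assumes "\<And>k. g k \<ge> 0" "2 * m \<le> N + 1"
  shows "(\<Sum>i<m. \<Sum>j<m. g (i + j)) \<le> real m * (\<Sum>k<N. g k)"
proof -
  have "(\<Sum>i<m. \<Sum>j<m. g (i + j)) \<le> (\<Sum>i<m. \<Sum>k<N. g k)"
  proof (rule sum_mono)
    fix i assume i: "i \<in> {..<m}"
    have "(\<Sum>j<m. g (i + j)) = sum g ((\<lambda>j. i + j) ` {..<m})" by (subst sum.reindex) auto
    also have "\<dots> \<le> (\<Sum>k<N. g k)" using assms i by (intro sum_mono2) auto
    finally show "(\<Sum>j<m. g (i + j)) \<le> (\<Sum>k<N. g k)" .
  qed
  thus ?thesis by simp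
qed

text \<open>
  Averaging over \<open>k = i + j\<close> squares the Dirichlet kernel of length \<open>m\<close>, and the squared kernel is
  absolutely summable over separated nodes, uniformly in \<open>S\<close>.
\<close>

theorem vandermonde_lower:
  fixes a :: "nat \<Rightarrow> complex" and x :: "nat \<Rightarrow> real"
  assumes \<Delta>: "\<Delta> > 0" and m: "m > 0" "2 * m \<le> N + 1"
    and gap: "\<And>s t. s < S \<Longrightarrow> t < S \<Longrightarrow> s \<noteq> t \<Longrightarrow> \<Delta> \<le> dist_Z (x s - x t)"
  shows "(real m - (1 / (3 * \<Delta>\<^sup>2) + real S) / real m) * (\<Sum>s<S. (cmod (a s))\<^sup>2)
    \<le> (\<Sum>k<N. (cmod (\<Sum>s<S. a s * cis (2 * pi * x s) ^ k))\<^sup>2)"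
proof -
  define f where "f = (\<lambda>k. \<Sum>s<S. a s * cis (2 * pi * x s) ^ k)"
  define D where "D = (\<lambda>s t. \<Sum>i<m. cis (2 * pi * (x s - x t)) ^ i)"
  define c where "c = (\<lambda>s t. 1 / (pi * dist_Z (x s - x t))\<^sup>2 + 1)"
  \<comment> \<open>\<open>R\<close> will bound the row sums of \<open>c\<close>: the first summand
    is the separated sum divided by pi^2, the second collects the constants 1.\<close>
  define R where "R = 1 / (3 * \<Delta>\<^sup>2) + real S"
  have c_sym: "c s t = c t s" for s t by (simp add: c_def dist_Z_commute)
  have c0: "c s t \<ge> 0" for s t by (simp add: c_def)
  have row: "(\<Sum>s\<in>{..<S} - {t}. c s t) \<le> R" if t: "t < S" for t
  proof -
    \<comment> \<open>Nearest representatives modulo 1. They are separated as real numbers, since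
      \<open>y s - y s'\<close> equals \<open>x s - x s'\<close> up to an integer.\<close>
    define y where "y = (\<lambda>s. (x s - x t) - of_int (round (x s - x t)))"
    have "(\<Sum>s\<in>{..<S} - {t}. 1 / (y s)\<^sup>2) \<le> pi\<^sup>2 / (3 * \<Delta>\<^sup>2)"
    proof (rule separated_sum)
      fix s assume "s \<in> {..<S} - {t}"
      thus "\<Delta> \<le> \<bar>y s\<bar>" using gap[of s t] t by (simp add: y_def dist_Z_round)
    next
      fix s s' assume s: "s \<in> {..<S} - {t}" "s' \<in> {..<S} - {t}" "s \<noteq> s'"
      have "\<Delta> \<le> dist_Z (x s - x s')" using gap s by auto
      also have "\<dots> \<le> \<bar>(x s - x s') - of_int (round (x s - x t) - round (x s' - x t))\<bar>" by (rule dist_Z_le)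
      also have "\<dots> = \<bar>y s - y s'\<bar>" by (simp add: y_def)
      finally show "\<Delta> \<le> \<bar>y s - y s'\<bar>" .
    qed (use \<Delta> in auto)
    moreover have "(y s)\<^sup>2 = (dist_Z (x s - x t))\<^sup>2" for s by (simp add: y_def dist_Z_round)
    ultimately have "1 / pi\<^sup>2 * (\<Sum>s\<in>{..<S} - {t}. 1 / (dist_Z (x s - x t))\<^sup>2) \<le> 1 / pi\<^sup>2 * (pi\<^sup>2 / (3 * \<Delta>\<^sup>2))"
      by (intro mult_left_mono) auto
    hence "(\<Sum>s\<in>{..<S} - {t}. 1 / (pi * dist_Z (x s - x t))\<^sup>2) \<le> 1 / (3 * \<Delta>\<^sup>2)"
      by (simp add: sum_distrib_left power_mult_distrib)
    moreover have "real (card ({..<S} - {t})) \<le> real S" using t by simp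
    ultimately show ?thesis by (simp add: c_def R_def sum.distrib)
  qed
  have "complex_of_real (\<Sum>i<m. \<Sum>j<m. (cmod (f (i + j)))\<^sup>2)
      = (\<Sum>i<m. \<Sum>j<m. \<Sum>s<S. \<Sum>t<S. a s * cnj (a t) * cis (2 * pi * (x s - x t)) ^ (i + j))"
  proof -
    have "complex_of_real ((cmod (f k))\<^sup>2) = (\<Sum>s<S. \<Sum>t<S. a s * cnj (a t) * cis (2 * pi * (x s - x t)) ^ k)" for k
    proof -
      have "complex_of_real ((cmod (f k))\<^sup>2) = (\<Sum>s<S. a s * cis (2 * pi * x s) ^ k) * (\<Sum>t<S. cnj (a t) * cnj (cis (2 * pi * x t)) ^ k)"
        unfolding complex_norm_square f_def by simp
      also have "\<dots> = (\<Sum>s<S. \<Sum>t<S. (a s * cnj (a t)) * (cis (2 * pi * x s) * cnj (cis (2 * pi * x t))) ^ k)"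
        unfolding sum_product by (simp add: power_mult_distrib mult_ac)
      also have "\<dots> = (\<Sum>s<S. \<Sum>t<S. a s * cnj (a t) * cis (2 * pi * (x s - x t)) ^ k)"
        by (simp add: cis_cnj cis_mult right_diff_distrib)
      finally show ?thesis .
    qed
    thus ?thesis by simp
  qed
  also have "\<dots> = (\<Sum>s<S. \<Sum>t<S. \<Sum>i<m. \<Sum>j<m. a s * cnj (a t) * cis (2 * pi * (x s - x t)) ^ (i + j))"
  proof -
    have sw: "(\<Sum>i<m. \<Sum>j<m. \<Sum>s<S. \<Sum>t<S. F i j s t) = (\<Sum>s<S. \<Sum>t<S. \<Sum>i<m. \<Sum>j<m. F i j s t)"
      for F :: "nat \<Rightarrow> nat \<Rightarrow> nat \<Rightarrow> nat \<Rightarrow> complex"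
    proof -
      have "(\<Sum>i<m. \<Sum>j<m. \<Sum>s<S. \<Sum>t<S. F i j s t) = (\<Sum>i<m. \<Sum>s<S. \<Sum>j<m. \<Sum>t<S. F i j s t)"
        by (intro sum.cong refl sum.swap)
      also have "\<dots> = (\<Sum>s<S. \<Sum>i<m. \<Sum>j<m. \<Sum>t<S. F i j s t)" by (rule sum.swap)
      also have "\<dots> = (\<Sum>s<S. \<Sum>i<m. \<Sum>t<S. \<Sum>j<m. F i j s t)"
        by (intro sum.cong refl sum.swap)
      also have "\<dots> = (\<Sum>s<S. \<Sum>t<S. \<Sum>i<m. \<Sum>j<m. F i j s t)"
        by (intro sum.cong refl sum.swap)
      finally show ?thesis .
    qed
    show ?thesis by (rule sw)
  qed
  also have "\<dots> = (\<Sum>s<S. \<Sum>t<S. a s * cnj (a t) * (D s t)\<^sup>2)"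
    by (simp add: D_def power2_eq_square sum_product sum_distrib_left power_add mult_ac)
  also have "\<dots> = (\<Sum>s<S. a s * cnj (a s) * (D s s)\<^sup>2 + (\<Sum>t\<in>{..<S} - {s}. a s * cnj (a t) * (D s t)\<^sup>2))"
    by (intro sum.cong refl sum.remove) auto
  finally have "(\<Sum>i<m. \<Sum>j<m. (cmod (f (i + j)))\<^sup>2)
     = (\<Sum>s<S. Re (a s * cnj (a s) * (D s s)\<^sup>2) + (\<Sum>t\<in>{..<S} - {s}. Re (a s * cnj (a t) * (D s t)\<^sup>2)))"
    by (metis (mono_tags, lifting) Re_complex_of_real Re_sum plus_complex.sel(1) sum.cong)
  also have "\<dots> \<ge> (\<Sum>s<S. (real m)\<^sup>2 * (cmod (a s))\<^sup>2 - (\<Sum>t\<in>{..<S} - {s}. ((cmod (a s))\<^sup>2 + (cmod (a t))\<^sup>2) / 2 * c s t))"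
  proof (rule sum_mono)
    fix s assume s: "s \<in> {..<S}"
    have "D s s = of_nat m" by (simp add: D_def)
    hence "a s * cnj (a s) * (D s s)\<^sup>2 = complex_of_real ((real m)\<^sup>2 * (cmod (a s))\<^sup>2)"
      by (simp flip: complex_norm_square)
    hence 1: "Re (a s * cnj (a s) * (D s s)\<^sup>2) = (real m)\<^sup>2 * (cmod (a s))\<^sup>2" by (simp only: Re_complex_of_real)
    have 2: "- (((cmod (a s))\<^sup>2 + (cmod (a t))\<^sup>2) / 2 * c s t) \<le> Re (a s * cnj (a t) * (D s t)\<^sup>2)" if t: "t \<in> {..<S} - {s}" for t
    proof -
      have d: "dist_Z (x s - x t) > 0" using gap[of s t] s t \<Delta> by auto
      have "cmod (a s * cnj (a t) * (D s t)\<^sup>2) = (cmod (a s) * cmod (a t)) * (cmod (D s t))\<^sup>2"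
        by (simp add: norm_mult norm_power)
      also have "\<dots> \<le> ((cmod (a s))\<^sup>2 + (cmod (a t))\<^sup>2) / 2 * c s t"
        using sum_squares_bound[of "cmod (a s)" "cmod (a t)"] geometric_kernel_bound[OF d, of m]
        by (intro mult_mono) (auto simp: c_def D_def)
      finally show ?thesis using abs_Re_le_cmod[of "a s * cnj (a t) * (D s t)\<^sup>2"] by linarith
    qed
    show "(real m)\<^sup>2 * (cmod (a s))\<^sup>2 - (\<Sum>t\<in>{..<S} - {s}. ((cmod (a s))\<^sup>2 + (cmod (a t))\<^sup>2) / 2 * c s t)
      \<le> Re (a s * cnj (a s) * (D s s)\<^sup>2) + (\<Sum>t\<in>{..<S} - {s}. Re (a s * cnj (a t) * (D s t)\<^sup>2))"
      using sum_mono[of "{..<S} - {s}", OF 2] 1 by (simp add: sum_negf)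
  qed
  finally have A: "(\<Sum>s<S. (real m)\<^sup>2 * (cmod (a s))\<^sup>2) - (\<Sum>s<S. \<Sum>t\<in>{..<S} - {s}. ((cmod (a s))\<^sup>2 + (cmod (a t))\<^sup>2) / 2 * c s t)
      \<le> (\<Sum>i<m. \<Sum>j<m. (cmod (f (i + j)))\<^sup>2)" by (simp add: sum_subtractf)
  \<comment> \<open>The products |a s||a t| were split by the arithmetic-geometric mean inequality.
    Since \<open>c\<close> is symmetric, the two halves give the same sum, and a bound on its rows
    suffices.\<close>
  have sw: "(\<Sum>s<S. \<Sum>t\<in>{..<S} - {s}. (cmod (a t))\<^sup>2 * c s t) = (\<Sum>s<S. \<Sum>t\<in>{..<S} - {s}. (cmod (a s))\<^sup>2 * c s t)"
  proof -
    have "(\<Sum>s<S. \<Sum>t\<in>{..<S} - {s}. (cmod (a t))\<^sup>2 * c s t) = (\<Sum>s<S. \<Sum>t<S. if s = t then 0 else (cmod (a t))\<^sup>2 * c s t)"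
      by (intro sum.cong refl sum.mono_neutral_cong_left) auto
    also have "\<dots> = (\<Sum>t<S. \<Sum>s<S. if s = t then 0 else (cmod (a t))\<^sup>2 * c s t)" by (rule sum.swap)
    also have "\<dots> = (\<Sum>t<S. \<Sum>s\<in>{..<S} - {t}. (cmod (a t))\<^sup>2 * c t s)"
      using c_sym by (intro sum.cong refl sum.mono_neutral_cong_right) auto
    finally show ?thesis .
  qed
  have "(\<Sum>s<S. \<Sum>t\<in>{..<S} - {s}. ((cmod (a s))\<^sup>2 + (cmod (a t))\<^sup>2) / 2 * c s t)
     = (\<Sum>s<S. \<Sum>t\<in>{..<S} - {s}. (cmod (a s))\<^sup>2 * c s t) / 2 + (\<Sum>s<S. \<Sum>t\<in>{..<S} - {s}. (cmod (a t))\<^sup>2 * c s t) / 2"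
    by (simp add: sum.distrib add_divide_distrib distrib_right sum_divide_distrib)
  also have "\<dots> = (\<Sum>s<S. (cmod (a s))\<^sup>2 * (\<Sum>t\<in>{..<S} - {s}. c t s))"
    unfolding sw by (simp add: sum_distrib_left c_sym)
  also have "\<dots> \<le> (\<Sum>s<S. (cmod (a s))\<^sup>2 * R)"
    using row by (intro sum_mono mult_left_mono) auto
  finally have "((real m)\<^sup>2 - R) * (\<Sum>s<S. (cmod (a s))\<^sup>2) \<le> (\<Sum>i<m. \<Sum>j<m. (cmod (f (i + j)))\<^sup>2)"
    using A by (simp add: sum_distrib_left[symmetric] sum_distrib_right[symmetric] algebra_simps)
  also have "\<dots> \<le> real m * (\<Sum>k<N. (cmod (f k))\<^sup>2)" by (rule sum_shifted_le) (use m in auto)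
  finally have "((real m)\<^sup>2 - R) * (\<Sum>s<S. (cmod (a s))\<^sup>2) / real m \<le> (\<Sum>k<N. (cmod (f k))\<^sup>2)"
    using m(1) by (simp add: field_simps)
  moreover have "((real m)\<^sup>2 - R) * (\<Sum>s<S. (cmod (a s))\<^sup>2) / real m = (real m - R / real m) * (\<Sum>s<S. (cmod (a s))\<^sup>2)"
    using m(1) by (simp add: field_simps power2_eq_square)
  ultimately show ?thesis by (simp add: f_def R_def)
qed

text \<open>The window length m is about K/4, the longest that fits twice into K/2 samples. There
  K\<Delta> > 4 gives 1/(3\<Delta>^2) \<le> K^2/48 and 32S \<le> K gives S \<le> K^2/1024, so at m =
  K/4 the factor of \<open>vandermonde_lower\<close> is about 0.163 K. The value 4/25 is a
  convenient square below it.\<close>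

lemma vandermonde_lower_numeric:
  fixes a :: "nat \<Rightarrow> complex" and x :: "nat \<Rightarrow> real"
  assumes \<Delta>: "\<Delta> > 0" "real K * \<Delta> > 4" and S: "S \<ge> 1" "32 * S \<le> K" and ev: "even K" and N: "K div 2 \<le> N"
    and gap: "\<And>s t. s < S \<Longrightarrow> t < S \<Longrightarrow> s \<noteq> t \<Longrightarrow> \<Delta> \<le> dist_Z (x s - x t)"
  shows "4 / 25 * real K * (\<Sum>s<S. (cmod (a s))\<^sup>2) \<le> (\<Sum>k<N. (cmod (\<Sum>s<S. a s * cis (2 * pi * x s) ^ k))\<^sup>2)"
proof -
  define m where "m = (K div 2 + 1) div 2"
  have K: "real K \<ge> 32" using S by linarith
  have mm: "m > 0" "2 * m \<le> N + 1" "real K \<le> 4 * real m"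
  proof -
    obtain h where h: "K = 2 * h" using ev by blast
    hence "h \<le> 2 * m" by (simp add: m_def)
    thus "real K \<le> 4 * real m" using h by linarith
    show "m > 0" "2 * m \<le> N + 1" using S N by (simp_all add: m_def)
  qed
  have "1 / (3 * \<Delta>\<^sup>2) \<le> (real K)\<^sup>2 / 48"
  proof -
    have "4\<^sup>2 \<le> (real K * \<Delta>)\<^sup>2" using \<Delta>(2) by (intro power_mono) auto
    hence "16 \<le> (real K)\<^sup>2 * \<Delta>\<^sup>2" by (simp add: power_mult_distrib)
    thus ?thesis using \<Delta>(1) by (simp add: field_simps)
  qed
  moreover have "real S \<le> (real K)\<^sup>2 / 1024"
  proof -
    have "32 * real S * 32 \<le> real K * real K" using S K by (intro mult_mono) auto
    thus ?thesis by (simp add: power2_eq_square)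
  qed
  ultimately have "(1 / (3 * \<Delta>\<^sup>2) + real S) / real m \<le> ((real K)\<^sup>2 / 48 + (real K)\<^sup>2 / 1024) / real m"
    using mm by (intro divide_right_mono) auto
  moreover have "4 / 25 * real K * real m \<le> (real m)\<^sup>2 - ((real K)\<^sup>2 / 48 + (real K)\<^sup>2 / 1024)"
  proof -
    \<comment> \<open>Here 9/100 = 1/4 - 4/25, and the resulting 9/400 exceeds 1/48 +
      1/1024.\<close>
    have "real K / 4 * (9/100 * real K) \<le> real m * (real m - 4/25 * real K)"
      using mm(3) by (intro mult_mono) auto
    moreover have "real K * real K \<ge> 0" by simp
    moreover have "real K / 4 * (9/100 * real K) = 9/400 * (real K * real K)"
      "real m * (real m - 4/25 * real K) = real m * real m - 4/25 * (real K * real m)" by (simp_all add: algebra_simps)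
    ultimately show ?thesis unfolding power2_eq_square mult.assoc by linarith
  qed
  hence "4 / 25 * real K \<le> real m - ((real K)\<^sup>2 / 48 + (real K)\<^sup>2 / 1024) / real m"
    using mm by (simp add: field_simps power2_eq_square)
  ultimately have "4 / 25 * real K \<le> real m - (1 / (3 * \<Delta>\<^sup>2) + real S) / real m" by linarith
  hence "4 / 25 * real K * (\<Sum>s<S. (cmod (a s))\<^sup>2) \<le> (real m - (1 / (3 * \<Delta>\<^sup>2) + real S) / real m) * (\<Sum>s<S. (cmod (a s))\<^sup>2)"
    by (intro mult_right_mono sum_nonneg) auto
  also have "\<dots> \<le> (\<Sum>k<N. (cmod (\<Sum>s<S. a s * cis (2 * pi * x s) ^ k))\<^sup>2)"
    by (rule vandermonde_lower[OF \<Delta>(1) mm(1,2) gap])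
  finally show ?thesis .
qed

section \<open>The Moore--Penrose inverse of an injective matrix\<close>

text \<open>Injectivity makes the Gram matrix invertible, and its inverse \<open>Gi\<close> times
  the adjoint of \<open>A\<close> satisfies the Penrose conditions. Uniqueness is proved along with
  it because \<open>pinv\<close> is a definite description. The norm bound holds because A X is an
  orthogonal projection, hence a contraction, and \<open>lower\<close> can be applied to
  \<open>X *\<^sub>v y\<close>.\<close>

lemma pinv_injective:
  fixes A :: "complex mat"
  assumes A: "A \<in> carrier_mat m k" and c: "c > 0"
    and lower: "\<And>x. x \<in> carrier_vec k \<Longrightarrow> c * vnorm x \<le> vnorm (A *\<^sub>v x)"
  shows "pinv A \<in> carrier_mat k m" "pinv A * A = 1\<^sub>m k"
    "\<And>y. y \<in> carrier_vec m \<Longrightarrow> c * vnorm (pinv A *\<^sub>v y) \<le> vnorm y"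
proof -
  have A': "mat_adjoint A \<in> carrier_mat k m" using A by simp
  let ?G = "mat_adjoint A * A"
  have G: "?G \<in> carrier_mat k k" using A A' by (rule mult_carrier_mat[rotated])
  have "v = 0\<^sub>v k" if v: "v \<in> carrier_vec k" "?G *\<^sub>v v = 0\<^sub>v k" for v
  proof -
    have Av: "A *\<^sub>v v \<in> carrier_vec m" using A v by simp
    have "(A *\<^sub>v v) \<bullet>c (A *\<^sub>v v) = v \<bullet>c (?G *\<^sub>v v)"
      using mult_mat_vec_cdot[OF A v(1) Av] assoc_mult_mat_vec[OF A' A v(1)] by simp
    also have "\<dots> = 0" using v by (simp add: cdot_sum[of _ k])
    finally have "vnorm (A *\<^sub>v v) = 0" using cdot_self[OF Av] by simp
    hence "vnorm v \<le> 0" using lower[OF v(1)] c by (simp add: mult_le_0_iff)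
    thus ?thesis using vnorm_eq_0[OF v(1)] vnorm_nonneg[of v] by linarith
  qed
  then obtain Gi where Gi: "Gi \<in> carrier_mat k k" "?G * Gi = 1\<^sub>m k" "Gi * ?G = 1\<^sub>m k"
    using injective_inverse[OF G] by blast
  have Gi': "mat_adjoint Gi \<in> carrier_mat k k" using Gi by simp
  have GH: "mat_adjoint ?G = ?G" using mat_adjoint_mult[OF A' A] by simp
  have one: "mat_adjoint (1\<^sub>m k :: complex mat) = 1\<^sub>m k" by (rule eq_matI) auto
  have GiH: "mat_adjoint Gi = Gi"
  proof -
    have "mat_adjoint Gi * ?G = 1\<^sub>m k" using mat_adjoint_mult[OF G Gi(1)] GH Gi(2) one by simp
    hence "mat_adjoint Gi * ?G * Gi = Gi" using Gi by simp
    thus ?thesis using assoc_mult_mat[OF Gi' G Gi(1)] Gi Gi' by simp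
  qed
  define X where "X = Gi * mat_adjoint A"
  have X: "X \<in> carrier_mat k m" using Gi A' by (simp add: X_def)
  have XA: "X * A = 1\<^sub>m k" unfolding X_def using assoc_mult_mat[OF Gi(1) A' A] Gi(3) by simp
  have AX: "A * X \<in> carrier_mat m m" using A X by simp
  have AXH: "mat_adjoint (A * X) = A * X"
  proof -
    have "mat_adjoint X = A * Gi" using mat_adjoint_mult[OF Gi(1) A'] GiH by (simp add: X_def)
    hence "mat_adjoint (A * X) = A * Gi * mat_adjoint A" using mat_adjoint_mult[OF A X] by simp
    thus ?thesis using assoc_mult_mat[OF A Gi(1) A'] by (simp add: X_def)
  qed
  have pX: "is_pinv A X"
    unfolding is_pinv_def using A X XA AXH one assoc_mult_mat[OF A X A] by simp
  have uniq: "Y = X" if Y: "is_pinv A Y" for Y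
  proof -
    have Yc: "Y \<in> carrier_mat k m" using Y A by (auto simp: is_pinv_def)
    note y = Y[unfolded is_pinv_def]
    have AY: "A * Y \<in> carrier_mat m m" using A Yc by simp
    have YAc: "Y * A \<in> carrier_mat k k" using A Yc by simp
    have "Y * A = (X * A) * (Y * A)" using XA left_mult_one_mat[OF YAc] by simp
    also have "\<dots> = X * (A * Y * A)"
      using assoc_mult_mat[OF X A YAc] assoc_mult_mat[OF A Yc A] by simp
    finally have YA: "Y * A = 1\<^sub>m k" using y XA by simp
    have "A * X = (A * Y * A) * X" using y by simp
    also have "\<dots> = (A * Y) * (A * X)" by (rule assoc_mult_mat[OF AY A X])
    finally have "mat_adjoint (A * X) = mat_adjoint (A * X) * mat_adjoint (A * Y)"
      using mat_adjoint_mult[OF AY AX] by simp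
    hence "A * X = (A * X) * (A * Y)" using AXH y by simp
    also have "\<dots> = (A * X * A) * Y" using assoc_mult_mat[OF AX A Yc] by simp
    also have "\<dots> = A * Y" using assoc_mult_mat[OF A X A] XA A by simp
    finally have eq: "A * X = A * Y" .
    have "Y = Y * A * Y" using y by simp
    also have "\<dots> = Y * (A * X)" using assoc_mult_mat[OF Yc A Yc] eq by simp
    also have "\<dots> = X" using assoc_mult_mat[OF Yc A X] YA X by simp
    finally show ?thesis .
  qed
  have p: "pinv A = X" unfolding pinv_def using pX uniq by (rule the_equality)
  show "pinv A \<in> carrier_mat k m" "pinv A * A = 1\<^sub>m k" using X XA p by auto
  fix y :: "complex Matrix.vec" assume yc: "y \<in> carrier_vec m"
  have Xy: "X *\<^sub>v y \<in> carrier_vec k" using X yc by simp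
  let ?t = "(A * X) *\<^sub>v y"
  have t: "?t \<in> carrier_vec m" using AX yc by (rule mult_mat_vec_carrier)
  have "(A * X) * (A * X) = A * X"
    using assoc_mult_mat[OF AX A X] assoc_mult_mat[OF A X A] XA A by simp
  hence "?t \<bullet>c ?t = y \<bullet>c ?t"
    using mult_mat_vec_cdot[OF AX yc t] AXH assoc_mult_mat_vec[OF AX AX yc] by simp
  hence "cmod (complex_of_real ((vnorm ?t)\<^sup>2)) \<le> vnorm y * vnorm ?t"
    using cdot_self[OF t] cdot_Cauchy_Schwarz[OF yc t] by simp
  hence "vnorm ?t * vnorm ?t \<le> vnorm y * vnorm ?t" by (simp add: power2_eq_square norm_mult)
  hence "vnorm ?t \<le> vnorm y"
    using vnorm_nonneg[of ?t] vnorm_nonneg[of y] by (cases "vnorm ?t = 0") (auto simp: mult_le_cancel_right)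
  moreover have "c * vnorm (X *\<^sub>v y) \<le> vnorm ?t"
    using lower[OF Xy] assoc_mult_mat_vec[OF A X yc] by simp
  ultimately show "c * vnorm (pinv A *\<^sub>v y) \<le> vnorm y" using p by simp
qed

section \<open>Stability of ESPRIT\<close>

lemma entrywise_vnorm_bound:
  assumes M: "M \<in> carrier_mat n m" and x: "x \<in> carrier_vec m" and d: "d \<ge> 0"
    and e: "\<And>i j. i < n \<Longrightarrow> j < m \<Longrightarrow> cmod (M $$ (i,j)) \<le> d"
  shows "vnorm (M *\<^sub>v x) \<le> d * sqrt (real n * real m) * vnorm x"
proof -
  have row: "cmod ((M *\<^sub>v x) $ i) \<le> d * sqrt (real m) * vnorm x" if i: "i < n" for i
  proof -
    have "cmod ((M *\<^sub>v x) $ i) \<le> (\<Sum>j<m. cmod (M $$ (i,j)) * cmod (x $ j))"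
      unfolding mult_mat_vec_index_sum[OF M x i] by (rule order.trans[OF norm_sum]) (simp add: norm_mult)
    also have "\<dots> \<le> (\<Sum>j<m. d * cmod (x $ j))" using e i by (intro sum_mono mult_right_mono) auto
    also have "\<dots> = d * (\<Sum>j<m. \<bar>1\<bar> * \<bar>cmod (x $ j)\<bar>)" by (simp add: sum_distrib_left)
    also have "\<dots> \<le> d * (L2_set (\<lambda>_. 1) {..<m} * L2_set (\<lambda>j. cmod (x $ j)) {..<m})"
      using d by (intro mult_left_mono L2_set_mult_ineq) auto
    also have "\<dots> = d * sqrt (real m) * vnorm x" using x by (simp add: L2_set_def vnorm_def)
    finally show ?thesis .
  qed
  have "vnorm (M *\<^sub>v x) \<le> L2_set (\<lambda>_. d * sqrt (real m) * vnorm x) {..<n}"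
    unfolding vnorm_def[of "M *\<^sub>v x"] using M row by (auto intro!: L2_set_mono simp del: index_mult_mat_vec)
  also have "\<dots> = d * sqrt (real n * real m) * vnorm x"
    using d by (simp add: L2_set_constant real_sqrt_mult)
  finally show ?thesis .
qed

definition vander :: "nat \<Rightarrow> nat \<Rightarrow> (nat \<Rightarrow> complex) \<Rightarrow> complex mat" where
  "vander n S z = mat n S (\<lambda>(i,s). z s ^ i)"

lemma vander_carrier [simp]: "vander n S z \<in> carrier_mat n S"
  by (simp add: vander_def)

lemma vander_mult_index:
  "a \<in> carrier_vec S \<Longrightarrow> i < n \<Longrightarrow> (vander n S z *\<^sub>v a) $ i = (\<Sum>s<S. z s ^ i * a $ s)"
  by (subst mult_mat_vec_index_sum[of _ n S]) (auto simp: vander_def)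

lemma vander_lower:
  assumes "\<Delta> > 0" "real K * \<Delta> > 4" "S \<ge> 1" "32 * S \<le> K" "even K" "K div 2 \<le> N"
    and gap: "\<And>s t. s < S \<Longrightarrow> t < S \<Longrightarrow> s \<noteq> t \<Longrightarrow> \<Delta> \<le> dist_Z (x s - x t)"
    and a: "a \<in> carrier_vec S"
  shows "2/5 * sqrt (real K) * vnorm a \<le> vnorm (vander N S (\<lambda>s. cis (2 * pi * x s)) *\<^sub>v a)"
proof -
  let ?V = "vander N S (\<lambda>s. cis (2 * pi * x s))"
  have Va: "?V *\<^sub>v a \<in> carrier_vec N" by (rule mult_mat_vec_carrier[OF vander_carrier a])
  have "(vnorm (?V *\<^sub>v a))\<^sup>2 = (\<Sum>k<N. (cmod (\<Sum>s<S. a $ s * cis (2 * pi * x s) ^ k))\<^sup>2)"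
    unfolding vnorm_sq[OF Va] using vander_mult_index[OF a, of _ N]
    by (intro sum.cong refl) (simp add: mult.commute del: index_mult_mat_vec)
  hence "4/25 * real K * (vnorm a)\<^sup>2 \<le> (vnorm (?V *\<^sub>v a))\<^sup>2"
    using vandermonde_lower_numeric[where a = "\<lambda>s. a $ s" and x = x, OF assms(1-7)]
    unfolding vnorm_sq[OF a] by simp
  hence "(2/5 * sqrt (real K) * vnorm a)\<^sup>2 \<le> (vnorm (?V *\<^sub>v a))\<^sup>2"
    by (simp add: power_mult_distrib power2_eq_square[of "2::real"] power_divide)
  thus ?thesis by (rule power2_le_imp_le) simp
qed

text \<open>Keeping only S columns amounts to applying the square matrix to a zero-padded vector;
  this makes the isometry property of the full unitary factors available for \<open>U\<close> and
  \<open>Y\<close> in \<open>esprit_perturbation\<close>.\<close>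

lemma padded_mult:
  fixes Q :: "complex mat" and w :: "complex Matrix.vec"
  assumes Q: "Q \<in> carrier_mat n n" and "S \<le> n" and w: "w \<in> carrier_vec S"
  shows "mat n S (\<lambda>(i,j). Q $$ (i,j) * d j) *\<^sub>v w = Q *\<^sub>v Matrix.vec n (\<lambda>j. if j < S then d j * w $ j else 0)"
proof (rule eq_vecI)
  fix i assume "i < dim_vec (Q *\<^sub>v Matrix.vec n (\<lambda>j. if j < S then d j * w $ j else 0))"
  hence i: "i < n" using Q by simp
  have "(Q *\<^sub>v Matrix.vec n (\<lambda>j. if j < S then d j * w $ j else 0)) $ i
     = (\<Sum>j<n. Q $$ (i,j) * (if j < S then d j * w $ j else 0))"
    using mult_mat_vec_index_sum[OF Q _ i, of "Matrix.vec n (\<lambda>j. if j < S then d j * w $ j else 0)"] by simp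
  also have "\<dots> = (\<Sum>j<S. Q $$ (i,j) * d j * w $ j)"
    using assms(2) by (intro sum.mono_neutral_cong_right) auto
  also have "\<dots> = (mat n S (\<lambda>(i,j). Q $$ (i,j) * d j) *\<^sub>v w) $ i"
    using mult_mat_vec_index_sum[of "mat n S (\<lambda>(i,j). Q $$ (i,j) * d j)" n S w i] i w by simp
  finally show "(mat n S (\<lambda>(i,j). Q $$ (i,j) * d j) *\<^sub>v w) $ i
     = (Q *\<^sub>v Matrix.vec n (\<lambda>j. if j < S then d j * w $ j else 0)) $ i" by simp
qed (use Q in auto)

lemma vnorm_padded:
  assumes "S \<le> n" "w \<in> carrier_vec S"
  shows "vnorm (Matrix.vec n (\<lambda>j. if j < S then d j * w $ j else 0)) = vnorm (Matrix.vec S (\<lambda>j. d j * w $ j))"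
proof -
  have "(vnorm (Matrix.vec n (\<lambda>j. if j < S then d j * w $ j else 0)))\<^sup>2 = (vnorm (Matrix.vec S (\<lambda>j. d j * w $ j)))\<^sup>2"
    unfolding vnorm_sq[OF vec_carrier] using assms by (intro sum.mono_neutral_cong_right) auto
  thus ?thesis by (simp add: power2_eq_iff_nonneg)
qed

lemma diag_vnorm_le:
  assumes "x \<in> carrier_vec n" "\<And>i. i < n \<Longrightarrow> x $ i \<noteq> 0 \<Longrightarrow> cmod (a i) \<le> c" "c \<ge> 0"
  shows "vnorm (Matrix.vec n (\<lambda>i. a i * x $ i)) \<le> c * vnorm x"
proof -
  have "vnorm (Matrix.vec n (\<lambda>i. a i * x $ i)) = L2_set (\<lambda>i. cmod (a i * x $ i)) {..<n}"
    by (simp add: vnorm_def L2_set_def)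
  also have "\<dots> \<le> L2_set (\<lambda>i. c * cmod (x $ i)) {..<n}"
  proof (intro L2_set_mono)
    fix i assume "i \<in> {..<n}"
    thus "cmod (a i * x $ i) \<le> c * cmod (x $ i)"
      using assms by (cases "x $ i = 0") (auto simp: norm_mult intro!: mult_right_mono)
  qed auto
  also have "\<dots> = c * vnorm x" using assms by (simp add: vnorm_def L2_set_right_distrib)
  finally show ?thesis .
qed

text \<open>Concavity of the sine would give the factor 4. The cubic minorant, whose relative factor
  is at least 147/250 up to pi/2, gives 2 * 3.1415 * 0.588 > 3.69, and that is enough for the final
  3/10.\<close>

lemma phase_distance:
  "369/100 * dist_Z \<theta> \<le> cmod (cis (2 * pi * \<theta>) - 1)"
proof -
  let ?y = "\<theta> - of_int (round \<theta>)"
  have y: "\<bar>?y\<bar> = dist_Z \<theta>" by (simp add: dist_Z_round)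
  have sa: "sin (pi * \<bar>t\<bar>) \<le> \<bar>sin (pi * t)\<bar>" for t :: real by (cases "t \<ge> 0") auto
  define u where "u = pi * dist_Z \<theta>"
  have u0: "u \<ge> 0" by (simp add: u_def)
  have "u \<le> pi * (1/2)" unfolding u_def by (intro mult_left_mono dist_Z_half) auto
  hence "u \<le> 1.5708" using pi_approx by simp
  hence "u * u \<le> 1.5708 * 1.5708" using u0 by (intro mult_mono) auto
  hence "147/250 \<le> 1 - u * u / 6" by simp
  hence "u * (147/250) \<le> u * (1 - u * u / 6)" using u0 by (rule mult_left_mono)
  also have "\<dots> \<le> sin u" using sin_ge_cubic[OF u0] by (simp add: power3_eq_cube algebra_simps)
  also have "sin u = sin (pi * \<bar>?y\<bar>)" by (simp add: u_def y)
  also have "\<dots> \<le> \<bar>sin (pi * ?y)\<bar>" by (rule sa)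
  finally have "u * (147/250) \<le> \<bar>sin (pi * ?y)\<bar>" .
  moreover have "6283/2000 * dist_Z \<theta> \<le> u" unfolding u_def using pi_approx by (intro mult_right_mono) auto
  ultimately show ?thesis unfolding norm_cis_minus_1 by linarith
qed

text \<open>Projecting \<mu> radially onto the unit circle moves it by at most r once more, hence
  the 2r. The assumption r < 1 keeps \<mu> away from 0, where the argument carries no
  information.\<close>

lemma phase_of_near_eigenvalue:
  assumes d: "cmod (\<mu> - cis (- (2 * pi * x))) \<le> r" and r: "r < 1"
  shows "dist_Z (frac (- Arg \<mu> / (2 * pi)) - x) \<le> 2 * r / (369/100)"
proof -
  have "cmod (cis (- (2 * pi * x))) - cmod \<mu> \<le> cmod (cis (- (2 * pi * x)) - \<mu>)" by (rule norm_triangle_ineq2)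
  hence "1 - cmod \<mu> \<le> cmod (\<mu> - cis (- (2 * pi * x)))" by (simp add: norm_minus_commute)
  hence "cmod \<mu> > 0" using d r by linarith
  hence m0: "\<mu> \<noteq> 0" by auto
  define v where "v = - Arg \<mu> / (2 * pi)"
  have a: "Arg \<mu> = - (2 * pi * v)" by (simp add: v_def)
  have \<mu>: "\<mu> = complex_of_real (cmod \<mu>) * cis (- (2 * pi * v))"
    using rcis_cmod_Arg[of \<mu>] unfolding a rcis_def by simp
  have "cmod (cis (- (2 * pi * v)) - \<mu>) = \<bar>1 - cmod \<mu>\<bar>"
  proof -
    have "cis (- (2 * pi * v)) - \<mu> = complex_of_real (1 - cmod \<mu>) * cis (- (2 * pi * v))"
      by (subst \<mu>) (simp add: algebra_simps)
    thus ?thesis by (simp only: norm_mult norm_of_real norm_cis mult_1_right)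
  qed
  also have "\<dots> \<le> r" using norm_triangle_ineq3[of \<mu> "cis (- (2 * pi * x))"] d by simp
  finally have "cmod (cis (- (2 * pi * v)) - cis (- (2 * pi * x))) \<le> 2 * r"
    using d norm_triangle_ineq[of "cis (- (2 * pi * v)) - \<mu>" "\<mu> - cis (- (2 * pi * x))"] by simp
  moreover have "cis (- (2 * pi * v)) - cis (- (2 * pi * x)) = cis (- (2 * pi * x)) * (cis (2 * pi * (x - v)) - 1)"
    by (simp add: algebra_simps cis_mult)
  ultimately have "cmod (cis (2 * pi * (x - v)) - 1) \<le> 2 * r" by (simp add: norm_mult)
  hence "369/100 * dist_Z (x - v) \<le> 2 * r" using phase_distance[of "x - v"] by linarith
  moreover have "dist_Z (frac v - x) = dist_Z (x - v)"
    using dist_Z_add_int[of "v - x" "- \<lfloor>v\<rfloor>"] dist_Z_commute[of v x] by (simp add: frac_def algebra_simps)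
  ultimately show ?thesis by (simp add: v_def)
qed

lemma diagonal_mult_vec:
  fixes Sg :: "complex mat"
  assumes Sg: "Sg \<in> carrier_mat n n" and d: "\<And>i j. i < n \<Longrightarrow> j < n \<Longrightarrow> i \<noteq> j \<Longrightarrow> Sg $$ (i,j) = 0"
    and t: "t \<in> carrier_vec n"
  shows "Sg *\<^sub>v t = Matrix.vec n (\<lambda>i. Sg $$ (i,i) * t $ i)"
proof (rule eq_vecI)
  fix i assume "i < dim_vec (Matrix.vec n (\<lambda>i. Sg $$ (i,i) * t $ i))"
  hence i: "i < n" by simp
  have "(Sg *\<^sub>v t) $ i = (\<Sum>j<n. if j = i then Sg $$ (i,i) * t $ i else 0)"
    unfolding mult_mat_vec_index_sum[OF Sg t i] using d i by (intro sum.cong) auto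
  thus "(Sg *\<^sub>v t) $ i = Matrix.vec n (\<lambda>i. Sg $$ (i,i) * t $ i) $ i" using i by simp
qed (use Sg in simp)

section \<open>Signal space of the noisy Hankel matrix\<close>

context
  fixes K S n :: nat and x p :: "nat \<Rightarrow> real" and y :: "nat \<Rightarrow> complex" and \<Delta> \<beta> \<delta> :: real
  assumes n: "n = K div 2 + 1" and S1: "S \<ge> 1" and K: "even K" "32 * S < K"
    and \<Delta>: "\<Delta> > 0" "real K * \<Delta> > 4"
    and gap: "\<And>s t. s < S \<Longrightarrow> t < S \<Longrightarrow> s \<noteq> t \<Longrightarrow> \<Delta> \<le> dist_Z (x s - x t)"
    and \<beta>: "\<beta> > 0" "\<And>s. s < S \<Longrightarrow> \<beta> \<le> p s"
    and \<delta>: "\<delta> \<ge> 0" "\<And>k. k \<le> K \<Longrightarrow> cmod (y k - (\<Sum>s<S. complex_of_real (p s) * cis (- (2 * pi * x s)) ^ k)) \<le> \<delta>"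
begin

private abbreviation (input) z :: "nat \<Rightarrow> complex" where "z \<equiv> \<lambda>s. cis (- (2 * pi * x s))"
private abbreviation (input) V :: "complex mat" where "V \<equiv> vander n S z"
private abbreviation (input) C :: "complex mat" where "C \<equiv> mat S n (\<lambda>(s,j). complex_of_real (p s) * z s ^ j)"
private abbreviation (input) Z :: "complex mat" where
  "Z \<equiv> mat n n (\<lambda>(i,j). y (i + j) - (\<Sum>s<S. complex_of_real (p s) * z s ^ (i + j)))"

text \<open>The constant is 1/2 + 1/34 rounded up: an even K above 32 is at least 34.\<close>

lemma n_le: "real n \<le> 53/100 * real K" and Kn: "2 * (K div 2) = K" and Sn: "S \<le> n" "S < n"
proof -
  show kn: "2 * (K div 2) = K" using K(1) by simp
  have "K \<ge> 34" using S1 K kn by presburger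
  moreover have "2 * real (K div 2) = real K" using kn by linarith
  ultimately show "real n \<le> 53/100 * real K" by (simp add: n)
  show "S \<le> n" "S < n" using K(2) by (auto simp: n)
qed

text \<open>Since z^(i+j) = z^i z^j, the exact Hankel matrix factors through dimension S;
  \<open>C\<close> is diag(p) times the transpose of \<open>V\<close>, and \<open>Z\<close> is the
  noise.\<close>

lemma hankel_mult:
  assumes v: "v \<in> carrier_vec n"
  shows "hankel K y *\<^sub>v v = V *\<^sub>v (C *\<^sub>v v) + Z *\<^sub>v v"
proof -
  have C: "C \<in> carrier_mat S n" by simp
  have "hankel K y = V * C + Z"
  proof (rule eq_matI)
    fix i j assume "i < dim_row (V * C + Z)" "j < dim_col (V * C + Z)"
    hence ij: "i < n" "j < n" by auto
    have "(V * C) $$ (i,j) = (\<Sum>s<S. complex_of_real (p s) * z s ^ (i + j))"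
      unfolding mat_mult_index_sum[OF vander_carrier C ij]
      using ij by (intro sum.cong) (auto simp: vander_def power_add)
    thus "hankel K y $$ (i,j) = (V * C + Z) $$ (i,j)" using ij by (simp add: hankel_def n)
  qed (auto simp: hankel_def vander_def n)
  moreover have "(V * C + Z) *\<^sub>v v = (V * C) *\<^sub>v v + Z *\<^sub>v v"
    using v by (intro add_mult_distrib_mat_vec[of _ n n] mult_carrier_mat[of _ n S]) auto
  moreover have "(V * C) *\<^sub>v v = V *\<^sub>v (C *\<^sub>v v)"
    using v by (intro assoc_mult_mat_vec[of _ n S _ n]) auto
  ultimately show ?thesis by simp
qed

lemma noise_mult:
  assumes v: "v \<in> carrier_vec n" shows "vnorm (Z *\<^sub>v v) \<le> real n * \<delta> * vnorm v"
proof -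
  have "vnorm (Z *\<^sub>v v) \<le> \<delta> * sqrt (real n * real n) * vnorm v"
    using \<delta> v Kn n by (intro entrywise_vnorm_bound[of _ n n]) auto
  thus ?thesis by (simp add: mult.commute)
qed

lemma V_lower: "a \<in> carrier_vec S \<Longrightarrow> 2/5 * sqrt (real K) * vnorm a \<le> vnorm (V *\<^sub>v a)"
  using vander_lower[of \<Delta> K S n "\<lambda>s. - x s" a] \<Delta> S1 K gap n
  by (simp add: dist_Z_commute)

text \<open>As S < n, \<open>C\<close> has a kernel, so a lower bound can hold only on its row
  space, which the conjugate Vandermonde matrix spans. There it is dual to the Vandermonde bound:
  the squared norm of v is the inner product of \<open>a\<close> with \<open>t\<close>, and
  \<open>a\<close> is already controlled by v.\<close>

lemma C_lower:
  assumes a: "a \<in> carrier_vec S"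
  defines "v \<equiv> vander n S (\<lambda>s. cis (2 * pi * x s)) *\<^sub>v a"
  shows "\<beta> * (2/5 * sqrt (real K)) * vnorm v \<le> vnorm (C *\<^sub>v v)"
proof -
  let ?Vb = "vander n S (\<lambda>s. cis (2 * pi * x s))"
  have v: "v \<in> carrier_vec n" unfolding v_def by (rule mult_mat_vec_carrier[OF vander_carrier a])
  define t where "t = mat_adjoint ?Vb *\<^sub>v v"
  have Vb': "mat_adjoint ?Vb \<in> carrier_mat S n" by simp
  have t: "t \<in> carrier_vec S" unfolding t_def by (rule mult_mat_vec_carrier[OF Vb' v])
  have g: "2/5 * sqrt (real K) * vnorm a \<le> vnorm v"
    using vander_lower[of \<Delta> K S n x a] \<Delta> S1 K gap n a by (simp add: v_def)
  have "v \<bullet>c v = a \<bullet>c t" unfolding v_def t_def by (rule mult_mat_vec_cdot[OF vander_carrier a v[unfolded v_def]])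
  hence "(vnorm v)\<^sup>2 = cmod (a \<bullet>c t)" using cdot_self[OF v] by (metis norm_of_real abs_of_nonneg zero_le_power2)
  hence "(vnorm v)\<^sup>2 \<le> vnorm a * vnorm t" using cdot_Cauchy_Schwarz[OF a t] by simp
  hence "2/5 * sqrt (real K) * (vnorm v * vnorm v) \<le> 2/5 * sqrt (real K) * (vnorm a * vnorm t)"
    by (intro mult_left_mono) (auto simp: power2_eq_square)
  also have "\<dots> \<le> vnorm v * vnorm t"
    using mult_right_mono[OF g, of "vnorm t"] by (simp add: mult.assoc)
  finally have "vnorm v * (2/5 * sqrt (real K) * vnorm v) \<le> vnorm v * vnorm t" by (simp add: mult_ac)
  hence vt: "2/5 * sqrt (real K) * vnorm v \<le> vnorm t"
    using vnorm_nonneg[of v] by (cases "vnorm v = 0") (auto simp: mult_le_cancel_left)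
  have "C *\<^sub>v v = Matrix.vec S (\<lambda>s. complex_of_real (p s) * t $ s)"
  proof (rule eq_vecI)
    fix s assume "s < dim_vec (Matrix.vec S (\<lambda>s. complex_of_real (p s) * t $ s))"
    hence s: "s < S" by simp
    have "t $ s = (\<Sum>j<n. z s ^ j * v $ j)"
      unfolding t_def mult_mat_vec_index_sum[OF Vb' v s]
      using s by (intro sum.cong) (auto simp: vander_def cis_cnj)
    thus "(C *\<^sub>v v) $ s = Matrix.vec S (\<lambda>s. complex_of_real (p s) * t $ s) $ s"
      using mult_mat_vec_index_sum[of C S n v s] v s by (simp add: sum_distrib_left mult.assoc)
  qed simp
  moreover have "\<beta> * vnorm t \<le> vnorm (Matrix.vec S (\<lambda>s. complex_of_real (p s) * t $ s))"
    using \<beta> by (intro diag_vnorm_ge[OF t]) (auto intro: order.trans[OF _ abs_ge_self])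
  moreover have "\<beta> * (2/5 * sqrt (real K) * vnorm v) \<le> \<beta> * vnorm t" using vt \<beta>(1) by (intro mult_left_mono) auto
  ultimately show ?thesis by (simp add: mult.assoc)
qed

text \<open>A min-max argument. S - 1 linear conditions on S coefficients leave a nonzero vector of
  the row space that is orthogonal to the first S - 1 right singular vectors; on it the Hankel
  matrix expands by at most the S-th singular value (index S - 1). On the other hand
  \<open>V C\<close> expands it by at least (2/5)^2 K \<beta>, up to the noise.\<close>

lemma singular_value_lower:
  assumes svd: "is_svd (hankel K y) W Sg X"
  shows "4/25 * real K * \<beta> - real n * \<delta> \<le> Re (Sg $$ (S - 1, S - 1))"
proof -
  let ?A = "hankel K y"
  let ?\<sigma> = "Re (Sg $$ (S - 1, S - 1))"
  have A: "?A \<in> carrier_mat n n" by (simp add: hankel_def n)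
  have dims: "dim_row ?A = n" "dim_col ?A = n" using A by auto
  note s = svd[unfolded is_svd_def dims]
  have W: "W \<in> carrier_mat n n" "mat_adjoint W * W = 1\<^sub>m n"
    and X: "X \<in> carrier_mat n n" "mat_adjoint X * X = 1\<^sub>m n"
    and Sg: "Sg \<in> carrier_mat n n" "\<And>i j. i < n \<Longrightarrow> j < n \<Longrightarrow> i \<noteq> j \<Longrightarrow> Sg $$ (i,j) = 0"
    and Sg2: "\<And>i. i < n \<Longrightarrow> Im (Sg $$ (i,i)) = 0 \<and> Re (Sg $$ (i,i)) \<ge> 0"
    and Sg3: "\<And>i j. i \<le> j \<Longrightarrow> j < n \<Longrightarrow> Re (Sg $$ (j,j)) \<le> Re (Sg $$ (i,i))"
    and eq: "?A = W * Sg * mat_adjoint X"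
    using s by auto
  have X': "mat_adjoint X \<in> carrier_mat n n" using X by simp
  have X'iso: "mat_adjoint (mat_adjoint X) * mat_adjoint X = 1\<^sub>m n" using unitary_right[OF X] by simp
  let ?Vb = "vander n S (\<lambda>s. cis (2 * pi * x s))"
  have XV: "mat_adjoint X * ?Vb \<in> carrier_mat n S" using X' by simp
  obtain a where a: "a \<in> carrier_vec S" "a \<noteq> 0\<^sub>v S"
    "\<And>i. i < S - 1 \<Longrightarrow> (\<Sum>j<S. (mat_adjoint X * ?Vb) $$ (i,j) * a $ j) = 0"
    using nontrivial_kernel[of "S - 1" S "\<lambda>i j. (mat_adjoint X * ?Vb) $$ (i,j)"] S1 by auto
  define v where "v = ?Vb *\<^sub>v a"
  have v: "v \<in> carrier_vec n" unfolding v_def by (rule mult_mat_vec_carrier[OF vander_carrier a(1)])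
  have "0 < 2/5 * sqrt (real K) * vnorm a" using vnorm_pos[OF a(1,2)] K by simp
  also have "\<dots> \<le> vnorm v" using vander_lower[of \<Delta> K S n x a] \<Delta> S1 K gap n a by (simp add: v_def)
  finally have v0: "vnorm v > 0" .
  define t where "t = mat_adjoint X *\<^sub>v v"
  have t: "t \<in> carrier_vec n" unfolding t_def by (rule mult_mat_vec_carrier[OF X' v])
  have tv: "vnorm t = vnorm v" unfolding t_def by (rule isometry_vnorm[OF X' X'iso v])
  have t0: "t $ i = 0" if "i < S - 1" for i
  proof -
    have "t = (mat_adjoint X * ?Vb) *\<^sub>v a"
      unfolding t_def v_def by (rule assoc_mult_mat_vec[OF X' vander_carrier a(1), symmetric])
    thus ?thesis using mult_mat_vec_index_sum[OF XV a(1), of i] a(3)[OF that] that Sn by simp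
  qed
  have "?A *\<^sub>v v = W *\<^sub>v (Sg *\<^sub>v t)"
    unfolding eq t_def
    using assoc_mult_mat_vec[OF mult_carrier_mat[OF W(1) Sg(1)] X' v] assoc_mult_mat_vec[OF W(1) Sg(1) t]
    by (simp only: t_def)
  hence "vnorm (?A *\<^sub>v v) = vnorm (Sg *\<^sub>v t)"
    using isometry_vnorm[OF W] mult_mat_vec_carrier[OF Sg(1) t] by simp
  also have "Sg *\<^sub>v t = Matrix.vec n (\<lambda>i. Sg $$ (i,i) * t $ i)" by (rule diagonal_mult_vec[OF Sg t])
  also have "vnorm \<dots> \<le> ?\<sigma> * vnorm t"
  proof (rule diag_vnorm_le[OF t])
    fix i assume i: "i < n" "t $ i \<noteq> 0"
    have "S - 1 \<le> i" using t0[of i] i by force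
    moreover have "cmod (Sg $$ (i,i)) = Re (Sg $$ (i,i))" using Sg2[OF i(1)] by (simp add: cmod_eq_Re)
    ultimately show "cmod (Sg $$ (i,i)) \<le> ?\<sigma>" using Sg3[of "S - 1" i] i by simp
  qed (use Sg2[of "S - 1"] Sn in auto)
  finally have up: "vnorm (?A *\<^sub>v v) \<le> ?\<sigma> * vnorm v" using tv by simp
  have Cv: "C *\<^sub>v v \<in> carrier_vec S" using v by (intro mult_mat_vec_carrier[of _ S n]) auto
  have VCv: "V *\<^sub>v (C *\<^sub>v v) \<in> carrier_vec n" by (rule mult_mat_vec_carrier[OF vander_carrier Cv])
  have Zv: "Z *\<^sub>v v \<in> carrier_vec n" using v by (intro mult_mat_vec_carrier[of _ n n]) auto
  have "(4/25 * real K * \<beta>) * vnorm v = 4/25 * \<beta> * vnorm v * (sqrt (real K) * sqrt (real K))"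
    by simp
  also have "\<dots> = 2/5 * sqrt (real K) * (\<beta> * (2/5 * sqrt (real K)) * vnorm v)" by simp
  also have "\<dots> \<le> 2/5 * sqrt (real K) * vnorm (C *\<^sub>v v)"
    using C_lower[OF a(1)] by (intro mult_left_mono) (auto simp: v_def)
  also have "\<dots> \<le> vnorm (V *\<^sub>v (C *\<^sub>v v))" by (rule V_lower[OF Cv])
  also have "\<dots> \<le> vnorm (?A *\<^sub>v v) + vnorm (Z *\<^sub>v v)"
    using vnorm_add_ge[OF VCv Zv] hankel_mult[OF v] by simp
  also have "\<dots> \<le> ?\<sigma> * vnorm v + real n * \<delta> * vnorm v" using up noise_mult[OF v] by simp
  finally have "(4/25 * real K * \<beta>) * vnorm v \<le> (?\<sigma> + real n * \<delta>) * vnorm v"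
    by (simp add: algebra_simps)
  thus ?thesis using v0 by simp
qed


lemma vander_component:
  assumes "b \<in> carrier_vec S" "i < n"
  shows "cmod ((V *\<^sub>v b) $ i) \<le> sqrt (real S) * vnorm b"
proof -
  have "cmod ((V *\<^sub>v b) $ i) \<le> (\<Sum>s<S. \<bar>1\<bar> * \<bar>cmod (b $ s)\<bar>)"
    unfolding vander_mult_index[OF assms]
    by (rule order.trans[OF norm_sum]) (simp add: norm_mult norm_power)
  also have "\<dots> \<le> L2_set (\<lambda>_. 1) {..<S} * L2_set (\<lambda>s. cmod (b $ s)) {..<S}" by (rule L2_set_mult_ineq)
  also have "\<dots> = sqrt (real S) * vnorm b" using assms by (simp add: L2_set_def vnorm_def)
  finally show ?thesis .
qed

lemma V_upper: "b \<in> carrier_vec S \<Longrightarrow> vnorm (V *\<^sub>v b) \<le> sqrt (real n * real S) * vnorm b"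
  using entrywise_vnorm_bound[of V n S b 1] by (auto simp: vander_def norm_power)

text \<open>Dividing the leading right singular vectors by their singular values gives
  \<open>Y\<close> with hankel * Y = U. The factorisation of the Hankel matrix then reads U = V (C
  Y) + Z Y, so \<open>B = C * Y\<close>. Dropping the first instead of the last row of
  \<open>V\<close> amounts to multiplying by diag(z) first, and this shift invariance passes to
  \<open>U\<close> up to the noise \<open>E\<close>.\<close>

lemma esprit_perturbation:
  assumes \<tau>: "0 < \<tau>" "\<tau> \<le> 1/640" "\<delta> \<le> \<tau> * \<beta>"
    and svd: "is_svd (hankel K y) W Sg X"
  defines "U0 \<equiv> mat (K div 2) S (\<lambda>(i,j). W $$ (i,j))"
    and "U1 \<equiv> mat (K div 2) S (\<lambda>(i,j). W $$ (i + 1,j))"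
  obtains B where "B \<in> carrier_mat S S" "pinv U0 * U1 \<in> carrier_mat S S"
    "\<And>v. v \<in> carrier_vec S \<Longrightarrow> B *\<^sub>v v = 0\<^sub>v S \<Longrightarrow> v = 0\<^sub>v S"
    "\<And>w. w \<in> carrier_vec S \<Longrightarrow>
      vnorm (B *\<^sub>v ((pinv U0 * U1) *\<^sub>v w) - Matrix.vec S (\<lambda>s. z s * (B *\<^sub>v w) $ s))
        \<le> 14 * sqrt (real S) * \<tau> * vnorm (B *\<^sub>v w)"
proof -
  let ?A = "hankel K y"
  have A: "?A \<in> carrier_mat n n" by (simp add: hankel_def n)
  have dims: "dim_row ?A = n" "dim_col ?A = n" using A by auto
  note s = svd[unfolded is_svd_def dims]
  have W: "W \<in> carrier_mat n n" "mat_adjoint W * W = 1\<^sub>m n"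
    and X: "X \<in> carrier_mat n n" "mat_adjoint X * X = 1\<^sub>m n"
    and Sg: "Sg \<in> carrier_mat n n" "\<And>i j. i < n \<Longrightarrow> j < n \<Longrightarrow> i \<noteq> j \<Longrightarrow> Sg $$ (i,j) = 0"
    and Sg2: "\<And>i. i < n \<Longrightarrow> Im (Sg $$ (i,i)) = 0 \<and> Re (Sg $$ (i,i)) \<ge> 0"
    and Sg3: "\<And>i j. i \<le> j \<Longrightarrow> j < n \<Longrightarrow> Re (Sg $$ (j,j)) \<le> Re (Sg $$ (i,i))"
    and eq: "?A = W * Sg * mat_adjoint X"
    using s by auto
  have X': "mat_adjoint X \<in> carrier_mat n n" using X by simp
  define \<sigma> where "\<sigma> = (\<lambda>j. Re (Sg $$ (j,j)))"
  \<comment> \<open>Relative size of the noise: it is at most 0.53 K \<beta> \<tau>, while the S-th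
    singular value is at least 0.159 K \<beta> because \<tau> \<le> 1/640. The ratio 0.53/0.159 is
    below 167/50.\<close>
  define e where "e = 167/50 * \<tau>"
  define \<gamma> where "\<gamma> = 2/5 * sqrt (real K)"
  have K0: "real K > 0" using K by simp
  have \<gamma>0: "\<gamma> > 0" using K0 by (simp add: \<gamma>_def)
  have e0: "0 < e" "e \<le> 1/190" using \<tau> by (auto simp: e_def)
  have K\<beta>: "real K * \<beta> > 0" using K0 \<beta>(1) by simp
  have nd: "real n * \<delta> \<le> 53/100 * (real K * \<beta>) * \<tau>"
  proof -
    have "real n * \<delta> \<le> (53/100 * real K) * (\<tau> * \<beta>)" using n_le \<tau> \<delta>(1) by (intro mult_mono) auto
    thus ?thesis by (simp add: mult_ac)
  qed
  have "(real K * \<beta>) * \<tau> \<le> (real K * \<beta>) * (1/640)" using K\<beta> \<tau> by (intro mult_left_mono) auto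
  hence \<sigma>S: "159/1000 * (real K * \<beta>) \<le> \<sigma> (S - 1)"
    using singular_value_lower[OF svd] nd K\<beta> unfolding \<sigma>_def by linarith
  hence \<sigma>0: "\<sigma> (S - 1) > 0" using K\<beta> by linarith
  have \<sigma>ge: "\<sigma> (S - 1) \<le> \<sigma> j" if "j < S" for j using Sg3[of j "S - 1"] that Sn by (simp add: \<sigma>_def)
  have nde: "real n * \<delta> \<le> e * \<sigma> (S - 1)"
  proof -
    have "e * (159/1000 * (real K * \<beta>)) \<le> e * \<sigma> (S - 1)" using \<sigma>S e0 by (intro mult_left_mono) auto
    moreover have "53/100 * (real K * \<beta>) * \<tau> \<le> e * (159/1000 * (real K * \<beta>))"
    proof -
      have "e * (159/1000 * (real K * \<beta>)) = 26553/50000 * (real K * \<beta> * \<tau>)" by (simp add: e_def)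
      moreover have "53/100 * (real K * \<beta>) * \<tau> = 53/100 * (real K * \<beta> * \<tau>)" by simp
      ultimately show ?thesis using mult_pos_pos[OF K\<beta> \<tau>(1)] by linarith
    qed
    ultimately show ?thesis using nd by linarith
  qed
  \<comment> \<open>Coordinates of \<open>Y *\<^sub>v w\<close> in the basis of right singular
    vectors.\<close>
  define pad where "pad = (\<lambda>w. Matrix.vec n (\<lambda>j. if j < S then complex_of_real (1 / \<sigma> j) * w $ j else 0))"
  define Y where "Y = mat n S (\<lambda>(i,j). X $$ (i,j) * complex_of_real (1 / \<sigma> j))"
  define U where "U = mat n S (\<lambda>(i,j). W $$ (i,j))"
  have Yc: "Y \<in> carrier_mat n S" and Uc: "U \<in> carrier_mat n S" by (auto simp: Y_def U_def)
  have padc: "pad w \<in> carrier_vec n" for w by (simp add: pad_def)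
  have Yw: "Y *\<^sub>v w = X *\<^sub>v pad w" if "w \<in> carrier_vec S" for w
    unfolding Y_def pad_def by (rule padded_mult[OF X(1) Sn(1) that])
  have Yn: "vnorm (Y *\<^sub>v w) \<le> 1 / \<sigma> (S - 1) * vnorm w" if w: "w \<in> carrier_vec S" for w
  proof -
    have "vnorm (Y *\<^sub>v w) = vnorm (pad w)" unfolding Yw[OF w] by (rule isometry_vnorm[OF X padc])
    also have "\<dots> = vnorm (Matrix.vec S (\<lambda>j. complex_of_real (1 / \<sigma> j) * w $ j))"
      unfolding pad_def by (rule vnorm_padded[OF Sn(1) w])
    also have "\<dots> \<le> 1 / \<sigma> (S - 1) * vnorm w"
    proof (rule diag_vnorm_le[OF w])
      fix j assume "j < S"
      hence "\<sigma> (S - 1) \<le> \<sigma> j" by (rule \<sigma>ge)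
      hence "1 / \<sigma> j \<le> 1 / \<sigma> (S - 1)" using \<sigma>0 by (intro divide_left_mono) auto
      moreover have "\<sigma> j > 0" using \<open>\<sigma> (S - 1) \<le> \<sigma> j\<close> \<sigma>0 by linarith
      ultimately show "cmod (complex_of_real (1 / \<sigma> j)) \<le> 1 / \<sigma> (S - 1)" unfolding norm_of_real by simp
    qed (use \<sigma>0 in simp)
    finally show ?thesis .
  qed
  have Uw: "U *\<^sub>v w = W *\<^sub>v Matrix.vec n (\<lambda>j. if j < S then 1 * w $ j else 0)" if w: "w \<in> carrier_vec S" for w
    using padded_mult[OF W(1) Sn(1) w, of "\<lambda>_. 1"] by (simp add: U_def)
  have Un: "vnorm (U *\<^sub>v w) = vnorm w" if w: "w \<in> carrier_vec S" for w
  proof -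
    have "vnorm (U *\<^sub>v w) = vnorm (Matrix.vec n (\<lambda>j. if j < S then 1 * w $ j else 0))"
      unfolding Uw[OF w] by (rule isometry_vnorm[OF W]) simp
    also have "\<dots> = vnorm (Matrix.vec S (\<lambda>j. 1 * w $ j))" by (rule vnorm_padded[OF Sn(1) w])
    also have "Matrix.vec S (\<lambda>j. 1 * w $ j) = w" by (rule eq_vecI) (use w in auto)
    finally show ?thesis .
  qed
  have AY: "?A *\<^sub>v (Y *\<^sub>v w) = U *\<^sub>v w" if w: "w \<in> carrier_vec S" for w
  proof -
    have Xp: "X *\<^sub>v pad w \<in> carrier_vec n" by (rule mult_mat_vec_carrier[OF X(1) padc])
    have 1: "mat_adjoint X *\<^sub>v (X *\<^sub>v pad w) = pad w"
      using assoc_mult_mat_vec[OF X' X(1) padc, of w] X(2) padc[of w] by simp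
    have "?A *\<^sub>v (Y *\<^sub>v w) = W *\<^sub>v (Sg *\<^sub>v pad w)"
      unfolding Yw[OF w] unfolding eq
      using assoc_mult_mat_vec[OF mult_carrier_mat[OF W(1) Sg(1)] X' Xp] assoc_mult_mat_vec[OF W(1) Sg(1) padc[of w]]
      by (simp only: 1)
    also have "Sg *\<^sub>v pad w = Matrix.vec n (\<lambda>j. if j < S then 1 * w $ j else 0)"
    proof -
      have 2: "Sg $$ (j,j) * pad w $ j = (if j < S then 1 * w $ j else 0)" if j: "j < n" for j
      proof (cases "j < S")
        case True
        have "Sg $$ (j,j) = complex_of_real (\<sigma> j)" using Sg2[OF j] by (simp add: \<sigma>_def complex_eq_iff)
        moreover have "\<sigma> j \<noteq> 0" using \<sigma>ge[OF True] \<sigma>0 by linarith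
        ultimately show ?thesis using True j by (simp add: pad_def)
      qed (use j in \<open>simp add: pad_def\<close>)
      have "Sg *\<^sub>v pad w = Matrix.vec n (\<lambda>i. Sg $$ (i,i) * pad w $ i)" by (rule diagonal_mult_vec[OF Sg padc])
      also have "\<dots> = Matrix.vec n (\<lambda>j. if j < S then 1 * w $ j else 0)"
        by (rule eq_vecI) (simp_all only: dim_vec index_vec 2)
      finally show ?thesis .
    qed
    finally show ?thesis using Uw[OF w] by simp
  qed
  define B where "B = C * Y"
  have Cc: "C \<in> carrier_mat S n" and Zc: "Z \<in> carrier_mat n n" by auto
  have B: "B \<in> carrier_mat S S" unfolding B_def by (rule mult_carrier_mat[OF Cc Yc])
  have Bw: "B *\<^sub>v w \<in> carrier_vec S" if "w \<in> carrier_vec S" for w by (rule mult_mat_vec_carrier[OF B that])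
  define E where "E = (\<lambda>w. Z *\<^sub>v (Y *\<^sub>v w))"
  have Yv: "Y *\<^sub>v w \<in> carrier_vec n" if "w \<in> carrier_vec S" for w by (rule mult_mat_vec_carrier[OF Yc that])
  have E: "E w \<in> carrier_vec n" if "w \<in> carrier_vec S" for w
    unfolding E_def by (rule mult_mat_vec_carrier[OF Zc Yv[OF that]])
  have VB: "V *\<^sub>v (B *\<^sub>v w) \<in> carrier_vec n" if "w \<in> carrier_vec S" for w
    by (rule mult_mat_vec_carrier[OF vander_carrier Bw[OF that]])
  have Uwc: "U *\<^sub>v w \<in> carrier_vec n" if "w \<in> carrier_vec S" for w by (rule mult_mat_vec_carrier[OF Uc that])
  have UVE: "U *\<^sub>v w = V *\<^sub>v (B *\<^sub>v w) + E w" if w: "w \<in> carrier_vec S" for w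
    using hankel_mult[OF Yv[OF w]] AY[OF w] assoc_mult_mat_vec[OF Cc Yc w] by (simp only: B_def E_def)
  have En: "vnorm (E w) \<le> e * vnorm w" if w: "w \<in> carrier_vec S" for w
  proof -
    have "vnorm (E w) \<le> real n * \<delta> * vnorm (Y *\<^sub>v w)" unfolding E_def by (rule noise_mult[OF Yv[OF w]])
    also have "\<dots> \<le> e * \<sigma> (S - 1) * (1 / \<sigma> (S - 1) * vnorm w)"
      by (rule mult_mono[OF nde Yn[OF w]]) (use e0 \<sigma>0 in auto)
    finally show ?thesis using \<sigma>0 by simp
  qed
  have VBup: "vnorm (V *\<^sub>v (B *\<^sub>v w)) \<le> (1 + e) * vnorm w" if w: "w \<in> carrier_vec S" for w
    using vnorm_add_ge[OF VB[OF w] E[OF w]] UVE[OF w] Un[OF w] En[OF w] by (simp add: algebra_simps)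
  have VBlo: "(1 - e) * vnorm w \<le> vnorm (V *\<^sub>v (B *\<^sub>v w))" if w: "w \<in> carrier_vec S" for w
    using vnorm_add[OF VB[OF w] E[OF w]] UVE[OF w] Un[OF w] En[OF w] by (simp add: algebra_simps)
  have Bup: "\<gamma> * vnorm (B *\<^sub>v w) \<le> (1 + e) * vnorm w" if w: "w \<in> carrier_vec S" for w
    using V_lower[OF Bw[OF w]] VBup[OF w] by (simp add: \<gamma>_def)
  have Blo: "(1 - e) * vnorm w \<le> sqrt (real n * real S) * vnorm (B *\<^sub>v w)" if w: "w \<in> carrier_vec S" for w
    using V_upper[OF Bw[OF w]] VBlo[OF w] by linarith
  have Binj: "w = 0\<^sub>v S" if w: "w \<in> carrier_vec S" "B *\<^sub>v w = 0\<^sub>v S" for w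
  proof -
    have "(1 - e) * vnorm w \<le> 0" using Blo[OF w(1)] w(2) by simp
    hence "vnorm w \<le> 0" using e0 by (simp add: mult_le_0_iff)
    thus ?thesis using vnorm_eq_0[OF w(1)] vnorm_nonneg[of w] by linarith
  qed
  define up where "up = (\<lambda>v :: complex Matrix.vec. Matrix.vec (K div 2) (\<lambda>i. v $ i))"
  define dn where "dn = (\<lambda>v :: complex Matrix.vec. Matrix.vec (K div 2) (\<lambda>i. v $ (i + 1)))"
  have upc: "up v \<in> carrier_vec (K div 2)" and dnc: "dn v \<in> carrier_vec (K div 2)" for v by (auto simp: up_def dn_def)
  have upn: "(vnorm (up v))\<^sup>2 = (vnorm v)\<^sup>2 - (cmod (v $ (K div 2)))\<^sup>2" if v: "v \<in> carrier_vec n" for v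
    unfolding vnorm_sq[OF upc] vnorm_sq[OF v] n by (simp add: up_def)
  have upl: "vnorm (up v) \<le> vnorm v" if v: "v \<in> carrier_vec n" for v
    by (rule power2_le_imp_le) (simp_all add: upn[OF v])
  have dnl: "vnorm (dn v) \<le> vnorm v" if v: "v \<in> carrier_vec n" for v
  proof (rule power2_le_imp_le)
    show "(vnorm (dn v))\<^sup>2 \<le> (vnorm v)\<^sup>2"
      unfolding vnorm_sq[OF dnc] vnorm_sq[OF v] n Suc_eq_plus1[symmetric] sum.lessThan_Suc_shift
      by (simp add: dn_def)
  qed simp
  have U0c: "U0 \<in> carrier_mat (K div 2) S" and U1c: "U1 \<in> carrier_mat (K div 2) S" by (auto simp: U0_def U1_def)
  have U0w: "U0 *\<^sub>v w = up (U *\<^sub>v w)" if w: "w \<in> carrier_vec S" for w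
  proof (rule eq_vecI)
    fix i assume "i < dim_vec (up (U *\<^sub>v w))"
    hence i: "i < K div 2" by (simp add: up_def)
    hence i': "i < n" by (simp add: n)
    show "(U0 *\<^sub>v w) $ i = up (U *\<^sub>v w) $ i"
      using mult_mat_vec_index_sum[OF U0c w i] mult_mat_vec_index_sum[OF Uc w i'] i i'
      by (simp add: up_def U0_def U_def del: index_mult_mat_vec)
  qed (simp add: U0_def up_def)
  have U1w: "U1 *\<^sub>v w = dn (U *\<^sub>v w)" if w: "w \<in> carrier_vec S" for w
  proof (rule eq_vecI)
    fix i assume "i < dim_vec (dn (U *\<^sub>v w))"
    hence i: "i < K div 2" by (simp add: dn_def)
    hence i': "i + 1 < n" by (simp add: n)
    show "(U1 *\<^sub>v w) $ i = dn (U *\<^sub>v w) $ i"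
      using mult_mat_vec_index_sum[OF U1c w i] mult_mat_vec_index_sum[OF Uc w i'] i i'
      by (simp add: dn_def U1_def U_def del: index_mult_mat_vec)
  qed (simp add: U1_def dn_def)
  \<comment> \<open>From 32 S \<le> K and \<gamma>^2 = 4K/25; the exact ratio is \<surd>(25/128),
    about 0.4419.\<close>
  have sqS: "sqrt (real S) \<le> 442/1000 * \<gamma>"
  proof (rule power2_le_imp_le)
    have "(442/1000 * \<gamma>)\<^sup>2 = (442/1000)\<^sup>2 * (4/25) * real K"
      by (simp add: \<gamma>_def power_mult_distrib power2_eq_square)
    moreover have "32 * real S \<le> real K" using K(2) by linarith
    ultimately show "(sqrt (real S))\<^sup>2 \<le> (442/1000 * \<gamma>)\<^sup>2" by (simp add: power2_eq_square)
  qed (use \<gamma>0 in simp)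
  \<comment> \<open>\<open>U\<close> is an isometry and \<open>U0\<close> omits just its last row.
    If that row has norm at most 0.45, at least 1 - 0.2025 > 0.89^2 of the squared norm remains, so
    \<open>U0\<close> is injective with a lower bound.\<close>
  have last: "cmod ((U *\<^sub>v w) $ (K div 2)) \<le> 45/100 * vnorm w" if w: "w \<in> carrier_vec S" for w
  proof -
    have i: "K div 2 < n" by (simp add: n)
    have "(U *\<^sub>v w) $ (K div 2) = (V *\<^sub>v (B *\<^sub>v w)) $ (K div 2) + E w $ (K div 2)"
      unfolding UVE[OF w] using E[OF w] i by (intro index_add_vec) auto
    hence "cmod ((U *\<^sub>v w) $ (K div 2)) \<le> cmod ((V *\<^sub>v (B *\<^sub>v w)) $ (K div 2)) + cmod (E w $ (K div 2))"
      by (simp only: norm_triangle_ineq)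
    also have "\<dots> \<le> sqrt (real S) * vnorm (B *\<^sub>v w) + e * vnorm w"
      using vander_component[OF Bw[OF w] i] vnorm_component[OF E[OF w] i] En[OF w] by linarith
    also have "sqrt (real S) * vnorm (B *\<^sub>v w) \<le> 442/1000 * (\<gamma> * vnorm (B *\<^sub>v w))"
      using mult_right_mono[OF sqS, of "vnorm (B *\<^sub>v w)"] by (simp add: mult.assoc)
    also have "\<dots> \<le> 442/1000 * ((1 + e) * vnorm w)" using Bup[OF w] by simp
    finally have "cmod ((U *\<^sub>v w) $ (K div 2)) \<le> (442/1000 * (1 + e) + e) * vnorm w" by (simp add: algebra_simps)
    also have "\<dots> \<le> 45/100 * vnorm w"
    proof (rule mult_right_mono)
      show "442/1000 * (1 + e) + e \<le> 45/100" using e0 unfolding distrib_left by linarith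
    qed simp
    finally show ?thesis .
  qed
  have U0lo: "89/100 * vnorm w \<le> vnorm (U0 *\<^sub>v w)" if w: "w \<in> carrier_vec S" for w
  proof (rule power2_le_imp_le)
    have "(cmod ((U *\<^sub>v w) $ (K div 2)))\<^sup>2 \<le> (45/100 * vnorm w)\<^sup>2" using last[OF w] by (intro power_mono) auto
    hence "(cmod ((U *\<^sub>v w) $ (K div 2)))\<^sup>2 \<le> 2025/10000 * (vnorm w)\<^sup>2"
      by (simp add: power_mult_distrib power_divide)
    moreover have "(89/100 * vnorm w)\<^sup>2 = 7921/10000 * (vnorm w)\<^sup>2" by (simp add: power_mult_distrib power_divide)
    ultimately show "(89/100 * vnorm w)\<^sup>2 \<le> (vnorm (U0 *\<^sub>v w))\<^sup>2"
      unfolding U0w[OF w] upn[OF Uwc[OF w]] Un[OF w]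
      using zero_le_power2[of "vnorm w"] by linarith
  qed simp
  note P = pinv_injective[OF U0c _ U0lo]
  have P1: "pinv U0 \<in> carrier_mat S (K div 2)" "pinv U0 * U0 = 1\<^sub>m S"
    and P2: "\<And>v. v \<in> carrier_vec (K div 2) \<Longrightarrow> 89/100 * vnorm (pinv U0 *\<^sub>v v) \<le> vnorm v"
    using P by auto
  have Psi: "pinv U0 * U1 \<in> carrier_mat S S" by (rule mult_carrier_mat[OF P1(1) U1c])
  have main: "vnorm (B *\<^sub>v ((pinv U0 * U1) *\<^sub>v w) - Matrix.vec S (\<lambda>s. z s * (B *\<^sub>v w) $ s))
        \<le> 14 * sqrt (real S) * \<tau> * vnorm (B *\<^sub>v w)" if w: "w \<in> carrier_vec S" for w
  proof -
    let ?D = "Matrix.vec S (\<lambda>s. z s * (B *\<^sub>v w) $ s)"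
    \<comment> \<open>\<open>w'\<close> is the image of \<open>w\<close> under the noise-free ESPRIT
      matrix, the \<open>B\<close>-conjugate of diag(z).\<close>
    obtain w' where w': "w' \<in> carrier_vec S" "B *\<^sub>v w' = ?D"
      using injective_imp_surjective_mat[OF B Binj, of ?D] by auto
    have Bw': "vnorm (B *\<^sub>v w') = vnorm (B *\<^sub>v w)"
      unfolding w'(2) by (rule diag_vnorm_eq[OF Bw[OF w]]) simp
    have shift: "dn (V *\<^sub>v (B *\<^sub>v w)) = up (V *\<^sub>v (B *\<^sub>v w'))"
    proof (rule eq_vecI)
      fix i assume "i < dim_vec (up (V *\<^sub>v (B *\<^sub>v w')))"
      hence i: "i < K div 2" by (simp add: up_def)
      hence i': "i + 1 < n" "i < n" by (auto simp: n)
      show "dn (V *\<^sub>v (B *\<^sub>v w)) $ i = up (V *\<^sub>v (B *\<^sub>v w')) $ i"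
        using vander_mult_index[OF Bw[OF w] i'(1), of z] vander_mult_index[OF Bw[OF w'(1)] i'(2), of z] i
        by (simp add: up_def dn_def w'(2) del: index_mult_mat_vec) (simp add: mult_ac)
    qed (simp add: up_def dn_def)
    define r where "r = dn (E w) - up (E w')"
    have r: "r \<in> carrier_vec (K div 2)" using upc dnc by (simp add: r_def)
    have "U1 *\<^sub>v w = U0 *\<^sub>v w' + r"
    proof (rule eq_vecI)
      fix i assume "i < dim_vec (U0 *\<^sub>v w' + r)"
      hence i: "i < K div 2" using r by simp
      hence i': "i + 1 < n" "i < n" by (auto simp: n)
      have 1: "(U1 *\<^sub>v w) $ i = (V *\<^sub>v (B *\<^sub>v w)) $ (i + 1) + E w $ (i + 1)"
        unfolding U1w[OF w] UVE[OF w] using i i' E[OF w] by (simp add: dn_def del: index_mult_mat_vec)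
      have 2: "(U0 *\<^sub>v w') $ i = (V *\<^sub>v (B *\<^sub>v w')) $ i + E w' $ i"
        unfolding U0w[OF w'(1)] UVE[OF w'(1)] using i i' E[OF w'(1)] by (simp add: up_def del: index_mult_mat_vec)
      have 3: "(V *\<^sub>v (B *\<^sub>v w)) $ (i + 1) = (V *\<^sub>v (B *\<^sub>v w')) $ i"
        using arg_cong[OF shift, of "\<lambda>v. v $ i"] i by (simp add: dn_def up_def del: index_mult_mat_vec)
      have 4: "(U0 *\<^sub>v w' + r) $ i = (U0 *\<^sub>v w') $ i + (E w $ (i + 1) - E w' $ i)"
        using i r by (simp add: r_def dn_def up_def del: index_mult_mat_vec)
      show "(U1 *\<^sub>v w) $ i = (U0 *\<^sub>v w' + r) $ i" unfolding 1 4 2 3 by simp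
    qed (use r in \<open>simp add: U1_def\<close>)
    hence "(pinv U0 * U1) *\<^sub>v w = pinv U0 *\<^sub>v (U0 *\<^sub>v w' + r)"
      using assoc_mult_mat_vec[OF P1(1) U1c w] by simp
    also have "\<dots> = pinv U0 *\<^sub>v (U0 *\<^sub>v w') + pinv U0 *\<^sub>v r"
      by (rule mult_add_distrib_mat_vec[OF P1(1) mult_mat_vec_carrier[OF U0c w'(1)] r])
    also have "pinv U0 *\<^sub>v (U0 *\<^sub>v w') = w'"
      using assoc_mult_mat_vec[OF P1(1) U0c w'(1)] P1(2) w'(1) by simp
    finally have Pw: "(pinv U0 * U1) *\<^sub>v w = w' + pinv U0 *\<^sub>v r" .
    have Pr: "pinv U0 *\<^sub>v r \<in> carrier_vec S" by (rule mult_mat_vec_carrier[OF P1(1) r])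
    have "B *\<^sub>v ((pinv U0 * U1) *\<^sub>v w) = ?D + B *\<^sub>v (pinv U0 *\<^sub>v r)"
      unfolding Pw w'(2)[symmetric] by (rule mult_add_distrib_mat_vec[OF B w'(1) Pr])
    moreover have "?D + t - ?D = t" if "t \<in> carrier_vec S" for t by (rule eq_vecI) (use that in auto)
    ultimately have diff: "B *\<^sub>v ((pinv U0 * U1) *\<^sub>v w) - ?D = B *\<^sub>v (pinv U0 *\<^sub>v r)" using Bw[OF Pr] by simp
    let ?T = "vnorm (B *\<^sub>v (pinv U0 *\<^sub>v r))" and ?b = "vnorm (B *\<^sub>v w)" and ?q = "sqrt (real n * real S)"
    have "vnorm r \<le> vnorm (dn (E w)) + vnorm (up (E w'))" unfolding r_def by (rule vnorm_minus_le[OF dnc upc])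
    also have "\<dots> \<le> e * vnorm w + e * vnorm w'"
      using dnl[OF E[OF w]] upl[OF E[OF w'(1)]] En[OF w] En[OF w'(1)] by linarith
    finally have "(1 - e) * vnorm r \<le> (1 - e) * (e * vnorm w + e * vnorm w')"
      using e0 by (intro mult_left_mono) auto
    also have "\<dots> = e * ((1 - e) * vnorm w + (1 - e) * vnorm w')" by (simp add: algebra_simps)
    also have "\<dots> \<le> e * (?q * ?b + ?q * ?b)" using Blo[OF w] Blo[OF w'(1)] Bw' e0 by (intro mult_left_mono add_mono) auto
    finally have r1: "(1 - e) * vnorm r \<le> 2 * e * ?q * ?b" by (simp add: mult_ac)
    \<comment> \<open>This is \<surd>0.53 divided by 2/5, rounded up; here the passage between
      \<open>w\<close> and \<open>B w\<close> contributes the factor \<surd>S.\<close>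
    have q: "?q \<le> 1821/1000 * \<gamma> * sqrt (real S)"
    proof -
      have "sqrt (real n) \<le> 1821/1000 * \<gamma>"
      proof (rule power2_le_imp_le)
        have "(1821/1000 * \<gamma>)\<^sup>2 = (1821/1000)\<^sup>2 * (4/25) * real K"
          by (simp add: \<gamma>_def power_mult_distrib power2_eq_square)
        thus "(sqrt (real n))\<^sup>2 \<le> (1821/1000 * \<gamma>)\<^sup>2" using n_le by (simp add: power2_eq_square)
      qed (use \<gamma>0 in simp)
      hence "sqrt (real n) * sqrt (real S) \<le> 1821/1000 * \<gamma> * sqrt (real S)" by (rule mult_right_mono) simp
      thus ?thesis by (simp add: real_sqrt_mult)
    qed
    have "\<gamma> * ?T \<le> (1 + e) * vnorm (pinv U0 *\<^sub>v r)" by (rule Bup[OF Pr])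
    also have "\<dots> \<le> (1 + e) * (100/89 * vnorm r)" using P2[OF r] e0 by (intro mult_left_mono) auto
    finally have "(1 - e) * (\<gamma> * ?T) \<le> (1 - e) * ((1 + e) * (100/89 * vnorm r))"
      using e0 by (intro mult_left_mono) auto
    also have "\<dots> = (1 + e) * (100/89) * ((1 - e) * vnorm r)" by (simp add: algebra_simps)
    also have "\<dots> \<le> (1 + e) * (100/89) * (2 * e * ?q * ?b)" using r1 e0 by (intro mult_left_mono) auto
    also have "\<dots> \<le> (1 + e) * (100/89) * (2 * e * (1821/1000 * \<gamma> * sqrt (real S)) * ?b)"
      using q e0 by (intro mult_left_mono mult_right_mono) auto
    also have "\<dots> = \<gamma> * ((1 + e) * (100/89 * 2 * (1821/1000)) * e * (sqrt (real S) * ?b))" by (simp add: mult_ac)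
    finally have "\<gamma> * ((1 - e) * ?T) \<le> \<gamma> * ((1 + e) * (100/89 * 2 * (1821/1000)) * e * (sqrt (real S) * ?b))"
      by (simp add: mult_ac)
    hence "(1 - e) * ?T \<le> (1 + e) * (100/89 * 2 * (1821/1000)) * e * (sqrt (real S) * ?b)"
      using \<gamma>0 by (simp only: mult_le_cancel_left_pos)
    also have "\<dots> \<le> (191/190) * (100/89 * 2 * (1821/1000)) * e * (sqrt (real S) * ?b)"
    proof (intro mult_right_mono)
      show "1 + e \<le> 191/190" using e0 by linarith
    qed (use e0 in auto)
    finally have 5: "(1 - e) * ?T \<le> (191/190) * (100/89 * 2 * (1821/1000)) * e * (sqrt (real S) * ?b)" .
    have "189/190 * ?T \<le> (1 - e) * ?T"
    proof (rule mult_right_mono)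
      show "189/190 \<le> 1 - e" using e0 by linarith
    qed simp
    hence "189/190 * ?T \<le> (191/190) * (100/89 * 2 * (1821/1000)) * (167/50) * (\<tau> * (sqrt (real S) * ?b))"
    proof -
      have "(191/190) * (100/89 * 2 * (1821/1000)) * e * (sqrt (real S) * ?b)
          = (191/190) * (100/89 * 2 * (1821/1000)) * (167/50) * (\<tau> * (sqrt (real S) * ?b))" by (simp add: e_def)
      thus ?thesis using 5 \<open>189/190 * ?T \<le> (1 - e) * ?T\<close> by linarith
    qed
    moreover have "0 \<le> \<tau> * (sqrt (real S) * ?b)" using \<tau>(1) by simp
    \<comment> \<open>The product of the numerical factors collected above, divided by 189/190, is
      about 13.81.\<close>
    ultimately have "?T \<le> 14 * (\<tau> * (sqrt (real S) * ?b))" by linarith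
    thus ?thesis unfolding diff by (simp add: mult_ac)
  qed
  show ?thesis using that[OF B Psi Binj main] by blast
qed

end

lemma esprit_outputs_nonempty: "esprit_outputs K S y \<noteq> {}"
proof -
  obtain W Sg X where "is_svd (hankel K y) W Sg X"
    by (rule svd_exists[of "hankel K y" "K div 2 + 1"]) (auto simp: hankel_def)
  thus ?thesis unfolding esprit_outputs_def Let_def by blast
qed

text \<open>The budget behind the factor 80. With \<tau> = \<eta>/(80 S^2) the perturbation is f =
  14\<surd>S \<tau>, and g = 2.1 f satisfies the required g > 2f. The eigenvalue error (2S - 1)g is
  at most 441/800 \<eta> because (2S - 1)\<surd>S \<le> 3/2 S^2. Passing to phases multiplies this
  by 2/3.69, which gives slightly less than 3/10 \<eta>.\<close>

theorem esprit_stable: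
  assumes S: "S \<ge> 1" and K: "even K" "32 * S < K"
    and \<Delta>: "\<Delta> > 0" "real K * \<Delta> > 4"
    and gap: "\<And>s t. s < S \<Longrightarrow> t < S \<Longrightarrow> s \<noteq> t \<Longrightarrow> \<Delta> \<le> dist_Z (x s - x t)"
    and \<beta>: "\<beta> > 0" "\<And>s. s < S \<Longrightarrow> \<beta> \<le> p s"
    and \<delta>: "\<delta> \<ge> 0" "\<And>k. k \<le> K \<Longrightarrow> cmod (y k - (\<Sum>s<S. complex_of_real (p s) * cis (- (2 * pi * x s)) ^ k)) \<le> \<delta>"
    and \<eta>: "80 * (real S)\<^sup>2 * \<delta> < \<eta> * \<beta>" "\<eta> \<le> 1/8"
    and L: "L \<in> esprit_outputs K S y"
  shows "\<And>v. v \<in> L \<Longrightarrow> \<exists>s<S. dist_Z (v - x s) \<le> 3/10 * \<eta>"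
    and "\<And>s. s < S \<Longrightarrow> \<exists>v\<in>L. dist_Z (v - x s) \<le> 3/10 * \<eta>"
proof -
  define \<tau> where "\<tau> = \<eta> / (80 * (real S)\<^sup>2)"
  have S2: "(real S)\<^sup>2 \<ge> 1" using S by simp
  have "80 * (real S)\<^sup>2 * \<delta> \<ge> 0" using \<delta>(1) by simp
  hence "\<eta> * \<beta> > 0" using \<eta>(1) by linarith
  hence \<eta>0: "\<eta> > 0" using \<beta>(1) by (simp add: zero_less_mult_iff)
  have \<tau>0: "\<tau> > 0" using \<eta>0 S by (simp add: \<tau>_def)
  have \<tau>\<eta>: "80 * (real S)\<^sup>2 * \<tau> = \<eta>" using S by (simp add: \<tau>_def)
  have "80 * 1 * \<tau> \<le> 80 * (real S)\<^sup>2 * \<tau>" using S2 \<tau>0 by (intro mult_right_mono mult_left_mono) auto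
  hence \<tau>1: "\<tau> \<le> 1/640" using \<tau>\<eta> \<eta>(2) by linarith
  have "80 * (real S)\<^sup>2 * \<delta> < 80 * (real S)\<^sup>2 * (\<tau> * \<beta>)" using \<eta>(1) \<tau>\<eta> by (simp add: mult.assoc[symmetric])
  hence \<delta>\<tau>: "\<delta> \<le> \<tau> * \<beta>" using S2 by (simp add: mult_less_cancel_left)
  obtain W Sg X where svd: "is_svd (hankel K y) W Sg X"
    and Leq: "L = {frac (- Arg \<mu> / (2 * pi)) | \<mu>. eigenvalue
       (pinv (mat (K div 2) S (\<lambda>(i,j). mat (K div 2 + 1) S (\<lambda>(i,j). W $$ (i,j)) $$ (i,j)))
         * mat (K div 2) S (\<lambda>(i,j). mat (K div 2 + 1) S (\<lambda>(i,j). W $$ (i,j)) $$ (i + 1,j))) \<mu>}"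
    using L unfolding esprit_outputs_def Let_def by blast
  have U0: "mat (K div 2) S (\<lambda>(i,j). mat (K div 2 + 1) S (\<lambda>(i,j). W $$ (i,j)) $$ (i,j))
      = mat (K div 2) S (\<lambda>(i,j). W $$ (i,j))" by (rule eq_matI) auto
  have U1: "mat (K div 2) S (\<lambda>(i,j). mat (K div 2 + 1) S (\<lambda>(i,j). W $$ (i,j)) $$ (i + 1,j))
      = mat (K div 2) S (\<lambda>(i,j). W $$ (i + 1,j))" by (rule eq_matI) auto
  let ?Psi = "pinv (mat (K div 2) S (\<lambda>(i,j). W $$ (i,j))) * mat (K div 2) S (\<lambda>(i,j). W $$ (i + 1,j))"
  have Leq: "L = {frac (- Arg \<mu> / (2 * pi)) | \<mu>. eigenvalue ?Psi \<mu>}" using Leq unfolding U0 U1 .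
  let ?z = "\<lambda>s. cis (- (2 * pi * x s))"
  define f where "f = 14 * sqrt (real S) * \<tau>"
  define g where "g = 21/10 * f"
  define r where "r = (2 * real S - 1) * g"
  have f0: "f > 0" using S \<tau>0 by (simp add: f_def)
  have fg: "g > 2 * f" "g > 0" using f0 by (auto simp: g_def)
  obtain B where B: "B \<in> carrier_mat S S" "?Psi \<in> carrier_mat S S"
    "\<And>v. v \<in> carrier_vec S \<Longrightarrow> B *\<^sub>v v = 0\<^sub>v S \<Longrightarrow> v = 0\<^sub>v S"
    "\<And>w. w \<in> carrier_vec S \<Longrightarrow> vnorm (B *\<^sub>v (?Psi *\<^sub>v w) - Matrix.vec S (\<lambda>s. ?z s * (B *\<^sub>v w) $ s))
        \<le> f * vnorm (B *\<^sub>v w)"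
    unfolding f_def
    by (rule esprit_perturbation[OF refl S K \<Delta> gap \<beta> \<delta> \<tau>0 \<tau>1 \<delta>\<tau> svd]) blast+
  have f0': "0 \<le> f" using f0 by simp
  have near: "\<exists>s<S. cmod (\<mu> - ?z s) \<le> f" if "eigenvalue ?Psi \<mu>" for \<mu>
    by (rule perturbed_eigenvalue_near[OF B(2) B(1) B(3) f0' B(4) that])
  have ex: "\<exists>\<mu>. eigenvalue ?Psi \<mu> \<and> cmod (\<mu> - ?z s) \<le> (2 * real S - 1) * g" if "s < S" for s
    by (rule perturbed_eigenvalue_exists[OF B(2) B(1) B(3) f0' B(4) that fg(1)])
  have "1 * g \<le> r" unfolding r_def using S fg by (intro mult_right_mono) auto
  hence fr: "f \<le> r" using fg f0 by simp
  have r\<eta>: "r \<le> 441/800 * \<eta>"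
  proof -
    define q where "q = sqrt (real S)"
    have q1: "q \<ge> 1" using S by (simp add: q_def)
    have qS: "real S = q\<^sup>2" by (simp add: q_def)
    \<comment> \<open>Expanding about q = 1 shows nonnegativity for q \<ge> 1. After multiplication
      by q this is 2q^3 - q \<le> 3/2 q^4.\<close>
    have "3/2 * q^3 - 2 * q\<^sup>2 + 1 = 3/2 * (q - 1)^3 + 5/2 * (q - 1)\<^sup>2 + (q - 1) / 2 + 1/2"
      by (simp add: power2_eq_square power3_eq_cube field_simps)
    also have "\<dots> \<ge> 0" using q1 by simp
    finally have "0 \<le> q * (3/2 * q^3 - 2 * q\<^sup>2 + 1)" using q1 by (intro mult_nonneg_nonneg) auto
    hence "(2 * q\<^sup>2 - 1) * q \<le> 3/2 * (q\<^sup>2)\<^sup>2"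
      by (simp add: power2_eq_square power3_eq_cube algebra_simps)
    hence "(2 * real S - 1) * sqrt (real S) \<le> 3/2 * (real S)\<^sup>2" unfolding qS[symmetric] by (simp add: q_def)
    hence "147/5 * \<tau> * ((2 * real S - 1) * sqrt (real S)) \<le> 147/5 * \<tau> * (3/2 * (real S)\<^sup>2)"
      using \<tau>0 by (intro mult_left_mono) auto
    moreover have "r = 147/5 * \<tau> * ((2 * real S - 1) * sqrt (real S))" by (simp add: r_def g_def f_def)
    moreover have "147/5 * \<tau> * (3/2 * (real S)\<^sup>2) = 441/800 * \<eta>" unfolding \<tau>\<eta>[symmetric] by simp
    ultimately show ?thesis by linarith
  qed
  have r1: "r < 1" using r\<eta> \<eta>(2) by linarith
  have d: "dist_Z (frac (- Arg \<mu> / (2 * pi)) - x s) \<le> 3/10 * \<eta>" if "cmod (\<mu> - ?z s) \<le> r" for \<mu> s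
    using phase_of_near_eigenvalue[OF that r1] r\<eta> \<eta>0 by simp
  show "\<exists>s<S. dist_Z (v - x s) \<le> 3/10 * \<eta>" if v: "v \<in> L" for v
  proof -
    obtain \<mu> where \<mu>: "v = frac (- Arg \<mu> / (2 * pi))" "eigenvalue ?Psi \<mu>"
      using v unfolding Leq by blast
    obtain s where s: "s < S" "cmod (\<mu> - ?z s) \<le> f" using near[OF \<mu>(2)] by blast
    have "cmod (\<mu> - ?z s) \<le> r" using s(2) fr by linarith
    thus ?thesis using d \<mu>(1) s(1) by blast
  qed
  show "\<exists>v\<in>L. dist_Z (v - x s) \<le> 3/10 * \<eta>" if s: "s < S" for s
  proof -
    obtain \<mu> where "eigenvalue ?Psi \<mu>" "cmod (\<mu> - ?z s) \<le> r" using ex[OF s] unfolding r_def by blast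
    thus ?thesis using d unfolding Leq by blast
  qed
qed

section \<open>Geometry of the refinement step\<close>

context
  fixes M \<eta> :: real and S :: nat and lam :: "nat \<Rightarrow> real" and L Ep :: "real set"
  assumes M: "M > 0" and \<eta>: "\<eta> > 0"
    and near1: "\<And>v. v \<in> L \<Longrightarrow> \<exists>s<S. dist_Z (v - M * lam s) \<le> 3/10 * \<eta>"
    and near2: "\<And>s. s < S \<Longrightarrow> \<exists>v\<in>L. dist_Z (v - M * lam s) \<le> 3/10 * \<eta>"
    and lamE: "\<And>s. s < S \<Longrightarrow> lam s \<in> Ep"
    and sep: "\<And>s t q. s < S \<Longrightarrow> t < S \<Longrightarrow> q \<noteq> (0::int) \<Longrightarrow> 9/5 * (\<eta> / M) \<le> \<bar>lam s - lam t - of_int q / M\<bar>"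
    and sepE: "\<And>x s q. x \<in> Ep \<Longrightarrow> s < S \<Longrightarrow> q \<noteq> (0::int) \<Longrightarrow> 4/5 * (\<eta> / M) < \<bar>x - lam s - of_int q / M\<bar>"
begin

private abbreviation (input) P :: "real set" where "P \<equiv> {x. M * x \<in> ballT L (\<eta> / 2)}"

lemma preimage_near:
  assumes "x \<in> P"
  obtains s q where "s < S" "\<bar>x - lam s - of_int q / M\<bar> \<le> 4/5 * (\<eta> / M)"
proof -
  obtain v where v: "v \<in> L" "dist_Z (M * x - v) \<le> \<eta> / 2" using assms by (auto simp: ballT_def)
  obtain s where s: "s < S" "dist_Z (v - M * lam s) \<le> 3/10 * \<eta>" using near1[OF v(1)] by blast
  have "dist_Z ((M * x - v) + (v - M * lam s)) \<le> \<eta> / 2 + 3/10 * \<eta>"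
    using dist_Z_triangle[of "M * x - v" "v - M * lam s"] v s by linarith
  hence "dist_Z (M * x - M * lam s) \<le> 4/5 * \<eta>" by simp
  then obtain q :: int where "\<bar>M * x - M * lam s - of_int q\<bar> \<le> 4/5 * \<eta>" unfolding dist_Z_le_iff by blast
  moreover have "M * x - M * lam s - of_int q = M * (x - lam s - of_int q / M)" using M by (simp add: field_simps)
  ultimately have "M * \<bar>x - lam s - of_int q / M\<bar> \<le> 4/5 * \<eta>" using M by (simp add: abs_mult)
  hence "\<bar>x - lam s - of_int q / M\<bar> \<le> 4/5 * (\<eta> / M)" using M by (simp add: field_simps)
  thus ?thesis using that s(1) by blast
qed

lemma preimage_contains:
  assumes "s < S" "\<bar>x - lam s\<bar> \<le> \<eta> / 5 / M"
  shows "x \<in> P"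
proof -
  obtain v where v: "v \<in> L" "dist_Z (v - M * lam s) \<le> 3/10 * \<eta>" using near2[OF assms(1)] by blast
  have "dist_Z (M * x - M * lam s) \<le> M * \<bar>x - lam s\<bar>"
    using dist_Z_le[of "M * x - M * lam s" 0] M by (simp add: right_diff_distrib[symmetric] abs_mult)
  also have "\<dots> \<le> \<eta> / 5" using assms(2) M by (simp add: field_simps)
  finally have "dist_Z ((M * x - M * lam s) + (M * lam s - v)) \<le> \<eta> / 2"
    using dist_Z_triangle[of "M * x - M * lam s" "M * lam s - v"] v(2) dist_Z_commute[of v "M * lam s"] by linarith
  thus ?thesis using v(1) by (auto simp: ballT_def)
qed

text \<open>
  The arcs lie in the \<open>4\<eta>/(5M)\<close>-balls around the points \<open>lam s + q/M\<close>; enlarged to radius \<open>9\<eta>/(10M)\<close>,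
  the balls with \<open>q = 0\<close> are still disjoint from the others, so a connected arc meets only one kind.
\<close>

lemma component_near:
  assumes D: "D \<in> components P" "D \<inter> Ep \<noteq> {}" and x: "x \<in> D"
  shows "\<exists>s<S. \<bar>x - lam s\<bar> \<le> 4/5 * (\<eta> / M)"
proof -
  define r where "r = 9/10 * (\<eta> / M)"
  have "\<eta> / M > 0" using M \<eta> by simp
  hence r: "4/5 * (\<eta> / M) < r" unfolding r_def by linarith
  define X0 where "X0 = (\<Union>s\<in>{..<S}. ball (lam s) r)"
  define X1 where "X1 = (\<Union>s\<in>{..<S}. \<Union>q\<in>{q::int. q \<noteq> 0}. ball (lam s + of_int q / M) r)"
  have DP: "D \<subseteq> P" using in_components_subset[OF D(1)] .
  have cover: "y \<in> X0 \<union> X1" if yD: "y \<in> D" for y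
  proof -
    obtain s q where s: "s < S" "\<bar>y - lam s - of_int q / M\<bar> \<le> 4/5 * (\<eta> / M)"
      using preimage_near[of y] DP yD by blast
    have "\<bar>(lam s + of_int q / M) - y\<bar> < r" using s(2) r by linarith
    hence "y \<in> ball (lam s + of_int q / M) r" by (simp add: dist_real_def)
    thus ?thesis using s(1) unfolding X0_def X1_def by (cases "q = 0") auto
  qed
  obtain y where y: "y \<in> D" "y \<in> Ep" using D(2) by blast
  \<comment> \<open>The point of \<open>D\<close> in \<open>Ep\<close> decides the kind of the arc:
    \<open>sepE\<close> keeps it away from every translate with q \<noteq> 0.\<close>
  have "y \<in> X0"
  proof -
    obtain s q where s: "s < S" "\<bar>y - lam s - of_int q / M\<bar> \<le> 4/5 * (\<eta> / M)"
      using preimage_near[of y] DP y(1) by blast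
    have "q = 0" using sepE[OF y(2) s(1), of q] s(2) by fastforce
    hence "\<bar>lam s - y\<bar> < r" using s(2) r by simp
    thus ?thesis using s(1) unfolding X0_def by (auto simp: dist_real_def)
  qed
  have disj: "X0 \<inter> X1 = {}"
  proof (rule ccontr)
    assume "X0 \<inter> X1 \<noteq> {}"
    then obtain u s t and q :: int where u: "s < S" "t < S" "q \<noteq> 0" "\<bar>lam s - u\<bar> < r" "\<bar>lam t + of_int q / M - u\<bar> < r"
      by (auto simp: X0_def X1_def dist_real_def)
    have "\<bar>lam s - lam t - of_int q / M\<bar> < 2 * r" using u(4,5) by linarith
    thus False using sep[OF u(1-3)] by (simp add: r_def)
  qed
  have "X1 \<inter> D = {}"
  proof (rule ccontr)
    assume "X1 \<inter> D \<noteq> {}"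
    moreover have "open X0" "open X1" by (auto simp: X0_def X1_def)
    ultimately have "\<not> connected D"
      unfolding connected_def using cover disj y(1) \<open>y \<in> X0\<close> by blast
    thus False using in_components_connected[OF D(1)] by simp
  qed
  moreover obtain s q where s: "s < S" "\<bar>x - lam s - of_int q / M\<bar> \<le> 4/5 * (\<eta> / M)"
    using preimage_near[of x] DP x by blast
  moreover have "\<bar>(lam s + of_int q / M) - x\<bar> < r" using s(2) r by linarith
  hence "x \<in> ball (lam s + of_int q / M) r" by (simp add: dist_real_def)
  ultimately have "q = 0" using x s(1) unfolding X1_def by blast
  thus ?thesis using s by auto
qed

text \<open>Two shifts of one arc that both meet \<open>Ep\<close> both lie near unshifted points.
  Their offset j/M is then within 8/5 \<eta>/M of a difference of such points, less than the
  separation 9/5 \<eta>/M allows unless j = 0.\<close>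

lemma component_unique:
  assumes D: "D \<in> components P" "D \<inter> Ep \<noteq> {}" and D': "D' \<in> components P" "D' \<inter> Ep \<noteq> {}"
    and same: "same_arc M D D'"
  shows "D' = D"
proof -
  obtain j :: int where j: "D' = (\<lambda>x. x + of_int j / M) ` D" using same by (auto simp: same_arc_def)
  obtain x where x: "x \<in> D" using D(2) by blast
  obtain s where s: "s < S" "\<bar>x - lam s\<bar> \<le> 4/5 * (\<eta> / M)" using component_near[OF D x] by blast
  have "x + of_int j / M \<in> D'" using x j by blast
  then obtain t where t: "t < S" "\<bar>x + of_int j / M - lam t\<bar> \<le> 4/5 * (\<eta> / M)" using component_near[OF D'] by blast
  have "\<bar>lam t - lam s - of_int j / M\<bar> \<le> 8/5 * (\<eta> / M)" using s(2) t(2) by linarith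
  moreover have "\<eta> / M > 0" using M \<eta> by simp
  ultimately have "\<bar>lam t - lam s - of_int j / M\<bar> < 9/5 * (\<eta> / M)" by linarith
  hence "j = 0" using sep[OF t(1) s(1), of j] by fastforce
  thus ?thesis using j by simp
qed

lemma same_arc_common:
  assumes "same_arc M D D1" "same_arc M D D2" shows "same_arc M D1 D2"
proof -
  obtain i j :: int where "D1 = (\<lambda>x. x + of_int i / M) ` D" "D2 = (\<lambda>x. x + of_int j / M) ` D"
    using assms by (auto simp: same_arc_def)
  hence "D2 = (\<lambda>x. x + of_int (j - i) / M) ` D1" by (auto simp: image_image diff_divide_distrib)
  thus ?thesis unfolding same_arc_def by blast
qed

lemma same_arc_refl: "same_arc M D D"
  unfolding same_arc_def by (rule exI[of _ 0]) simp

text \<open>All components that meet \<open>Ep\<close> can be taken together, since no arc has two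
  of them. Existence has to be established because the selection of \<open>E\<close> is constrained
  only when an admissible set exists.\<close>

lemma E_update_exists: "\<exists>E. E_update_ok M (ballT L (\<eta> / 2)) Ep E"
proof -
  let ?F = "{D \<in> components P. D \<inter> Ep \<noteq> {}}"
  have "\<exists>!D'. D' \<in> ?F \<and> same_arc M D D'"
    if D: "D \<in> components P" "D1 \<in> components P" "same_arc M D D1" "D1 \<inter> Ep \<noteq> {}" for D D1
  proof (rule ex1I[of _ D1])
    fix D2 assume D2: "D2 \<in> ?F \<and> same_arc M D D2"
    have "same_arc M D1 D2" using same_arc_common D(3) D2 by blast
    thus "D2 = D1" using component_unique[OF D(2,4)] D2 by blast
  qed (use D in auto)
  hence "E_update_ok M (ballT L (\<eta> / 2)) Ep (\<Union>?F)"
    unfolding E_update_ok_def Let_def by (intro exI[of _ ?F]) blast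
  thus ?thesis by blast
qed

text \<open>For the inner bound, the component of \<open>lam s\<close> itself meets
  \<open>Ep\<close>, and by uniqueness the representative chosen for its arc can be no
  other.\<close>

lemma E_update_bounds:
  assumes "E_update_ok M (ballT L (\<eta> / 2)) Ep E"
  shows "E \<subseteq> ballR (lam ` {..<S}) (4/5 * (\<eta> / M))"
    and "\<And>s. s < S \<Longrightarrow> {lam s - \<eta> / 5 / M .. lam s + \<eta> / 5 / M} \<subseteq> E"
proof -
  from assms obtain F where F0: "F \<subseteq> components P \<and> E = \<Union>F \<and> (\<forall>D\<in>F. D \<inter> Ep \<noteq> {}) \<and>
    (\<forall>D\<in>components P. (\<exists>D'\<in>components P. same_arc M D D' \<and> D' \<inter> Ep \<noteq> {}) \<longrightarrow> (\<exists>!D'. D' \<in> F \<and> same_arc M D D'))"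
    unfolding E_update_ok_def Let_def by (rule exE)
  hence F: "F \<subseteq> components P" "E = \<Union>F" "\<And>D. D \<in> F \<Longrightarrow> D \<inter> Ep \<noteq> {}" by simp_all
  have F4: "\<exists>!D'. D' \<in> F \<and> same_arc M D D'" if "D \<in> components P" "same_arc M D D" "D \<inter> Ep \<noteq> {}" for D
    using F0[THEN conjunct2, THEN conjunct2, THEN conjunct2, rule_format, OF that(1)] that by blast
  show "E \<subseteq> ballR (lam ` {..<S}) (4/5 * (\<eta> / M))"
  proof
    fix x assume "x \<in> E"
    then obtain D where D: "D \<in> F" "x \<in> D" using F(2) by blast
    obtain s where "s < S" "\<bar>x - lam s\<bar> \<le> 4/5 * (\<eta> / M)"
      using component_near[of D x] D F by blast
    thus "x \<in> ballR (lam ` {..<S}) (4/5 * (\<eta> / M))" by (auto simp: ballR_def abs_le_iff intro!: bexI[of _ s])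
  qed
  fix s assume s: "s < S"
  let ?D = "connected_component_set P (lam s)"
  have \<eta>M: "\<eta> / 5 / M \<ge> 0" using M \<eta> by simp
  have lP: "lam s \<in> P" using preimage_contains[OF s, of "lam s"] \<eta>M by simp
  have D: "?D \<in> components P" using lP by (auto simp: components_def)
  have lD: "lam s \<in> ?D" using lP by (simp add: connected_component_refl)
  hence DE: "?D \<inter> Ep \<noteq> {}" using lamE[OF s] by blast
  obtain D' where D': "D' \<in> F" "same_arc M ?D D'" using F4[OF D same_arc_refl DE] by blast
  have "D' = ?D" using component_unique[OF D DE _ _ D'(2)] F D'(1) by blast
  hence "?D \<subseteq> E" using D'(1) F(2) by blast
  moreover have "{lam s - \<eta> / 5 / M .. lam s + \<eta> / 5 / M} \<subseteq> ?D"
    using preimage_contains[OF s] \<eta>M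
    by (intro connected_component_maximal) (auto simp: abs_le_iff)
  ultimately show "{lam s - \<eta> / 5 / M .. lam s + \<eta> / 5 / M} \<subseteq> E" by blast
qed

end

section \<open>Admissible refinement factors\<close>

text \<open>\<open>G\<close> contains the intervals of radius u + w about the points
  \<open>lam s\<close> and of radius w about the points of \<open>Ep\<close>. As \<open>G\<close> is
  disjoint from its translates, distances modulo translation exceed the sums of the radii, 2u + 2w
  and u + 2w. The \<eta>/4 in w yields the first two claims; the \<open>Dt / 2\<close> yields the
  third, which preserves the gap at the next level.\<close>

lemma m_rule_separation:
  assumes ok: "m_rule_ok Dt \<eta> Mp Ep m" and Mp: "Mp > 0" and \<eta>: "\<eta> > 0" and Dt: "Dt > 0"
    and lamE: "\<And>s. s < S \<Longrightarrow> {lam s - \<eta> / 5 / Mp .. lam s + \<eta> / 5 / Mp} \<subseteq> Ep"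
  defines "M \<equiv> Mp * m"
  shows "\<And>s t q. s < S \<Longrightarrow> t < S \<Longrightarrow> q \<noteq> (0::int) \<Longrightarrow> 9/5 * (\<eta> / M) \<le> \<bar>lam s - lam t - of_int q / M\<bar>"
    and "\<And>x s q. x \<in> Ep \<Longrightarrow> s < S \<Longrightarrow> q \<noteq> (0::int) \<Longrightarrow> 4/5 * (\<eta> / M) < \<bar>x - lam s - of_int q / M\<bar>"
    and "\<And>s t q. s < S \<Longrightarrow> t < S \<Longrightarrow> q \<noteq> (0::int) \<Longrightarrow> Dt / Mp \<le> \<bar>lam s - lam t - of_int q / M\<bar>"
proof -
  define w where "w = max (Dt / 2) (\<eta> / 4) / Mp"
  define u where "u = \<eta> / 5 / Mp"
  have m: "2 \<le> m" "m \<le> 4" using ok by (auto simp: m_rule_ok_def)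
  have M: "M > 0" using m Mp by (simp add: M_def)
  have w: "Dt / (2 * Mp) \<le> w" "\<eta> / (4 * Mp) \<le> w" using Mp by (auto simp: w_def field_simps)
  have u0: "u > 0" using \<eta> Mp by (simp add: u_def)
  have w0: "w > 0" using w(2) \<eta> Mp by (smt (verit) divide_pos_pos mult_pos_pos)
  have disj: "\<not> (g \<in> ballR Ep w \<and> g + of_int q / M \<in> ballR Ep w)" if "q \<noteq> (0::int)" for g q
    using ok that unfolding m_rule_ok_def Let_def w_def M_def by blast
  have mem: "g \<in> ballR Ep w" if "x \<in> Ep" "\<bar>g - x\<bar> \<le> w" for g x
    using that by (auto simp: ballR_def abs_le_iff intro!: bexI[of _ x])
  have memL: "g \<in> ballR Ep w" if s: "s < S" and g: "\<bar>g - lam s\<bar> \<le> u + w" for g s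
  proof -
    define x where "x = max (lam s - u) (min (lam s + u) g)"
    have "lam s - u \<le> x" "x \<le> lam s + u" unfolding x_def using u0 by linarith+
    hence "x \<in> Ep" using lamE[OF s] unfolding u_def by auto
    moreover have "\<bar>g - x\<bar> \<le> w" using g u0 w0 unfolding x_def by linarith
    ultimately show ?thesis by (rule mem)
  qed
  \<comment> \<open>In the unit \<eta>/(2 Mp), which is at least \<eta>/M because m \<ge> 2, one has
    u = 2/5 and w \<ge> 1/2. Hence 2u + 2w \<ge> 9/5 and u + 2w \<ge> 7/5 > 4/5.\<close>
  have \<eta>M: "\<eta> / M \<le> \<eta> / (2 * Mp)" unfolding M_def using m Mp \<eta> by (intro divide_left_mono) (auto simp: mult.commute)
  have u1: "u = 2/5 * (\<eta> / (2 * Mp))" and w1: "\<eta> / (4 * Mp) = 1/2 * (\<eta> / (2 * Mp))" by (auto simp: u_def)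
  have main: "2 * u + 2 * w < \<bar>lam s - lam t - of_int q / M\<bar>" if "s < S" "t < S" "q \<noteq> (0::int)" for s t q
  proof (rule ccontr)
    assume n: "\<not> 2 * u + 2 * w < \<bar>lam s - lam t - of_int q / M\<bar>"
    define d where "d = lam s - lam t - of_int q / M"
    define c where "c = lam t + d / 2"
    have d: "\<bar>d\<bar> \<le> 2 * u + 2 * w" using n unfolding d_def by simp
    have "d \<le> 2 * u + 2 * w" "- d \<le> 2 * u + 2 * w" using abs_le_D1[OF d] abs_le_D2[OF d] by auto
    hence d2: "\<bar>d / 2\<bar> \<le> u + w" by (simp add: abs_le_iff)
    have 1: "\<bar>c - lam t\<bar> \<le> u + w" using d2 unfolding c_def by simp
    have "c + of_int q / M - lam s = - (d / 2)" unfolding c_def d_def by (simp add: field_simps)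
    hence "\<bar>c + of_int q / M - lam s\<bar> \<le> u + w" using d2 by simp
    with 1 show False using disj[OF that(3), of c] memL that by blast
  qed
  show "9/5 * (\<eta> / M) \<le> \<bar>lam s - lam t - of_int q / M\<bar>" if "s < S" "t < S" "q \<noteq> (0::int)" for s t q
    using main[OF that] \<eta>M u1 w1 w(2) by linarith
  show "Dt / Mp \<le> \<bar>lam s - lam t - of_int q / M\<bar>" if "s < S" "t < S" "q \<noteq> (0::int)" for s t q
  proof -
    have "Dt / Mp = 2 * (Dt / (2 * Mp))" by simp
    thus ?thesis using main[OF that] u0 w(1) by linarith
  qed
  show "4/5 * (\<eta> / M) < \<bar>x - lam s - of_int q / M\<bar>" if x: "x \<in> Ep" "s < S" "q \<noteq> (0::int)" for x s q
  proof (rule ccontr)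
    assume n: "\<not> 4/5 * (\<eta> / M) < \<bar>x - lam s - of_int q / M\<bar>"
    have "\<eta> / (2 * Mp) > 0" using \<eta> Mp by simp
    hence b: "\<bar>x - lam s - of_int q / M\<bar> \<le> u + 2 * w" using n \<eta>M u1 w1 w(2) by linarith
    define d where "d = x - of_int q / M - lam s"
    \<comment> \<open>Clamping d to [-(u + w), u + w] keeps \<open>c\<close> within u + w of
      \<open>lam s\<close>; since |d| \<le> u + 2w, the part cut off is at most w, so the translate
      of \<open>c\<close> stays within w of \<open>x\<close>.\<close>
    define c where "c = lam s + max (- (u + w)) (min (u + w) d)"
    have d: "\<bar>d\<bar> \<le> u + 2 * w" using b unfolding d_def by linarith
    have 1: "\<bar>c - lam s\<bar> \<le> u + w" unfolding c_def using u0 w0 by linarith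
    have "c + of_int q / M - x = max (- (u + w)) (min (u + w) d) - d" by (simp add: c_def d_def)
    hence "\<bar>c + of_int q / M - x\<bar> \<le> w" using d u0 w0 by linarith
    thus False using disj[OF x(3), of c] memL[OF x(2) 1] mem[OF x(1)] by blast
  qed
qed

text \<open>From a to a + 1 the block loses 1/a and gains two terms of at most 1/(2a) each, so it is
  largest at a = 1.\<close>

lemma harmonic_block_le: "a \<ge> 1 \<Longrightarrow> (\<Sum>q=a..2*a. 1 / real q) \<le> 3/2"
proof (induction a rule: dec_induct)
  case base
  have "{1..2::nat} = {1, 2}" by auto
  thus ?case by simp
next
  case (step a)
  have "(\<Sum>q=Suc a..2 * Suc a. 1 / real q) = (\<Sum>q=a..2*a. 1 / real q) - 1 / real a + 1 / real (2*a+1) + 1 / real (2*a+2)"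
    using step.hyps by (simp add: sum.atLeast_Suc_atMost[of a "2 * a"])
  moreover have "1 / real (2*a+1) \<le> 1 / real (2 * a)" "1 / real (2*a+2) \<le> 1 / real (2 * a)"
    using step.hyps by (auto intro!: divide_left_mono)
  moreover have "1 / real a = 1 / real (2 * a) + 1 / real (2 * a)" using step.hyps by (simp add: field_simps)
  ultimately show ?case using step.IH by linarith
qed

lemma interval_cover:
  fixes a b :: "'i \<Rightarrow> real"
  assumes I: "finite I" "\<And>i. i \<in> I \<Longrightarrow> a i \<le> b i" and cov: "{x..y} \<subseteq> (\<Union>i\<in>I. {a i..b i})" and "x \<le> y"
  shows "y - x \<le> (\<Sum>i\<in>I. b i - a i)"
proof -
  have "ennreal (y - x) = emeasure lborel {x..y}" using assms(4) by simp
  also have "\<dots> \<le> emeasure lborel (\<Union>i\<in>I. {a i..b i})" using cov I(1) by (intro emeasure_mono) auto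
  also have "\<dots> \<le> (\<Sum>i\<in>I. emeasure lborel {a i..b i})" using I(1) by (intro emeasure_subadditive_finite) auto
  also have "\<dots> = (\<Sum>i\<in>I. ennreal (b i - a i))" using I(2) by (intro sum.cong) auto
  also have "\<dots> = ennreal (\<Sum>i\<in>I. b i - a i)" using I(2) by (intro sum_ennreal) auto
  finally show ?thesis using I(2) by (subst (asm) ennreal_le_iff) (auto intro!: sum_nonneg)
qed

text \<open>
  For one pair of points the bad \<open>p\<close> lie in intervals of length \<open>2r/q\<close> with \<open>a \<le> q \<le> 2a\<close> for some \<open>a\<close>,
  hence have measure at most \<open>3r\<close>.
\<close>

lemma avoiding_step_exists:
  fixes X :: "nat \<Rightarrow> real"
  assumes S: "S \<ge> 1" and r: "0 < r" "r * (8 * real S * (2 * real S - 1)) < 13/5"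
  obtains p where "1/4 \<le> p" "p \<le> 1/2" "\<And>s t q. s < S \<Longrightarrow> t < S \<Longrightarrow> q \<noteq> (0::int) \<Longrightarrow> r < \<bar>X s - X t + of_int q * p\<bar>"
proof (cases "S = 1")
  case True
  have "r < \<bar>X s - X t + of_int q * (1/2)\<bar>" if "s < S" "t < S" "q \<noteq> (0::int)" for s t q
  proof -
    have "\<bar>real_of_int q\<bar> \<ge> 1" using that(3) by linarith
    thus ?thesis using that True r(2) by simp
  qed
  thus ?thesis using that[of "1/2"] by simp
next
  case False
  hence S2: "S \<ge> 2" using S by simp
  \<comment> \<open>This needs S \<ge> 2, which is why a single point is treated separately. It
    confines the dangerous q to one block {a..2a} and makes the coincidences with D = 0
    harmless.\<close>
  have r8: "r < 1/8"
  proof -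
    have "8 * 2 * (3::real) \<le> 8 * real S * (2 * real S - 1)" using S2 by (intro mult_mono) auto
    hence "r * 48 \<le> r * (8 * real S * (2 * real S - 1))" using r(1) by (intro mult_left_mono) auto
    thus ?thesis using r(2) by linarith
  qed
  define D where "D = (\<lambda>s t. \<bar>X s - X t\<bar>)"
  \<comment> \<open>If |D - qp| \<le> r with p in [1/4, 1/2], then 2D - 2r \<le> q \<le> 4D + 4r,
    and the upper end is at most 2a + 8r < 2a + 1.\<close>
  define a where "a = (\<lambda>s t. max 1 (nat \<lceil>2 * D s t - 2 * r\<rceil>))"
  define I where "I = Sigma {..<S} (\<lambda>t. Sigma {..<t} (\<lambda>s. {a s t..2 * a s t}))"
  define lo where "lo = (\<lambda>(t,s,q). (D s t - r) / real q)"
  define hi where "hi = (\<lambda>(t,s,q). (D s t + r) / real q)"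
  have fin: "finite I" by (auto simp: I_def)
  have I1: "q \<ge> 1" if "(t,s,q) \<in> I" for t s q using that by (auto simp: I_def a_def)
  have len: "hi i - lo i = 2 * r * (1 / real (snd (snd i)))" for i
    by (cases i) (simp add: hi_def lo_def diff_divide_distrib[symmetric])
  have "(\<Sum>i\<in>I. hi i - lo i) = (\<Sum>t<S. \<Sum>s<t. \<Sum>q=a s t..2 * a s t. 2 * r * (1 / real q))"
  proof -
    have "(\<Sum>t<S. \<Sum>s<t. \<Sum>q=a s t..2 * a s t. 2 * r * (1 / real q))
      = (\<Sum>t<S. \<Sum>(s,q)\<in>Sigma {..<t} (\<lambda>s. {a s t..2 * a s t}). 2 * r * (1 / real q))"
      by (intro sum.cong refl sum.Sigma) auto
    also have "\<dots> = (\<Sum>(t,x)\<in>I. case x of (s,q) \<Rightarrow> 2 * r * (1 / real q))"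
      unfolding I_def by (intro sum.Sigma) auto
    finally show ?thesis unfolding len by (simp add: case_prod_beta)
  qed
  also have "\<dots> \<le> (\<Sum>t<S. \<Sum>s<t. 3 * r)"
  proof (intro sum_mono)
    fix t s
    have "(\<Sum>q=a s t..2 * a s t. 1 / real q) \<le> 3/2" by (rule harmonic_block_le) (simp add: a_def)
    hence "2 * r * (\<Sum>q=a s t..2 * a s t. 1 / real q) \<le> 2 * r * (3/2)" using r(1) by (intro mult_left_mono) auto
    thus "(\<Sum>q=a s t..2 * a s t. 2 * r * (1 / real q)) \<le> 3 * r" unfolding sum_distrib_left by simp
  qed
  also have "\<dots> = 3 * r * (\<Sum>t<S. real t)" unfolding sum_distrib_left by (intro sum.cong) auto
  also have "(\<Sum>t<S. real t) = real S * (real S - 1) / 2"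
    by (induction S) (auto simp: field_simps)
  \<comment> \<open>At most 3/32 of 13/5, that is 39/160: the number of unordered pairs is compared
    with the S(2S - 1) in the assumption on r.\<close>
  also have "3 * r * (real S * (real S - 1) / 2) < 1/4"
  proof -
    have "3 * r * (real S * (real S - 1) / 2) * 32 \<le> 3 * (r * (8 * real S * (2 * real S - 1)))"
    proof -
      have "3 * r * (real S * (real S - 1) / 2) * 32 = 48 * (r * real S * real S) - 48 * (r * real S)"
        "3 * (r * (8 * real S * (2 * real S - 1))) = 48 * (r * real S * real S) - 24 * (r * real S)"
        by (simp_all add: field_simps)
      moreover have "r * real S \<ge> 0" using r(1) by simp
      ultimately show ?thesis by linarith
    qed
    thus ?thesis using r(2) by linarith
  qed
  finally have small: "(\<Sum>i\<in>I. hi i - lo i) < 1/2 - 1/4" by simp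
  have "\<not> {1/4..1/2} \<subseteq> (\<Union>i\<in>I. {lo i..hi i})"
  proof
    assume cov: "{1/4..1/2} \<subseteq> (\<Union>i\<in>I. {lo i..hi i})"
    have "lo i \<le> hi i" for i using r(1) by (cases i) (auto simp: lo_def hi_def intro!: divide_right_mono)
    hence "1/2 - 1/4 \<le> (\<Sum>i\<in>I. hi i - lo i)" by (intro interval_cover[OF fin _ cov]) auto
    thus False using small by linarith
  qed
  then obtain p where p: "1/4 \<le> p" "p \<le> 1/2" "\<And>i. i \<in> I \<Longrightarrow> p \<notin> {lo i..hi i}" by fastforce
  have key: "r < \<bar>D s t - real q * p\<bar>" if st: "s < t" "t < S" and q: "q \<ge> 1" for s t q
  proof (rule ccontr)
    assume n: "\<not> r < \<bar>D s t - real q * p\<bar>"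
    have qp: "real q / 4 \<le> real q * p" "real q * p \<le> real q / 2" 
      using mult_left_mono[OF p(1), of "real q"] mult_left_mono[OF p(2), of "real q"] by simp_all
    have "2 * D s t - 2 * r \<le> real q" using n qp by linarith
    hence 1: "a s t \<le> q" using q by (auto simp: a_def nat_le_iff ceiling_le_iff)
    have "2 * D s t \<le> real (a s t) + 2 * r" using of_nat_ceiling[of "2 * D s t - 2 * r"] unfolding a_def by linarith
    hence "real q < 2 * real (a s t) + 1" using n qp r8 by linarith
    hence 2: "q \<le> 2 * a s t" by linarith
    have "(t, s, q) \<in> I" using st 1 2 by (auto simp: I_def)
    from p(3)[OF this] have "\<not> ((D s t - r) / real q \<le> p \<and> p \<le> (D s t + r) / real q)" by (simp add: lo_def hi_def)
    thus False using n q by (auto simp: field_simps abs_le_iff)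
  qed
  have "r < \<bar>X s - X t + of_int q * p\<bar>" if st: "s < S" "t < S" and q: "q \<noteq> (0::int)" for s t q
  proof -
    define k where "k = nat \<bar>q\<bar>"
    have k: "k \<ge> 1" "\<bar>real_of_int q\<bar> = real k" using q by (auto simp: k_def)
    have kp: "real k * p \<ge> 1/4" using k(1) p(1) mult_mono[of 1 "real k" "1/4" p] by simp
    \<comment> \<open>Up to the signs of q and of \<open>X s - X t\<close> only two cases remain;
      the one with a plus sign cannot be small, because k p \<ge> 1/4.\<close>
    have ab: "\<bar>X s - X t + of_int q * p\<bar> = \<bar>D s t - real k * p\<bar> \<or> \<bar>X s - X t + of_int q * p\<bar> = D s t + real k * p"
    proof -
      have gen: "\<bar>d + y\<bar> = \<bar>\<bar>d\<bar> - y\<bar> \<or> \<bar>d + y\<bar> = \<bar>d\<bar> + y" if "y \<ge> 0" for d y :: real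
        using that by (cases "d \<ge> 0") (auto simp: abs_if)
      have "\<bar>X t - X s\<bar> = D s t" "\<bar>X s - X t\<bar> = D s t" by (auto simp: D_def)
      moreover have "\<bar>X s - X t - real k * p\<bar> = \<bar>X t - X s + real k * p\<bar>" by linarith
      moreover have "real_of_int q = real k \<or> real_of_int q = - real k" using k(2) by linarith
      ultimately show ?thesis using gen[of "real k * p" "X s - X t"] gen[of "real k * p" "X t - X s"] kp by auto
    qed
    have "r < \<bar>D s t - real k * p\<bar>"
    proof (cases s t rule: linorder_cases)
      case less thus ?thesis using key[OF less st(2) k(1)] by simp
    next
      case equal thus ?thesis using kp r8 by (simp add: D_def)
    next
      case greater
      have "D s t = D t s" by (simp add: D_def abs_minus_commute)
      thus ?thesis using key[OF greater st(1) k(1)] by simp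
    qed
    moreover have "r < D s t + real k * p" using kp r8 by (simp add: D_def)
    ultimately show ?thesis using ab by auto
  qed
  thus ?thesis using that[OF p(1,2)] by blast
qed

text \<open>Take m = 1/p. \<open>G\<close> lies within r/(2 Mp) of the points \<open>lam s\<close>,
  so a collision of \<open>G\<close> with a translate puts a difference of the scaled points within
  r of a multiple of p. With k the common bound on \<eta> and \<open>Dt\<close>, r = 8/5 \<eta> + 2w
  stays below 13/5 k since w < k/2.\<close>

lemma m_rule_exists:
  assumes S: "S \<ge> 1" and Mp: "Mp > 0" and \<eta>: "0 < \<eta>" "\<eta> < 1 / (8 * real S * (2 * real S - 1))"
    and Dt: "Dt < 1 / (8 * real S * (2 * real S - 1))"
    and Ep: "Ep \<subseteq> ballR (lam ` {..<S}) (4/5 * (\<eta> / Mp))"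
  shows "\<exists>m. m_rule_ok Dt \<eta> Mp Ep m"
proof -
  define w where "w = max (Dt / 2) (\<eta> / 4)"
  define r where "r = 2 * (4/5 * \<eta> + w)"
  define c where "c = 8 * real S * (2 * real S - 1)"
  have c: "c > 0" using S by (simp add: c_def)
  define k where "k = 1 / c"
  have \<eta>c: "\<eta> < k" "Dt < k" using \<eta>(2) Dt by (simp_all add: c_def k_def)
  have w: "w \<ge> \<eta> / 4" "w < k / 2"
  proof -
    have "Dt / 2 < k / 2" "\<eta> / 4 < k / 2" using \<eta>c \<eta>(1) by linarith+
    thus "w < k / 2" unfolding w_def by simp
  qed (simp add: w_def)
  have r0: "0 < r" using w(1) \<eta>(1) by (simp add: r_def)
  have "r < 13/5 * k" unfolding r_def distrib_left using w(2) \<eta>c(1) by linarith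
  hence "r * c < 13/5" using c by (simp add: k_def field_simps)
  then obtain p where p: "1/4 \<le> p" "p \<le> 1/2"
    "\<And>s t q. s < S \<Longrightarrow> t < S \<Longrightarrow> q \<noteq> (0::int) \<Longrightarrow> r < \<bar>Mp * lam s - Mp * lam t + of_int q * p\<bar>"
    using avoiding_step_exists[OF S r0, of "\<lambda>s. Mp * lam s"] unfolding c_def by blast
  have "m_rule_ok Dt \<eta> Mp Ep (1 / p)"
    unfolding m_rule_ok_def Let_def w_def[symmetric]
  proof (intro conjI allI impI)
    show "2 \<le> 1 / p" "1 / p \<le> 4" using p(1,2) by (auto simp: field_simps)
    fix q :: int assume q: "q \<noteq> 0"
    have near: "\<exists>s<S. \<bar>g - lam s\<bar> \<le> r / 2 / Mp" if gE: "g \<in> ballR Ep (w / Mp)" for g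
    proof -
      obtain x where x: "x \<in> Ep" "\<bar>g - x\<bar> \<le> w / Mp" using gE by (auto simp: ballR_def abs_le_iff)
      obtain s where s: "s < S" "\<bar>x - lam s\<bar> \<le> 4/5 * (\<eta> / Mp)" using Ep x(1) by (force simp: ballR_def abs_le_iff)
      have "r / 2 / Mp = 4/5 * (\<eta> / Mp) + w / Mp" by (simp add: r_def add_divide_distrib)
      thus ?thesis using s x by (intro exI[of _ s]) linarith
    qed
    show "(\<lambda>x. x + of_int q / (Mp * (1 / p))) ` ballR Ep (w / Mp) \<inter> ballR Ep (w / Mp) = {}"
    proof (rule ccontr)
      assume "\<not> ?thesis"
      then obtain g where g: "g \<in> ballR Ep (w / Mp)" "g + of_int q / (Mp * (1 / p)) \<in> ballR Ep (w / Mp)" by blast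
      obtain s t where st: "s < S" "t < S" "\<bar>g - lam s\<bar> \<le> r / 2 / Mp" "\<bar>g + of_int q / (Mp * (1 / p)) - lam t\<bar> \<le> r / 2 / Mp"
        using near[OF g(1)] near[OF g(2)] by blast
      have "\<bar>lam s - lam t + of_int q / (Mp * (1 / p))\<bar> \<le> r / Mp" using st(3,4) by (simp add: field_simps)
      hence "Mp * \<bar>lam s - lam t + of_int q / (Mp * (1 / p))\<bar> \<le> r" using Mp by (simp add: field_simps)
      moreover have "Mp * \<bar>lam s - lam t + of_int q / (Mp * (1 / p))\<bar> = \<bar>Mp * (lam s - lam t + of_int q / (Mp * (1 / p)))\<bar>"
        using Mp by (simp add: abs_mult)
      moreover have "Mp * (lam s - lam t + of_int q / (Mp * (1 / p))) = Mp * lam s - Mp * lam t + of_int q * p"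
        using Mp p(1) by (simp add: field_simps)
      ultimately show False using p(3)[OF st(1,2) q] by simp
    qed
  qed
  thus ?thesis by blast
qed

section \<open>The Hadamard-test signal\<close>

lemma pow_mat_eigenvector:
  fixes A :: "complex mat"
  assumes A: "A \<in> carrier_mat n n" and v: "v \<in> carrier_vec n" and e: "A *\<^sub>v v = \<mu> \<cdot>\<^sub>v v"
  shows "(A ^\<^sub>m k) *\<^sub>v v = \<mu> ^ k \<cdot>\<^sub>v v"
proof (induction k)
  case 0 thus ?case using A v by simp
next
  case (Suc k)
  have Ak: "A ^\<^sub>m k \<in> carrier_mat n n" using A by simp
  have "(A ^\<^sub>m Suc k) *\<^sub>v v = (A ^\<^sub>m k) *\<^sub>v (\<mu> \<cdot>\<^sub>v v)" using assoc_mult_mat_vec[OF Ak A v] e by simp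
  also have "\<dots> = \<mu> \<cdot>\<^sub>v (\<mu> ^ k \<cdot>\<^sub>v v)" using mult_mat_vec[OF Ak v] Suc by simp
  finally show ?case by (simp add: smult_smult_assoc)
qed

lemma orthonormal_parseval:
  assumes o: "orthonormal n n q" and v: "v \<in> carrier_vec n" and w: "w \<in> carrier_vec n"
  shows "(\<Sum>l<n. (v \<bullet>c q l) * cnj (w \<bullet>c q l)) = v \<bullet>c w"
proof -
  let ?Q = "col_mat n n q"
  have Q': "mat_adjoint ?Q \<in> carrier_mat n n" by simp
  have qc: "q l \<in> carrier_vec n" if "l < n" for l using o that by (simp add: orthonormal_def)
  have Qw: "mat_adjoint ?Q *\<^sub>v w \<in> carrier_vec n" by (rule mult_mat_vec_carrier[OF Q' w])
  have "(mat_adjoint ?Q *\<^sub>v v) \<bullet>c (mat_adjoint ?Q *\<^sub>v w) = v \<bullet>c (?Q *\<^sub>v (mat_adjoint ?Q *\<^sub>v w))"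
    using mult_mat_vec_cdot[OF Q' v Qw] by simp
  also have "?Q *\<^sub>v (mat_adjoint ?Q *\<^sub>v w) = w"
    using assoc_mult_mat_vec[OF col_mat_carrier Q' w, symmetric]
      unitary_right[OF col_mat_carrier orthonormal_isometry[OF o]] w by simp
  finally have "v \<bullet>c w = (mat_adjoint ?Q *\<^sub>v v) \<bullet>c (mat_adjoint ?Q *\<^sub>v w)" by simp
  thus ?thesis using col_mat_adjoint_mult_vec[OF _ v qc] col_mat_adjoint_mult_vec[OF _ w qc]
    by (simp add: cdot_sum[OF Qw] del: index_mult_mat_vec)
qed

text \<open>\<open>mat_exp\<close> is an entrywise series. Expanding the powers of \<open>A\<close>
  in the eigenbasis turns every entry into a finite combination of scalar exponential
  series.\<close>

lemma mat_exp_eigenbasis: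
  assumes A: "A \<in> carrier_mat n n" and o: "orthonormal n n q"
    and e: "\<And>l. l < n \<Longrightarrow> A *\<^sub>v q l = \<mu> l \<cdot>\<^sub>v q l" and v: "v \<in> carrier_vec n" and w: "w \<in> carrier_vec n"
  shows "(mat_exp A *\<^sub>v v) \<bullet>c w = (\<Sum>l<n. exp (\<mu> l) * (v \<bullet>c q l) * cnj (w \<bullet>c q l))"
proof -
  let ?Q = "col_mat n n q"
  have Q: "?Q \<in> carrier_mat n n" and Q': "mat_adjoint ?Q \<in> carrier_mat n n" by simp_all
  have qc: "q l \<in> carrier_vec n" if "l < n" for l using o that by (simp add: orthonormal_def)
  have pow: "(A ^\<^sub>m k) $$ (i,j) = (\<Sum>l<n. \<mu> l ^ k * (q l $ i * cnj (q l $ j)))" if ij: "i < n" "j < n" for i j k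
  proof -
    have Ak: "A ^\<^sub>m k \<in> carrier_mat n n" using A by simp
    have "A ^\<^sub>m k = (A ^\<^sub>m k * ?Q) * mat_adjoint ?Q"
      using assoc_mult_mat[OF Ak Q Q'] unitary_right[OF Q orthonormal_isometry[OF o]] right_mult_one_mat[OF Ak] by simp
    also have "A ^\<^sub>m k * ?Q = col_mat n n (\<lambda>l. (A ^\<^sub>m k) *\<^sub>v q l)" by (rule mult_col_mat[OF Ak qc])
    finally have "(A ^\<^sub>m k) $$ (i,j) = (col_mat n n (\<lambda>l. (A ^\<^sub>m k) *\<^sub>v q l) * mat_adjoint ?Q) $$ (i,j)"
      by (rule arg_cong)
    also have "\<dots> = (\<Sum>l<n. col_mat n n (\<lambda>l. (A ^\<^sub>m k) *\<^sub>v q l) $$ (i,l) * mat_adjoint ?Q $$ (l,j))"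
      by (rule mat_mult_index_sum[OF col_mat_carrier Q' ij])
    also have "\<dots> = (\<Sum>l<n. \<mu> l ^ k * (q l $ i * cnj (q l $ j)))"
      using ij qc pow_mat_eigenvector[OF A qc e]
      by (intro sum.cong refl) (simp add: col_mat_def mult.assoc carrier_vecD[OF qc] del: index_mult_mat_vec)
    finally show ?thesis .
  qed
  have E: "mat_exp A \<in> carrier_mat n n" using A by (simp add: mat_exp_def)
  have ent: "mat_exp A $$ (i,j) = (\<Sum>l<n. exp (\<mu> l) * (q l $ i * cnj (q l $ j)))" if ij: "i < n" "j < n" for i j
  proof -
    have "(\<lambda>k. \<Sum>l<n. (\<mu> l ^ k /\<^sub>R fact k) * (q l $ i * cnj (q l $ j))) sums (\<Sum>l<n. exp (\<mu> l) * (q l $ i * cnj (q l $ j)))"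
      by (intro sums_sum sums_mult2 exp_converges)
    moreover have "(\<Sum>l<n. (\<mu> l ^ k /\<^sub>R fact k) * (q l $ i * cnj (q l $ j))) = (A ^\<^sub>m k) $$ (i,j) / of_nat (fact k)" for k
      unfolding pow[OF ij] sum_divide_distrib by (intro sum.cong refl) (simp add: scaleR_conv_of_real field_simps)
    ultimately have "(\<lambda>k. (A ^\<^sub>m k) $$ (i,j) / of_nat (fact k)) sums (\<Sum>l<n. exp (\<mu> l) * (q l $ i * cnj (q l $ j)))" by simp
    thus ?thesis using A ij by (simp add: mat_exp_def sums_iff)
  qed
  have "(mat_exp A *\<^sub>v v) \<bullet>c w = (\<Sum>i<n. \<Sum>j<n. \<Sum>l<n. exp (\<mu> l) * (q l $ i * cnj (q l $ j)) * v $ j * cnj (w $ i))"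
    unfolding cdot_sum[OF w] using mult_mat_vec_index_sum[OF E v] ent
    by (simp add: sum_distrib_right del: index_mult_mat_vec)
  also have "\<dots> = (\<Sum>i<n. \<Sum>l<n. \<Sum>j<n. exp (\<mu> l) * (q l $ i * cnj (q l $ j)) * v $ j * cnj (w $ i))"
    by (intro sum.cong refl sum.swap)
  also have "\<dots> = (\<Sum>l<n. \<Sum>i<n. \<Sum>j<n. exp (\<mu> l) * (q l $ i * cnj (q l $ j)) * v $ j * cnj (w $ i))"
    by (rule sum.swap)
  also have "\<dots> = (\<Sum>l<n. exp (\<mu> l) * (v \<bullet>c q l) * cnj (w \<bullet>c q l))"
  proof (intro sum.cong refl)
    fix l assume "l \<in> {..<n}"
    hence l: "q l \<in> carrier_vec n" using qc by simp
    have "cnj (w \<bullet>c q l) * (v \<bullet>c q l) = (\<Sum>i<n. cnj (w $ i) * q l $ i) * (\<Sum>j<n. v $ j * cnj (q l $ j))"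
      by (simp add: cdot_sum[OF l])
    thus "(\<Sum>i<n. \<Sum>j<n. exp (\<mu> l) * (q l $ i * cnj (q l $ j)) * v $ j * cnj (w $ i))
       = exp (\<mu> l) * (v \<bullet>c q l) * cnj (w \<bullet>c q l)"
      by (simp add: sum_product sum_distrib_left mult_ac)
  qed
  finally show ?thesis .
qed

text \<open>The form \<open>B\<close> is the evolution written in an eigenbasis \<open>q\<close> of
  \<open>H\<close>. The vectors \<open>psis s\<close> need not occur in \<open>q\<close>, but a
  nonzero overlap with \<open>q l\<close> forces \<open>d l = lam s\<close>, so each acts as an
  eigenvector of \<open>B\<close> on either side. Orthogonality then removes all cross terms, and
  only the residual contribution, of modulus at most |cres|^2, survives. The bound by 1 makes the
  test probabilities legitimate.\<close>

theorem signal_bounds: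
  assumes model: "real_power_model n H S lam psis c cres psires psi \<beta> \<omega>"
  shows "cmod (signal H psi t) \<le> 1"
    and "cmod (signal H psi t - (\<Sum>s<S. complex_of_real ((cmod (c s))\<^sup>2) * cis (- (2 * pi * lam s * t)))) \<le> \<omega>"
proof -
  note m = model[unfolded real_power_model_def]
  have H: "H \<in> carrier_mat n n" "mat_adjoint H = H" using m by auto
  have ps: "psis s \<in> carrier_vec n" "H *\<^sub>v psis s = complex_of_real (lam s) \<cdot>\<^sub>v psis s" if "s < S" for s
    using m that by auto
  have on: "psis s \<bullet>c psis s' = (if s = s' then 1 else 0)" if "s < S" "s' < S" for s s' using m that by auto
  have pr: "psires \<in> carrier_vec n" "psires \<bullet>c psires = 1" "\<And>s. s < S \<Longrightarrow> psires \<bullet>c psis s = 0" using m by auto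
  have psi: "psi = Matrix.vec n (\<lambda>i. (\<Sum>s<S. c s * psis s $ i) + cres * psires $ i)" "psi \<bullet>c psi = 1" using m by auto
  have psic: "psi \<in> carrier_vec n" by (simp add: psi(1))
  have \<omega>: "(cmod cres)\<^sup>2 \<le> \<omega>" using m by auto
  obtain q d where q: "orthonormal n n q" "\<And>i. i < n \<Longrightarrow> H *\<^sub>v q i = complex_of_real (d i) \<cdot>\<^sub>v q i"
    using hermitian_spectral[OF H] by blast
  have qc: "q l \<in> carrier_vec n" if "l < n" for l using q that by (simp add: orthonormal_def)
  define e where "e = (\<lambda>x::real. cis (- (2 * pi * x * t)))"
  define B where "B = (\<lambda>v w. \<Sum>l<n. e (d l) * (v \<bullet>c q l) * cnj (w \<bullet>c q l))"
  let ?a = "- (2 * of_real pi * \<i> * of_real t) :: complex"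
  have sig: "signal H psi t = B psi psi"
  proof -
    have "(?a \<cdot>\<^sub>m H) *\<^sub>v q l = (?a * complex_of_real (d l)) \<cdot>\<^sub>v q l" if l: "l < n" for l
    proof (rule eq_vecI)
      fix i assume "i < dim_vec ((?a * complex_of_real (d l)) \<cdot>\<^sub>v q l)"
      hence i: "i < n" using qc[OF l] by simp
      have "((?a \<cdot>\<^sub>m H) *\<^sub>v q l) $ i = ?a * (H *\<^sub>v q l) $ i"
        using mult_mat_vec_index_sum[of "?a \<cdot>\<^sub>m H" n n "q l" i] mult_mat_vec_index_sum[OF H(1) qc[OF l] i] H(1) qc[OF l] i
        by (simp add: sum_distrib_left mult.assoc del: index_mult_mat_vec)
      thus "((?a \<cdot>\<^sub>m H) *\<^sub>v q l) $ i = ((?a * complex_of_real (d l)) \<cdot>\<^sub>v q l) $ i"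
        using q(2)[OF l] qc[OF l] i by (simp del: index_mult_mat_vec)
    qed (use H qc[OF l] in auto)
    moreover have "exp (?a * complex_of_real x) = e x" for x
      by (simp add: e_def cis_conv_exp mult_ac)
    ultimately show ?thesis
      unfolding signal_def U_pow_def B_def
      using mat_exp_eigenbasis[of "?a \<cdot>\<^sub>m H" n q "\<lambda>l. ?a * complex_of_real (d l)" psi psi] H(1) q(1) psic by simp
  qed
  have Bvv: "cmod (B v v) \<le> 1" if v: "v \<in> carrier_vec n" "v \<bullet>c v = 1" for v
  proof -
    have "cmod (B v v) \<le> (\<Sum>l<n. cmod (v \<bullet>c q l) * cmod (v \<bullet>c q l))"
      unfolding B_def by (rule order.trans[OF norm_sum]) (simp add: e_def norm_mult)
    also have "complex_of_real \<dots> = (\<Sum>l<n. (v \<bullet>c q l) * cnj (v \<bullet>c q l))"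
      by (simp add: complex_norm_square[symmetric] power2_eq_square)
    hence "(\<Sum>l<n. cmod (v \<bullet>c q l) * cmod (v \<bullet>c q l)) = 1"
      using orthonormal_parseval[OF q(1) v(1) v(1)] v(2) by (metis of_real_eq_1_iff)
    finally show ?thesis .
  qed
  show "cmod (signal H psi t) \<le> 1" unfolding sig by (rule Bvv[OF psic psi(2)])
  have ev: "d l = lam s" if s: "s < S" and l: "l < n" and nz: "psis s \<bullet>c q l \<noteq> 0" for s l
  proof -
    have "complex_of_real (lam s) * (psis s \<bullet>c q l) = complex_of_real (d l) * (psis s \<bullet>c q l)"
      using mult_mat_vec_cdot[OF H(1) ps(1)[OF s] qc[OF l]] ps[OF s] q(2)[OF l] H(2) qc[OF l]
      by (simp add: smult_cdot[of _ n] cdot_smult[of _ n])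
    thus ?thesis using nz by simp
  qed
  have BL: "B (psis s) w = e (lam s) * (psis s \<bullet>c w)" if s: "s < S" and w: "w \<in> carrier_vec n" for s w
    unfolding B_def orthonormal_parseval[OF q(1) ps(1)[OF s] w, symmetric] sum_distrib_left
    using ev[OF s] by (intro sum.cong refl) (metis lessThan_iff mult.assoc mult_zero_left mult_zero_right)
  have BR: "B w (psis s) = e (lam s) * (w \<bullet>c psis s)" if s: "s < S" and w: "w \<in> carrier_vec n" for s w
    unfolding B_def orthonormal_parseval[OF q(1) w ps(1)[OF s], symmetric] sum_distrib_left
    using ev[OF s] by (intro sum.cong refl) (metis complex_cnj_zero lessThan_iff mult.assoc mult_zero_right)
  have lin: "psi \<bullet>c u = (\<Sum>s<S. c s * (psis s \<bullet>c u)) + cres * (psires \<bullet>c u)" if u: "u \<in> carrier_vec n" for u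
  proof -
    have "psi \<bullet>c u = (\<Sum>i<n. \<Sum>s<S. c s * psis s $ i * cnj (u $ i)) + (\<Sum>i<n. cres * psires $ i * cnj (u $ i))"
      unfolding cdot_sum[OF u] by (simp add: psi(1) distrib_right sum_distrib_right sum.distrib)
    also have "(\<Sum>i<n. \<Sum>s<S. c s * psis s $ i * cnj (u $ i)) = (\<Sum>s<S. \<Sum>i<n. c s * psis s $ i * cnj (u $ i))" by (rule sum.swap)
    finally show ?thesis by (simp add: cdot_sum[OF u] sum_distrib_left mult.assoc)
  qed
  have Blin: "B psi w = (\<Sum>s<S. c s * B (psis s) w) + cres * B psires w" for w
  proof -
    have "B psi w = (\<Sum>l<n. \<Sum>s<S. c s * (e (d l) * (psis s \<bullet>c q l) * cnj (w \<bullet>c q l)))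
        + (\<Sum>l<n. cres * (e (d l) * (psires \<bullet>c q l) * cnj (w \<bullet>c q l)))"
      unfolding B_def sum.distrib[symmetric]
      by (intro sum.cong refl) (simp add: lin qc algebra_simps sum_distrib_left sum_distrib_right)
    also have "(\<Sum>l<n. \<Sum>s<S. c s * (e (d l) * (psis s \<bullet>c q l) * cnj (w \<bullet>c q l)))
       = (\<Sum>s<S. \<Sum>l<n. c s * (e (d l) * (psis s \<bullet>c q l) * cnj (w \<bullet>c q l)))" by (rule sum.swap)
    finally show ?thesis by (simp add: B_def sum_distrib_left)
  qed
  have Blin2: "B v psi = (\<Sum>s<S. cnj (c s) * B v (psis s)) + cnj cres * B v psires" for v
  proof -
    have "B v psi = (\<Sum>l<n. \<Sum>s<S. cnj (c s) * (e (d l) * (v \<bullet>c q l) * cnj (psis s \<bullet>c q l)))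
        + (\<Sum>l<n. cnj cres * (e (d l) * (v \<bullet>c q l) * cnj (psires \<bullet>c q l)))"
      unfolding B_def sum.distrib[symmetric]
      by (intro sum.cong refl) (simp add: lin qc algebra_simps sum_distrib_left sum_distrib_right)
    also have "(\<Sum>l<n. \<Sum>s<S. cnj (c s) * (e (d l) * (v \<bullet>c q l) * cnj (psis s \<bullet>c q l)))
       = (\<Sum>s<S. \<Sum>l<n. cnj (c s) * (e (d l) * (v \<bullet>c q l) * cnj (psis s \<bullet>c q l)))" by (rule sum.swap)
    finally show ?thesis by (simp add: B_def sum_distrib_left)
  qed
  have c1: "c s * B (psis s) psi = complex_of_real ((cmod (c s))\<^sup>2) * e (lam s)" if s: "s < S" for s
  proof -
    have "(\<Sum>u<S. c u * (psis u \<bullet>c psis s)) = (\<Sum>u<S. if u = s then c s else 0)"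
      by (intro sum.cong refl) (use on[OF _ s] in simp)
    hence "psi \<bullet>c psis s = c s" using lin[OF ps(1)[OF s]] s pr(3)[OF s] by simp
    hence "psis s \<bullet>c psi = cnj (c s)" using cdot_commute[OF ps(1)[OF s] psic] by simp
    thus ?thesis using BL[OF s psic] complex_norm_square[of "c s"] by (simp add: mult_ac)
  qed
  have "B psires psi = cnj cres * B psires psires" using Blin2[of psires] BR pr by simp
  hence "B psi psi = (\<Sum>s<S. complex_of_real ((cmod (c s))\<^sup>2) * e (lam s)) + cres * cnj cres * B psires psires"
    unfolding Blin[of psi] using c1 by simp
  hence "cmod (signal H psi t - (\<Sum>s<S. complex_of_real ((cmod (c s))\<^sup>2) * e (lam s))) = (cmod cres)\<^sup>2 * cmod (B psires psires)"
    unfolding sig by (simp add: norm_mult power2_eq_square)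
  also have "\<dots> \<le> (cmod cres)\<^sup>2 * 1" using Bvv[OF pr(1,2)] by (intro mult_left_mono) auto
  finally show "cmod (signal H psi t - (\<Sum>s<S. complex_of_real ((cmod (c s))\<^sup>2) * cis (- (2 * pi * lam s * t)))) \<le> \<omega>"
    using \<omega> by (simp add: e_def)
qed

section \<open>Concentration of the Hadamard-test estimates\<close>

text \<open>Makes Hoeffding's inequality for the binomial distribution applicable.\<close>

lemma sum_pm1_binomial:
  assumes "a \<in> {-1..1}"
  shows "sum_pm1 m a = map_pmf (\<lambda>k. 2 * real k - real m) (binomial_pmf m ((1 + a) / 2))"
proof -
  have p: "(1 + a) / 2 \<in> {0..1}" using assms by auto
  show ?thesis
  proof (induction m)
    case 0 show ?case by (simp add: binomial_pmf_0[OF p])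
  next
    case (Suc m)
    show ?case
      unfolding sum_pm1.simps Suc pm1_pmf_def binomial_pmf_Suc[OF p] map_pmf_def bind_assoc_pmf bind_return_pmf
      by (intro bind_pmf_cong refl arg_cong[where f = return_pmf]) auto
  qed
qed

lemma sum_pm1_tail:
  assumes a: "a \<in> {-1..1}" and m: "m > 0" and s: "s \<ge> 0"
  shows "measure_pmf.prob (sum_pm1 m a) {x. s \<le> \<bar>x / real m - a\<bar>} \<le> 2 * exp (- real m * s\<^sup>2 / 2)"
proof -
  let ?p = "(1 + a) / 2"
  interpret binomial_distribution m ?p by standard (use a in auto)
  have "{k. s \<le> \<bar>(2 * real k - real m) / real m - a\<bar>} = {k. real m * s / 2 \<le> \<bar>real k - real m * ?p\<bar>}"
  proof -
    have "(2 * real k - real m) / real m - a = (2 / real m) * (real k - real m * ?p)" for k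
      using m by (simp add: field_simps)
    hence "\<bar>(2 * real k - real m) / real m - a\<bar> = (2 / real m) * \<bar>real k - real m * ?p\<bar>" for k
      by (simp only: abs_mult) simp
    thus ?thesis using m by (auto simp: field_simps)
  qed
  hence "measure_pmf.prob (sum_pm1 m a) {x. s \<le> \<bar>x / real m - a\<bar>}
      = measure_pmf.prob (binomial_pmf m ?p) {k. real m * s / 2 \<le> \<bar>real k - real m * ?p\<bar>}"
    unfolding sum_pm1_binomial[OF a] measure_map_pmf by (simp add: vimage_def)
  also have "\<dots> \<le> 2 * exp (- 2 * (real m * s / 2)\<^sup>2 / real m)"
    using m s by (intro prob_abs_ge) auto
  also have "- 2 * (real m * s / 2)\<^sup>2 / real m = - real m * s\<^sup>2 / 2"
    using m by (simp add: field_simps power2_eq_square)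
  finally show ?thesis .
qed

text \<open>Allowing \<alpha>/\<surd>2 for the real and for the imaginary part gives the exponent
  with \<alpha>^2/4; the factor 4 counts two parts with two-sided tails. These are the 4/\<alpha>^2
  and the 4/\<rho> in the formula for N.\<close>

lemma hadamard_tail:
  assumes f: "cmod (f t) \<le> 1" and m: "N div 2 > 0" and \<alpha>: "\<alpha> > 0"
  shows "measure_pmf.prob (hadamard_estimate f N t) {y. \<not> cmod (y - f t) \<le> \<alpha>} \<le> 4 * exp (- real (N div 2) * \<alpha>\<^sup>2 / 4)"
proof -
  let ?m = "N div 2" and ?s = "\<alpha> / sqrt 2"
  let ?H = "hadamard_estimate f N t"
  have a: "Re (f t) \<in> {-1..1}" "Im (f t) \<in> {-1..1}"
    using abs_Re_le_cmod[of "f t"] abs_Im_le_cmod[of "f t"] f by auto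
  have s2: "?s\<^sup>2 = \<alpha>\<^sup>2 / 2" by (simp add: power_divide)
  have s0: "?s \<ge> 0" using \<alpha> by simp
  have marginal: "measure_pmf.prob ?H {y. ?s \<le> \<bar>g y - a\<bar>} \<le> 2 * exp (- real ?m * ?s\<^sup>2 / 2)"
    if g: "map_pmf g ?H = map_pmf (\<lambda>r. r / real ?m) (sum_pm1 ?m a)" and a: "a \<in> {-1..1}" for g :: "complex \<Rightarrow> real" and a
  proof -
    have "measure_pmf.prob ?H {y. ?s \<le> \<bar>g y - a\<bar>} = measure_pmf.prob (map_pmf g ?H) {x. ?s \<le> \<bar>x - a\<bar>}"
      by (simp add: vimage_def)
    also have "\<dots> = measure_pmf.prob (sum_pm1 ?m a) {x. ?s \<le> \<bar>x / real ?m - a\<bar>}" unfolding g by (simp add: vimage_def)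
    finally show ?thesis using sum_pm1_tail[OF a m s0] by simp
  qed
  have "map_pmf Re ?H = map_pmf (\<lambda>r. r / real ?m) (sum_pm1 ?m (Re (f t)))"
    "map_pmf Im ?H = map_pmf (\<lambda>r. r / real ?m) (sum_pm1 ?m (Im (f t)))"
    unfolding hadamard_estimate_def map_pmf_def bind_assoc_pmf bind_return_pmf complex.sel bind_pmf_const by (rule refl)+
  note R = marginal[OF this(1) a(1)] and I = marginal[OF this(2) a(2)]
  have "{y. \<not> cmod (y - f t) \<le> \<alpha>} \<subseteq> {y. ?s \<le> \<bar>Re y - Re (f t)\<bar>} \<union> {y. ?s \<le> \<bar>Im y - Im (f t)\<bar>}"
  proof (rule subsetI, rule ccontr)
    fix y assume y: "y \<in> {y. \<not> cmod (y - f t) \<le> \<alpha>}" "y \<notin> {y. ?s \<le> \<bar>Re y - Re (f t)\<bar>} \<union> {y. ?s \<le> \<bar>Im y - Im (f t)\<bar>}"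
    hence "\<bar>Re y - Re (f t)\<bar>\<^sup>2 \<le> ?s\<^sup>2" "\<bar>Im y - Im (f t)\<bar>\<^sup>2 \<le> ?s\<^sup>2" by (intro power_mono; simp)+
    moreover have "(cmod (y - f t))\<^sup>2 = \<bar>Re y - Re (f t)\<bar>\<^sup>2 + \<bar>Im y - Im (f t)\<bar>\<^sup>2"
      by (simp add: cmod_power2)
    ultimately have "(cmod (y - f t))\<^sup>2 \<le> \<alpha>\<^sup>2" unfolding s2 by linarith
    hence "cmod (y - f t) \<le> \<alpha>" by (rule power2_le_imp_le) (use \<alpha> in simp)
    thus False using y by simp
  qed
  hence "measure_pmf.prob ?H {y. \<not> cmod (y - f t) \<le> \<alpha>} \<le> measure_pmf.prob ?H ({y. ?s \<le> \<bar>Re y - Re (f t)\<bar>} \<union> {y. ?s \<le> \<bar>Im y - Im (f t)\<bar>})"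
    by (intro measure_pmf.finite_measure_mono) auto
  also have "\<dots> \<le> measure_pmf.prob ?H {y. ?s \<le> \<bar>Re y - Re (f t)\<bar>} + measure_pmf.prob ?H {y. ?s \<le> \<bar>Im y - Im (f t)\<bar>}"
    by (rule measure_Un_le) auto
  also have "\<dots> \<le> 4 * exp (- real ?m * ?s\<^sup>2 / 2)" using R I by simp
  finally show ?thesis by (simp add: s2)
qed

text \<open>A union bound for adaptive procedures: only the conditional failure probability after a
  good past has to be bounded, however the next step depends on that past.\<close>

lemma prob_bind_le:
  assumes c: "0 \<le> c" and f: "\<And>x. x \<in> set_pmf p \<Longrightarrow> x \<notin> B \<Longrightarrow> measure_pmf.prob (f x) A \<le> c"
  shows "measure_pmf.prob (bind_pmf p f) A \<le> measure_pmf.prob p B + c"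
proof -
  have "measure_pmf.prob (bind_pmf p f) A = measure_pmf.expectation p (\<lambda>x. measure_pmf.prob (f x) A)"
    unfolding measure_pmf_bind
    by (subst measure_pmf.measure_bind[where N = "count_space UNIV"]) (auto simp: measure_pmf_in_subprob_space)
  also have "\<dots> \<le> measure_pmf.expectation p (\<lambda>x. indicator B x + c)"
  proof (rule integral_mono_AE)
    show "integrable p (\<lambda>x. measure_pmf.prob (f x) A)"
      by (rule measure_pmf.integrable_const_bound[where B = 1]) auto
    show "integrable p (\<lambda>x. indicator B x + c)"
      by (rule measure_pmf.integrable_const_bound[where B = "1 + c"]) (use c in \<open>auto simp: indicator_def\<close>)
    show "AE x in p. measure_pmf.prob (f x) A \<le> indicator B x + c"
      unfolding AE_measure_pmf_iff
    proof
      fix x assume "x \<in> set_pmf p"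
      thus "measure_pmf.prob (f x) A \<le> indicator B x + c"
        using f[of x] c measure_pmf.prob_le_1[of "f x" A] by (cases "x \<in> B") (auto intro: order.trans)
    qed
  qed
  also have "\<dots> = measure_pmf.prob p B + c"
  proof -
    have "integrable p (indicat_real B)"
      by (rule measure_pmf.integrable_const_bound[where B = 1]) (auto simp: indicator_def)
    thus ?thesis by (simp add: measure_pmf.prob_space)
  qed
  finally show ?thesis .
qed

lemma sample_list_bad:
  assumes c: "0 \<le> c" and g: "\<And>k. measure_pmf.prob (g k) {y. \<not> ok k y} \<le> c"
  shows "measure_pmf.prob (sample_list g ks) {ys. \<not> list_all2 ok ks ys} \<le> real (length ks) * c"
proof (induction ks)
  case (Cons k ks)
  have "measure_pmf.prob (sample_list g (k # ks)) {ys. \<not> list_all2 ok (k # ks) ys}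
     \<le> measure_pmf.prob (g k) {y. \<not> ok k y} + real (length ks) * c"
    unfolding sample_list.simps
  proof (rule prob_bind_le)
    fix x assume "x \<notin> {y. \<not> ok k y}"
    hence "(#) x -` {ys. \<not> list_all2 ok (k # ks) ys} = {ys. \<not> list_all2 ok ks ys}" by auto
    thus "measure_pmf.prob (map_pmf ((#) x) (sample_list g ks)) {ys. \<not> list_all2 ok (k # ks) ys} \<le> real (length ks) * c"
      using Cons by simp
  qed (use c in simp)
  thus ?case using g[of k] by (simp add: algebra_simps)
qed simp

section \<open>Cost of the algorithm\<close>

text \<open>Here b stands for \<eta>/\<epsilon>. A level that does not stop has M < b, so the next M
  is at most 4b; since factors are at least 2, all M together sum to at most twice the last. The
  total cost constant 2 * 4 = 8 comes from here, and it holds on the whole support, whether or not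
  the estimates are accurate.\<close>

definition cost_inv :: "real \<Rightarrow> rmpe_state \<Rightarrow> bool" where
  "cost_inv b st \<longleftrightarrow> (case st of (stopped, E, Ms) \<Rightarrow>
     (Ms = [] \<and> \<not> stopped) \<or>
     (Ms \<noteq> [] \<and> 0 < last Ms \<and> last Ms \<le> 4 * b \<and> sum_list Ms \<le> 2 * last Ms \<and>
      (\<forall>M\<in>set Ms. 0 \<le> M \<and> M \<le> last Ms) \<and> (\<not> stopped \<longrightarrow> last Ms < b)))"

lemma cost_inv_step:
  assumes inv: "cost_inv (\<eta> / \<epsilon>) st" and \<epsilon>: "\<epsilon> > 0" "\<epsilon> < 2 * \<eta>"
    and selm: "\<And>l Mp Ep. 2 \<le> selm l Mp Ep \<and> selm l Mp Ep \<le> 4"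
    and st': "st' \<in> set_pmf (rmpe_step f K N \<eta> \<epsilon> selm sele selE st)"
  shows "cost_inv (\<eta> / \<epsilon>) st' \<and> snd (snd st') \<noteq> []"
proof -
  obtain stopped E Ms where st: "st = (stopped, E, Ms)" by (cases st)
  show ?thesis
  proof (cases stopped)
    case True
    thus ?thesis using st' inv by (auto simp: st rmpe_step_def cost_inv_def)
  next
    case False
    define M where "M = (if length Ms = 0 then 1 else last Ms * selm (length Ms) (last Ms) E)"
    obtain E' where st'eq: "st' = (\<eta> / M \<le> \<epsilon>, E', Ms @ [M])"
      using st' False by (auto simp: st rmpe_step_def Let_def M_def)
    have ns: "M < \<eta> / \<epsilon>" if "\<not> \<eta> / M \<le> \<epsilon>" "M > 0" using that \<epsilon> by (simp add: field_simps)
    show ?thesis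
    proof (cases "Ms = []")
      case True
      hence "M = 1" by (simp add: M_def)
      \<comment> \<open>The level M = 1 is always run; the assumption \<epsilon> < 2\<eta> is what
        fits it into the bound.\<close>
      moreover have "1 \<le> 4 * (\<eta> / \<epsilon>)" using \<epsilon> by (simp add: field_simps)
      ultimately show ?thesis using True ns by (auto simp: st'eq cost_inv_def)
    next
      case False2: False
      have i: "0 < last Ms" "last Ms < \<eta> / \<epsilon>" "sum_list Ms \<le> 2 * last Ms" "\<forall>M\<in>set Ms. 0 \<le> M \<and> M \<le> last Ms"
        using inv False False2 by (auto simp: st cost_inv_def)
      let ?m = "selm (length Ms) (last Ms) E"
      have M: "M = last Ms * ?m" using False2 by (simp add: M_def)
      have "last Ms * 2 \<le> M" "M \<le> last Ms * 4" unfolding M using selm i(1) by (auto intro!: mult_left_mono)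
      hence "2 * last Ms \<le> M" "M \<le> 4 * (\<eta> / \<epsilon>)" using i by linarith+
      thus ?thesis using i ns by (fastforce simp: st'eq cost_inv_def)
    qed
  qed
qed

lemma rmpe_cost:
  assumes \<epsilon>: "\<epsilon> > 0" "\<epsilon> < 2 * \<eta>"
    and selm: "\<And>l Mp Ep. 2 \<le> selm l Mp Ep \<and> selm l Mp Ep \<le> 4"
    and st: "(stopped, E, Ms) \<in> set_pmf (rmpe_output f K N \<eta> \<epsilon> selm sele selE)"
  shows "T_max K Ms \<le> 8 * \<eta> * real K / \<epsilon>"
    and "T_total K N Ms \<le> 8 * \<eta> * (real K)\<^sup>2 * real N / \<epsilon>"
proof -
  have iter: "cost_inv (\<eta> / \<epsilon>) st" if "st \<in> set_pmf (rmpe_iter f K N \<eta> \<epsilon> selm sele selE i)" for i st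
    using that
  proof (induction i arbitrary: st)
    case 0 thus ?case by (auto simp: cost_inv_def)
  next
    case (Suc i)
    obtain st0 where st0: "st0 \<in> set_pmf (rmpe_iter f K N \<eta> \<epsilon> selm sele selE i)"
      "st \<in> set_pmf (rmpe_step f K N \<eta> \<epsilon> selm sele selE st0)" using Suc.prems by auto
    thus ?case using cost_inv_step[where selm = selm, OF Suc.IH[OF st0(1)] \<epsilon> selm st0(2)] by simp
  qed
  have "cost_inv (\<eta> / \<epsilon>) (stopped, E, Ms) \<and> Ms \<noteq> []"
  proof -
    obtain st0 where st0: "st0 \<in> set_pmf (rmpe_iter f K N \<eta> \<epsilon> selm sele selE (nat \<lceil>log 2 (\<eta> / \<epsilon>)\<rceil>))"
      "(stopped, E, Ms) \<in> set_pmf (rmpe_step f K N \<eta> \<epsilon> selm sele selE st0)"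
      using st by (auto simp: rmpe_output_def)
    show ?thesis using cost_inv_step[where selm = selm, OF iter[OF st0(1)] \<epsilon> selm st0(2)] by simp
  qed
  hence i: "Ms \<noteq> []" "last Ms \<le> 4 * (\<eta> / \<epsilon>)" "sum_list Ms \<le> 2 * last Ms"
    "\<And>M. M \<in> set Ms \<Longrightarrow> 0 \<le> M \<and> M \<le> last Ms" by (auto simp: cost_inv_def)
  have \<eta>0: "\<eta> / \<epsilon> > 0" using \<epsilon> by simp
  have "T_max K Ms \<le> 4 * (\<eta> / \<epsilon>) * real K"
    unfolding T_max_def
  proof (rule Max.boundedI)
    have "{M * real k | M k. M \<in> set Ms \<and> k \<le> K} = (\<lambda>(M, k). M * real k) ` (set Ms \<times> {..K})" by auto
    thus "finite {M * real k | M k. M \<in> set Ms \<and> k \<le> K}" by simp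
    show "{M * real k | M k. M \<in> set Ms \<and> k \<le> K} \<noteq> {}" using i(1) last_in_set by blast
    fix a assume "a \<in> {M * real k | M k. M \<in> set Ms \<and> k \<le> K}"
    then obtain M k where a: "a = M * real k" "M \<in> set Ms" "k \<le> K" by auto
    have "M \<le> 4 * (\<eta> / \<epsilon>)" using i(2) i(4)[OF a(2)] by linarith
    thus "a \<le> 4 * (\<eta> / \<epsilon>) * real K" unfolding a(1) by (rule mult_mono) (use a(3) \<eta>0 in simp_all)
  qed
  also have "\<dots> \<le> 8 * \<eta> * real K / \<epsilon>" using \<epsilon> by (simp add: field_simps)
  finally show "T_max K Ms \<le> 8 * \<eta> * real K / \<epsilon>" .
  have sumk: "(\<Sum>k\<le>K. real k) \<le> (real K)\<^sup>2"
  proof (cases "K = 0")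
    case False
    have "(\<Sum>k\<le>K. real k) = real K * (real K + 1) / 2" by (induction K) (auto simp: field_simps)
    moreover have "real K * (real K + 1) \<le> real K * (2 * real K)" using False by (intro mult_left_mono) auto
    ultimately show ?thesis by (simp add: power2_eq_square)
  qed simp
  have "T_total K N Ms = (\<Sum>l<length Ms. Ms ! l) * (real N * (\<Sum>k\<le>K. real k))"
    unfolding T_total_def sum_distrib_right by (intro sum.cong refl) (simp add: sum_distrib_left mult_ac)
  also have "(\<Sum>l<length Ms. Ms ! l) = sum_list Ms" by (simp add: sum_list_sum_nth atLeast0LessThan)
  also have "\<dots> * (real N * (\<Sum>k\<le>K. real k)) \<le> (8 * (\<eta> / \<epsilon>)) * (real N * (real K)\<^sup>2)"
    using i(2,3) sumk \<eta>0 by (intro mult_mono mult_left_mono) (auto intro!: mult_nonneg_nonneg sum_nonneg)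
  finally show "T_total K N Ms \<le> 8 * \<eta> * (real K)\<^sup>2 * real N / \<epsilon>" by (simp add: mult_ac)
qed

section \<open>Correctness with high probability\<close>

text \<open>The deterministic content of one level. The two alternatives in \<open>start\<close>
  differ only in the source of the separation: at M = 1 the interval [0, 9/10] is shorter than the
  period, later the rule for m provides it.\<close>

lemma rmpe_level:
  assumes S: "S \<ge> 1" and K: "even K" "32 * S < K" and Dt: "Dt > 0" "real K * Dt > 4"
    "Dt < 1 / (8 * real S * (2 * real S - 1))"
    and gap: "\<And>s t. s < S \<Longrightarrow> t < S \<Longrightarrow> s \<noteq> t \<Longrightarrow> Dt \<le> dist_Z (lam s - lam t)"
    and lam: "\<And>s. s < S \<Longrightarrow> lam s \<in> {0..9/10}"
    and \<beta>: "\<beta> > 0" "\<And>s. s < S \<Longrightarrow> \<beta> \<le> p s"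
    and \<delta>: "\<delta> \<ge> 0" "80 * (real S)\<^sup>2 * \<delta> < \<eta> * \<beta>"
    and \<eta>: "0 < \<eta>" "\<eta> < 1 / (8 * real S * (2 * real S - 1))"
    and start: "(M = 1 \<and> Ep = {0..9/10}) \<or>
      (\<exists>Mp m. Mp \<ge> 1 \<and> M = Mp * m \<and> m_rule_ok Dt \<eta> Mp Ep m \<and>
        (\<forall>s<S. {lam s - \<eta> / 5 / Mp .. lam s + \<eta> / 5 / Mp} \<subseteq> Ep))"
    and noise: "\<And>k. k \<le> K \<Longrightarrow> cmod (y k - (\<Sum>s<S. complex_of_real (p s) * cis (- (2 * pi * (M * lam s))) ^ k)) \<le> \<delta>"
    and L: "L \<in> esprit_outputs K S y"
    and selE: "(\<exists>E. E_update_ok M (ballT L (\<eta> / 2)) Ep E) \<Longrightarrow> E_update_ok M (ballT L (\<eta> / 2)) Ep E'"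
  shows "E' \<subseteq> ballR (lam ` {..<S}) (4/5 * (\<eta> / M))"
    and "\<And>s. s < S \<Longrightarrow> {lam s - \<eta> / 5 / M .. lam s + \<eta> / 5 / M} \<subseteq> E'"
proof -
  have "1 * 1 \<le> real S * (2 * real S - 1)" using S by (intro mult_mono) auto
  hence "1 / (8 * real S * (2 * real S - 1)) \<le> 1 / 8" by (intro divide_left_mono) auto
  hence \<eta>8: "\<eta> < 1/8" using \<eta>(2) by linarith
  have geom: "M \<ge> 1 \<and> (\<forall>s<S. lam s \<in> Ep) \<and>
     (\<forall>s<S. \<forall>t<S. \<forall>q::int. q \<noteq> 0 \<longrightarrow> 9/5 * (\<eta> / M) \<le> \<bar>lam s - lam t - of_int q / M\<bar>) \<and>
     (\<forall>x\<in>Ep. \<forall>s<S. \<forall>q::int. q \<noteq> 0 \<longrightarrow> 4/5 * (\<eta> / M) < \<bar>x - lam s - of_int q / M\<bar>) \<and>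
     (\<forall>s<S. \<forall>t<S. s \<noteq> t \<longrightarrow> Dt \<le> dist_Z (M * lam s - M * lam t))"
    using start
  proof (elim disjE exE conjE)
    assume M: "M = 1" and Ep: "Ep = {0..9/10}"
    have "9/5 * \<eta> \<le> \<bar>lam s - lam t - of_int q\<bar>" if st: "s < S" "t < S" "q \<noteq> (0::int)" for s t q
    \<comment> \<open>For a single point, 9/5 \<eta> may exceed the free length 1/10, but then
      \<open>lam s - lam t\<close> is zero. For S \<ge> 2, \<eta> < 1/48 is small enough.\<close>
    proof (cases "S = 1")
      case True
      hence "lam s = lam t" using st by simp
      moreover have "\<bar>real_of_int q\<bar> \<ge> 1" using st(3) by linarith
      ultimately show ?thesis using \<eta>8 by simp
    next
      case False
      hence "2 * 3 \<le> real S * (2 * real S - 1)" using S by (intro mult_mono) auto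
      hence "1 / (8 * real S * (2 * real S - 1)) \<le> 1 / 48" by (intro divide_left_mono) auto
      hence "9/5 * \<eta> \<le> 1/10" using \<eta>(2) by linarith
      moreover have "\<bar>lam s - lam t\<bar> \<le> 9/10" using lam[OF st(1)] lam[OF st(2)] unfolding atLeastAtMost_iff by linarith
      moreover have "\<bar>real_of_int q\<bar> \<ge> 1" using st(3) by linarith
      ultimately show ?thesis by linarith
    qed
    moreover have "4/5 * \<eta> < \<bar>x - lam s - of_int q\<bar>" if "x \<in> Ep" "s < S" "q \<noteq> (0::int)" for x s q
    proof -
      have "\<bar>x - lam s\<bar> \<le> 9/10" using lam[OF that(2)] that(1) unfolding Ep atLeastAtMost_iff by linarith
      moreover have "\<bar>real_of_int q\<bar> \<ge> 1" using that(3) by linarith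
      ultimately show ?thesis using \<eta>8 by linarith
    qed
    ultimately show ?thesis using M Ep lam gap by auto
  next
    fix Mp m assume Mp: "1 \<le> Mp" and M: "M = Mp * m" and ok: "m_rule_ok Dt \<eta> Mp Ep m"
      and E: "\<forall>s<S. {lam s - \<eta> / 5 / Mp .. lam s + \<eta> / 5 / Mp} \<subseteq> Ep"
    have Mp0: "Mp > 0" using Mp by simp
    have m: "2 \<le> m" using ok by (simp add: m_rule_ok_def)
    have "1 * 2 \<le> Mp * m" using Mp m by (intro mult_mono) auto
    hence M1: "M \<ge> 1" by (simp add: M)
    note sep = m_rule_separation[where lam = lam and S = S, OF ok Mp0 \<eta>(1) Dt(1), folded M]
    have lamE: "lam s \<in> Ep" if "s < S" for s
    proof -
      have "\<eta> / 5 / Mp \<ge> 0" using \<eta>(1) Mp0 by simp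
      thus ?thesis using E[rule_format, OF that] by auto
    qed
    have "Dt \<le> dist_Z (M * lam s - M * lam t)" if st: "s < S" "t < S" "s \<noteq> t" for s t
    proof -
      define q where "q = round (M * lam s - M * lam t)"
      have d: "dist_Z (M * lam s - M * lam t) = \<bar>M * lam s - M * lam t - of_int q\<bar>" by (simp add: dist_Z_round q_def)
      have eq: "M * lam s - M * lam t - of_int q = M * (lam s - lam t - of_int q / M)" using M1 by (simp add: field_simps)
      \<comment> \<open>For q = 0 this is the original gap, magnified by M \<ge> 1; for q \<noteq> 0
        it is an aliased coincidence, kept \<open>Dt / Mp\<close> apart by the rule for m.\<close>
      have "Dt \<le> M * \<bar>lam s - lam t - of_int q / M\<bar>"
      proof (cases "q = 0")
        case True
        have "Dt \<le> \<bar>lam s - lam t\<bar>" using gap[OF st] dist_Z_le[of "lam s - lam t" 0] by simp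
        hence "1 * Dt \<le> M * \<bar>lam s - lam t\<bar>" using M1 Dt(1) by (intro mult_mono) auto
        thus ?thesis using True by simp
      next
        case False
        have "Dt / Mp \<le> \<bar>lam s - lam t - of_int q / M\<bar>" using sep(3)[OF _ st(1,2) False] E by blast
        hence "M * (Dt / Mp) \<le> M * \<bar>lam s - lam t - of_int q / M\<bar>" using M1 by (intro mult_left_mono) auto
        moreover have "M * (Dt / Mp) = m * Dt" using Mp0 by (simp add: M)
        moreover have "1 * Dt \<le> m * Dt" using m Dt(1) by (intro mult_right_mono) auto
        ultimately show ?thesis by simp
      qed
      thus ?thesis unfolding d eq using M1 by (simp add: abs_mult)
    qed
    moreover have "9/5 * (\<eta> / M) \<le> \<bar>lam s - lam t - of_int q / M\<bar>" if "s < S" "t < S" "q \<noteq> (0::int)" for s t q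
      using sep(1)[OF _ that] E by blast
    moreover have "4/5 * (\<eta> / M) < \<bar>x - lam s - of_int q / M\<bar>" if "x \<in> Ep" "s < S" "q \<noteq> (0::int)" for x s q
      using sep(2)[OF _ that] E by blast
    ultimately show ?thesis using M1 lamE by blast
  qed
  have M0: "M > 0" using geom[THEN conjunct1] by linarith
  note g = geom[THEN conjunct2, THEN conjunct1, rule_format]
    geom[THEN conjunct2, THEN conjunct2, THEN conjunct1, rule_format]
    geom[THEN conjunct2, THEN conjunct2, THEN conjunct2, THEN conjunct1, rule_format]
  note g4 = geom[THEN conjunct2, THEN conjunct2, THEN conjunct2, THEN conjunct2, rule_format]
  note es = esprit_stable[where x = "\<lambda>s. M * lam s", OF S K Dt(1,2) g4 \<beta> \<delta>(1) noise \<delta>(2) less_imp_le[OF \<eta>8] L]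
  have n: "\<And>v. v \<in> L \<Longrightarrow> \<exists>s<S. dist_Z (v - M * lam s) \<le> 3/10 * \<eta>"
    "\<And>s. s < S \<Longrightarrow> \<exists>v\<in>L. dist_Z (v - M * lam s) \<le> 3/10 * \<eta>"
    by (rule es(1); assumption) (rule es(2); assumption)
  have "\<exists>E. E_update_ok M (ballT L (\<eta> / 2)) Ep E"
    by (rule E_update_exists[OF M0 \<eta>(1) n g])
  hence ok: "E_update_ok M (ballT L (\<eta> / 2)) Ep E'" by (rule selE)
  show "E' \<subseteq> ballR (lam ` {..<S}) (4/5 * (\<eta> / M))"
    by (rule E_update_bounds(1)[OF M0 \<eta>(1) n g ok])
  show "{lam s - \<eta> / 5 / M .. lam s + \<eta> / 5 / M} \<subseteq> E'" if "s < S" for s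
    by (rule E_update_bounds(2)[OF M0 \<eta>(1) n g ok that])
qed

text \<open>A stopped state records the goal itself. For a running state i counts the completed
  levels; the lower bound on the last M forces termination, and the inclusions on both sides are
  what \<open>m_rule_exists\<close> and \<open>m_rule_separation\<close> require.\<close>

definition rmpe_inv :: "nat \<Rightarrow> (nat \<Rightarrow> real) \<Rightarrow> real \<Rightarrow> real \<Rightarrow> nat \<Rightarrow> rmpe_state \<Rightarrow> bool" where
  "rmpe_inv S lam \<eta> \<epsilon> i st \<longleftrightarrow> (case st of (stopped, E, Ms) \<Rightarrow>
     if stopped then lam ` {..<S} \<subseteq> E \<and> E \<subseteq> ballR (lam ` {..<S}) \<epsilon>
     else length Ms = i \<and> (if i = 0 then E = {0..9/10}
       else 2 ^ (i - 1) \<le> last Ms \<and> \<epsilon> < \<eta> / last Ms \<and>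
         E \<subseteq> ballR (lam ` {..<S}) (4/5 * (\<eta> / last Ms)) \<and>
         (\<forall>s<S. {lam s - \<eta> / 5 / last Ms .. lam s + \<eta> / 5 / last Ms} \<subseteq> E)))"

context
  fixes S K N :: nat and lam p :: "nat \<Rightarrow> real" and Dt \<beta> \<omega> \<alpha> \<eta> \<epsilon> :: real and f :: "real \<Rightarrow> complex"
    and selm :: "nat \<Rightarrow> real \<Rightarrow> real set \<Rightarrow> real"
    and sele :: "nat \<Rightarrow> real \<Rightarrow> real set \<Rightarrow> (nat \<Rightarrow> complex) \<Rightarrow> real set"
    and selE :: "nat \<Rightarrow> real \<Rightarrow> real set \<Rightarrow> real set \<Rightarrow> real set"
  assumes S: "S \<ge> 1" and K: "even K" "32 * S < K" and Dt: "Dt > 0" "real K * Dt > 4"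
    "Dt < 1 / (8 * real S * (2 * real S - 1))"
    and gap: "\<And>s t. s < S \<Longrightarrow> t < S \<Longrightarrow> s \<noteq> t \<Longrightarrow> Dt \<le> dist_Z (lam s - lam t)"
    and lam: "\<And>s. s < S \<Longrightarrow> lam s \<in> {0..9/10}"
    and \<beta>: "\<beta> > 0" "\<And>s. s < S \<Longrightarrow> \<beta> \<le> p s"
    and \<omega>: "\<omega> \<ge> 0" and \<alpha>: "\<alpha> > 0" "80 * (real S)\<^sup>2 * (\<alpha> + \<omega>) < \<eta> * \<beta>"
    and \<eta>: "0 < \<eta>" "\<eta> < 1 / (8 * real S * (2 * real S - 1))" and \<epsilon>: "\<epsilon> > 0"
    and f1: "\<And>t. cmod (f t) \<le> 1"
    and f2: "\<And>t. cmod (f t - (\<Sum>s<S. complex_of_real (p s) * cis (- (2 * pi * lam s * t)))) \<le> \<omega>"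
    and N: "N div 2 > 0"
    and selm: "\<And>l Mp Ep. 2 \<le> selm l Mp Ep" "\<And>l Mp Ep. \<exists>m. m_rule_ok Dt \<eta> Mp Ep m \<Longrightarrow> m_rule_ok Dt \<eta> Mp Ep (selm l Mp Ep)"
    and sele: "\<And>l M Ep y. esprit_outputs K S y \<noteq> {} \<Longrightarrow> sele l M Ep y \<in> esprit_outputs K S y"
    and selE: "\<And>l M Ep Y. \<exists>E. E_update_ok M Y Ep E \<Longrightarrow> E_update_ok M Y Ep (selE l M Ep Y)"
begin

lemma rmpe_step_good:
  assumes inv: "rmpe_inv S lam \<eta> \<epsilon> i (False, Ep, Ms)"
  defines "M \<equiv> if length Ms = 0 then 1 else last Ms * selm (length Ms) (last Ms) Ep"
  assumes ys: "list_all2 (\<lambda>k y. cmod (y - f (M * real k)) \<le> \<alpha>) [0..<K + 1] ys"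
  shows "rmpe_inv S lam \<eta> \<epsilon> (Suc i)
    (\<eta> / M \<le> \<epsilon>, selE (length Ms) M Ep (ballT (sele (length Ms) M Ep (\<lambda>k. ys ! k)) (\<eta> / 2)), Ms @ [M])"
proof -
  let ?y = "\<lambda>k. ys ! k"
  let ?L = "sele (length Ms) M Ep ?y"
  let ?E = "selE (length Ms) M Ep (ballT ?L (\<eta> / 2))"
  have len: "length Ms = i" using inv by (simp add: rmpe_inv_def)
  have "((M = 1 \<and> Ep = {0..9/10}) \<or>
      (\<exists>Mp m. Mp \<ge> 1 \<and> M = Mp * m \<and> m_rule_ok Dt \<eta> Mp Ep m \<and>
        (\<forall>s<S. {lam s - \<eta> / 5 / Mp .. lam s + \<eta> / 5 / Mp} \<subseteq> Ep))) \<and> 2 ^ i \<le> M"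
  proof (cases "i = 0")
    case True
    thus ?thesis using inv len by (simp add: rmpe_inv_def M_def)
  next
    case False
    have i: "2 ^ (i - 1) \<le> last Ms" "Ep \<subseteq> ballR (lam ` {..<S}) (4/5 * (\<eta> / last Ms))"
      "\<forall>s<S. {lam s - \<eta> / 5 / last Ms .. lam s + \<eta> / 5 / last Ms} \<subseteq> Ep"
      using inv False by (simp_all add: rmpe_inv_def)
    have "(1::real) \<le> 2 ^ (i - 1)" by simp
    hence l1: "last Ms \<ge> 1" using i(1) by linarith
    have ok: "m_rule_ok Dt \<eta> (last Ms) Ep (selm i (last Ms) Ep)"
      using l1 by (intro selm(2) m_rule_exists[OF S _ \<eta> Dt(3) i(2)]) simp
    have M: "M = last Ms * selm i (last Ms) Ep" using False len by (simp add: M_def)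
    have "2 ^ (i - 1) * 2 \<le> last Ms * selm i (last Ms) Ep" using i(1) selm(1) l1 by (intro mult_mono) auto
    moreover have "(2::real) ^ i = 2 ^ (i - 1) * 2" using False by (cases i) auto
    ultimately show ?thesis using M ok l1 i(3) by auto
  qed
  hence start: "(M = 1 \<and> Ep = {0..9/10}) \<or>
      (\<exists>Mp m. Mp \<ge> 1 \<and> M = Mp * m \<and> m_rule_ok Dt \<eta> Mp Ep m \<and>
        (\<forall>s<S. {lam s - \<eta> / 5 / Mp .. lam s + \<eta> / 5 / Mp} \<subseteq> Ep))" and M2: "2 ^ i \<le> M" by (rule conjunct1, rule conjunct2)
  have noise: "cmod (?y k - (\<Sum>s<S. complex_of_real (p s) * cis (- (2 * pi * (M * lam s))) ^ k)) \<le> \<alpha> + \<omega>" if k: "k \<le> K" for k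
  proof -
    let ?s = "\<Sum>s<S. complex_of_real (p s) * cis (- (2 * pi * lam s * (M * real k)))"
    have "?s = (\<Sum>s<S. complex_of_real (p s) * cis (- (2 * pi * (M * lam s))) ^ k)"
    proof (intro sum.cong refl arg_cong[where f = "(*) _"])
      fix s show "cis (- (2 * pi * lam s * (M * real k))) = cis (- (2 * pi * (M * lam s))) ^ k"
        unfolding Complex.DeMoivre by (rule arg_cong[where f = cis]) simp
    qed
    moreover have "cmod (?y k - f (M * real k)) \<le> \<alpha>"
      using list_all2_nthD[OF ys, of k] k by (simp del: upt_Suc)
    moreover have "cmod (f (M * real k) - ?s) \<le> \<omega>" by (rule f2)
    ultimately show ?thesis using norm_triangle_ineq[of "?y k - f (M * real k)" "f (M * real k) - ?s"] by simp
  qed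
  have L: "?L \<in> esprit_outputs K S ?y" by (rule sele[OF esprit_outputs_nonempty])
  have \<delta>: "0 \<le> \<alpha> + \<omega>" using \<alpha>(1) \<omega> by simp
  have E1: "?E \<subseteq> ballR (lam ` {..<S}) (4/5 * (\<eta> / M))" 
    by (rule rmpe_level(1)[where y = ?y, OF S K Dt gap lam \<beta> \<delta> \<alpha>(2) \<eta> start noise L selE])
  have E2: "{lam s - \<eta> / 5 / M .. lam s + \<eta> / 5 / M} \<subseteq> ?E" if "s < S" for s
    by (rule rmpe_level(2)[where y = ?y, OF S K Dt gap lam \<beta> \<delta> \<alpha>(2) \<eta> start noise L selE that])
  have "(0::real) < 2 ^ i" by simp
  hence \<eta>M: "\<eta> / M > 0" using M2 \<eta>(1) by (intro divide_pos_pos) linarith+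
  show ?thesis
  proof (cases "\<eta> / M \<le> \<epsilon>")
    case True
    have "lam s \<in> ?E" if "s < S" for s
      using E2[OF that] \<eta>M by (auto simp: subset_iff)
    moreover have "4/5 * (\<eta> / M) \<le> \<epsilon>" using True \<eta>M by linarith
    hence "ballR (lam ` {..<S}) (4/5 * (\<eta> / M)) \<subseteq> ballR (lam ` {..<S}) \<epsilon>" by (force simp: ballR_def)
    ultimately show ?thesis using True E1 by (auto simp: rmpe_inv_def)
  next
    case False
    thus ?thesis using E1 E2 M2 len by (simp add: rmpe_inv_def)
  qed
qed

lemma rmpe_step_prob:
  assumes inv: "rmpe_inv S lam \<eta> \<epsilon> i st"
  shows "measure_pmf.prob (rmpe_step f K N \<eta> \<epsilon> selm sele selE st) {st. \<not> rmpe_inv S lam \<eta> \<epsilon> (Suc i) st}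
    \<le> real (K + 1) * (4 * exp (- real (N div 2) * \<alpha>\<^sup>2 / 4))"
proof -
  obtain stopped Ep Ms where st: "st = (stopped, Ep, Ms)" by (cases st)
  let ?c = "4 * exp (- real (N div 2) * \<alpha>\<^sup>2 / 4)"
  show ?thesis
  proof (cases stopped)
    case True
    hence "rmpe_inv S lam \<eta> \<epsilon> (Suc i) st" using inv by (simp add: st rmpe_inv_def)
    thus ?thesis using True by (simp add: st rmpe_step_def)
  next
    case False
    define M where "M = (if length Ms = 0 then 1 else last Ms * selm (length Ms) (last Ms) Ep)"
    have inv': "rmpe_inv S lam \<eta> \<epsilon> i (False, Ep, Ms)" using inv False by (simp add: st)
    define F where "F = (\<lambda>ys. (\<eta> / M \<le> \<epsilon>, selE (length Ms) M Ep (ballT (sele (length Ms) M Ep (\<lambda>k. ys ! k)) (\<eta> / 2)), Ms @ [M]))"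
    let ?ok = "\<lambda>k y. cmod (y - f (M * real k)) \<le> \<alpha>"
    let ?smp = "sample_list (\<lambda>k. hadamard_estimate f N (M * real k)) [0..<K + 1]"
    have "rmpe_step f K N \<eta> \<epsilon> selm sele selE st = map_pmf F ?smp"
      using False by (simp add: st rmpe_step_def Let_def M_def F_def)
    hence "measure_pmf.prob (rmpe_step f K N \<eta> \<epsilon> selm sele selE st) {st. \<not> rmpe_inv S lam \<eta> \<epsilon> (Suc i) st}
      = measure_pmf.prob ?smp (F -` {st. \<not> rmpe_inv S lam \<eta> \<epsilon> (Suc i) st})" by simp
    also have "\<dots> \<le> measure_pmf.prob ?smp {ys. \<not> list_all2 ?ok [0..<K + 1] ys}"
    proof (rule measure_pmf.finite_measure_mono)
      have "rmpe_inv S lam \<eta> \<epsilon> (Suc i) (F ys)" if "list_all2 ?ok [0..<K + 1] ys" for ys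
        unfolding F_def M_def by (rule rmpe_step_good[OF inv' that[unfolded M_def]])
      thus "F -` {st. \<not> rmpe_inv S lam \<eta> \<epsilon> (Suc i) st} \<subseteq> {ys. \<not> list_all2 ?ok [0..<K + 1] ys}" by blast
    qed simp
    also have "\<dots> \<le> real (length [0..<K + 1]) * ?c"
      by (rule sample_list_bad[OF _ hadamard_tail[OF f1 N \<alpha>(1)]]) simp
    finally show ?thesis by (simp only: length_upt diff_zero)
  qed
qed

lemma rmpe_iter_prob:
  "measure_pmf.prob (rmpe_iter f K N \<eta> \<epsilon> selm sele selE i) {st. \<not> rmpe_inv S lam \<eta> \<epsilon> i st}
    \<le> real i * (real (K + 1) * (4 * exp (- real (N div 2) * \<alpha>\<^sup>2 / 4)))"
proof (induction i)
  case 0 show ?case by (simp add: rmpe_inv_def)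
next
  case (Suc i)
  let ?c = "real (K + 1) * (4 * exp (- real (N div 2) * \<alpha>\<^sup>2 / 4))"
  have "measure_pmf.prob (rmpe_iter f K N \<eta> \<epsilon> selm sele selE (Suc i)) {st. \<not> rmpe_inv S lam \<eta> \<epsilon> (Suc i) st}
     \<le> measure_pmf.prob (rmpe_iter f K N \<eta> \<epsilon> selm sele selE i) {st. \<not> rmpe_inv S lam \<eta> \<epsilon> i st} + ?c"
    unfolding rmpe_iter.simps by (rule prob_bind_le) (use rmpe_step_prob in auto)
  thus ?case using Suc by (simp add: algebra_simps)
qed

text \<open>A state still running after J + 1 levels would satisfy 2^J \<le> M < \<eta>/\<epsilon>
  \<le> 2^J. So every bad outcome breaks the invariant, and the union bound over J + 1 levels and K
  + 1 estimates accounts for the last two logarithms.\<close>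

lemma rmpe_output_prob:
  assumes n: "real (N div 2) * \<alpha>\<^sup>2 / 4 \<ge> ln (4 / \<rho>) + ln (real (nat \<lceil>log 2 (\<eta> / \<epsilon>)\<rceil>) + 1) + ln (real K + 1)"
    and \<rho>: "\<rho> > 0"
  shows "measure_pmf.prob (rmpe_output f K N \<eta> \<epsilon> selm sele selE)
    {(stopped, E, Ms). stopped \<and> lam ` {..<S} \<subseteq> E \<and> E \<subseteq> ballR (lam ` {..<S}) \<epsilon>} \<ge> 1 - \<rho>"
proof -
  define J where "J = nat \<lceil>log 2 (\<eta> / \<epsilon>)\<rceil>"
  let ?p = "rmpe_output f K N \<eta> \<epsilon> selm sele selE"
  let ?G = "{(stopped, E, Ms). stopped \<and> lam ` {..<S} \<subseteq> E \<and> E \<subseteq> ballR (lam ` {..<S}) \<epsilon>} :: rmpe_state set"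
  let ?c = "4 * exp (- real (N div 2) * \<alpha>\<^sup>2 / 4)"
  have "log 2 (\<eta> / \<epsilon>) \<le> real J" unfolding J_def by linarith
  hence "\<eta> / \<epsilon> \<le> 2 powr real J" using \<eta>(1) \<epsilon> by (simp add: log_le_iff)
  hence J: "\<eta> / \<epsilon> \<le> 2 ^ J" by (simp add: powr_realpow)
  have sub: "- ?G \<subseteq> {st. \<not> rmpe_inv S lam \<eta> \<epsilon> (J + 1) st}"
  proof (rule subsetI, rule ccontr)
    fix st assume st: "st \<in> - ?G" "st \<notin> {st. \<not> rmpe_inv S lam \<eta> \<epsilon> (J + 1) st}"
    obtain stopped E Ms where eq: "st = (stopped, E, Ms)" by (cases st)
    have inv: "rmpe_inv S lam \<eta> \<epsilon> (J + 1) (stopped, E, Ms)" using st(2) unfolding eq by simp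
    have ng: "\<not> (stopped \<and> lam ` {..<S} \<subseteq> E \<and> E \<subseteq> ballR (lam ` {..<S}) \<epsilon>)"
      using st(1) unfolding eq by simp
    have ns: "\<not> stopped" using inv ng unfolding rmpe_inv_def by (cases stopped) simp_all
    have l: "2 ^ J \<le> last Ms" "\<epsilon> < \<eta> / last Ms" using inv ns unfolding rmpe_inv_def by simp_all
    have "(0::real) < 2 ^ J" by simp
    hence "0 < last Ms" using l(1) by linarith
    hence "last Ms < \<eta> / \<epsilon>" using l(2) \<epsilon> by (simp add: field_simps)
    thus False using J l(1) by linarith
  qed
  have "measure_pmf.prob ?p (- ?G) \<le> measure_pmf.prob ?p {st. \<not> rmpe_inv S lam \<eta> \<epsilon> (J + 1) st}"
    using sub by (intro measure_pmf.finite_measure_mono) auto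
  also have "\<dots> \<le> real (J + 1) * (real (K + 1) * ?c)"
    unfolding rmpe_output_def J_def by (rule rmpe_iter_prob)
  also have "\<dots> \<le> \<rho>"
  proof -
    have "?c \<le> 4 * exp (- (ln (4 / \<rho>) + ln (real J + 1) + ln (real K + 1)))" using n by (simp add: J_def)
    also have "\<dots> = \<rho> / ((real J + 1) * (real K + 1))"
    proof -
      define x where "x = (real J + 1) * (real K + 1)"
      have x: "x > 0" by (simp add: x_def)
      have "exp (ln (4 / \<rho>) + ln (real J + 1) + ln (real K + 1)) = 4 / \<rho> * x"
        using \<rho> by (simp add: exp_add x_def)
      hence "4 * exp (- (ln (4 / \<rho>) + ln (real J + 1) + ln (real K + 1))) = 4 * inverse (4 / \<rho> * x)"
        by (simp only: exp_minus)
      also have "\<dots> = \<rho> / x" using \<rho> x by (simp add: field_simps)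
      finally show ?thesis by (simp only: x_def)
    qed
    finally have "real (J + 1) * (real (K + 1) * ?c) \<le> real (J + 1) * (real (K + 1) * (\<rho> / ((real J + 1) * (real K + 1))))"
      by (intro mult_left_mono) auto
    also have "\<dots> = \<rho>"
    proof -
      have "real (J + 1) = real J + 1" "real (K + 1) = real K + 1" "real J + 1 \<noteq> 0" "real K + 1 \<noteq> 0" by auto
      thus ?thesis by (simp only: times_divide_eq_right mult.assoc[symmetric]) simp
    qed
    finally show ?thesis .
  qed
  finally have "measure_pmf.prob ?p (- ?G) \<le> \<rho>" .
  moreover have "measure_pmf.prob ?p (- ?G) = 1 - measure_pmf.prob ?p ?G"
    using measure_pmf.prob_compl[of ?G ?p] by (simp add: Compl_eq_Diff_UNIV)
  ultimately show ?thesis by simp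
qed

end

text \<open>The constant \<open>cst\<close> precedes all parameters, so the O-bounds are uniform.
  The selection functions are arbitrary except that they return an admissible choice whenever one
  exists.\<close>

theorem theorem5:
  shows "\<exists>cst::real. \<forall>n H S lam psis c cres psires psi \<beta> \<omega> Dt K C \<eta> \<alpha> \<epsilon> \<rho> N selm sele selE.
    real_power_model n H S lam psis c cres psires psi \<beta> \<omega> \<and> S \<ge> 1 \<and>
    \<epsilon> > 0 \<and> \<epsilon> < 2 * \<eta> \<and> 0 < \<rho> \<and> \<rho> < 1 \<and>
    Dt < 1 / (8 * real S * (2 * real S - 1)) \<and>
    (\<forall>s<S. \<forall>s'<S. s \<noteq> s' \<longrightarrow> Dt < dist_Z (lam s - lam s')) \<and>
    even K \<and> real K > 4 / Dt \<and>
    2 < C \<and> C < real K * Dt / 2 \<and>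
    (let A = 80 * (real S)\<^sup>2 / \<beta> * sqrt (C ^ 3 * (2 + real K) / ((C - 1) ^ 3 * real K))
               * inverse (1 - 2 * C * real S / ((C - 1) * real K))
     in A * \<omega> < \<eta> \<and> \<eta> < 1 / (8 * real S * (2 * real S - 1)) \<and>
        0 < \<alpha> \<and>
        \<alpha> < min (C * \<beta> / (8 * (C - 1) * sqrt (2 * real S))
                     * sqrt (1 - 2 * (C - 1) * real S / (C * real K)))
                 (\<eta> / A) - \<omega>) \<and>
    real N = 2 * of_int \<lceil>4 / \<alpha>\<^sup>2 * (ln (4 / \<rho>) + ln (of_int \<lceil>log 2 (\<eta> / \<epsilon>)\<rceil> + 1)
                                     + ln (real K + 1))\<rceil> \<and>
    (\<forall>l Mp Ep. 2 \<le> selm l Mp Ep \<and> selm l Mp Ep \<le> 4 \<and>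
       ((\<exists>m. m_rule_ok Dt \<eta> Mp Ep m) \<longrightarrow> m_rule_ok Dt \<eta> Mp Ep (selm l Mp Ep))) \<and>
    (\<forall>l M Ep y. esprit_outputs K S y \<noteq> {} \<longrightarrow> sele l M Ep y \<in> esprit_outputs K S y) \<and>
    (\<forall>l M Ep Y. (\<exists>E. E_update_ok M Y Ep E) \<longrightarrow> E_update_ok M Y Ep (selE l M Ep Y))
    \<longrightarrow>
    measure_pmf.prob (rmpe_output (signal H psi) K N \<eta> \<epsilon> selm sele selE)
       {(stopped, E, Ms). stopped \<and> lam ` {..<S} \<subseteq> E \<and> E \<subseteq> ballR (lam ` {..<S}) \<epsilon>}
       \<ge> 1 - \<rho> \<and>
    (\<forall>(stopped, E, Ms) \<in> set_pmf (rmpe_output (signal H psi) K N \<eta> \<epsilon> selm sele selE).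
       T_max K Ms \<le> cst * \<eta> * real K / \<epsilon> \<and>
       T_total K N Ms \<le> cst * \<eta> * (real K)\<^sup>2 * real N / \<epsilon>)"
proof (intro exI[of _ 8] allI impI, goal_cases)
  case (1 n H S lam psis c cres psires psi \<beta> \<omega> Dt K C \<eta> \<alpha> \<epsilon> \<rho> N selm sele selE)
  define A where "A = 80 * (real S)\<^sup>2 / \<beta> * sqrt (C ^ 3 * (2 + real K) / ((C - 1) ^ 3 * real K))
               * inverse (1 - 2 * C * real S / ((C - 1) * real K))"
  from 1 have model: "real_power_model n H S lam psis c cres psires psi \<beta> \<omega>" and S: "S \<ge> 1"
    and \<epsilon>: "\<epsilon> > 0" "\<epsilon> < 2 * \<eta>" and \<rho>: "0 < \<rho>" "\<rho> < 1"
    and Dtu: "Dt < 1 / (8 * real S * (2 * real S - 1))"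
    and gap: "\<forall>s<S. \<forall>s'<S. s \<noteq> s' \<longrightarrow> Dt < dist_Z (lam s - lam s')"
    and K: "even K" and C: "2 < C" "C < real K * Dt / 2"
    and \<eta>u: "\<eta> < 1 / (8 * real S * (2 * real S - 1))" and \<alpha>0: "0 < \<alpha>" and \<alpha>A: "\<alpha> < \<eta> / A - \<omega>"
    and N: "real N = 2 * of_int \<lceil>4 / \<alpha>\<^sup>2 * (ln (4 / \<rho>) + ln (of_int \<lceil>log 2 (\<eta> / \<epsilon>)\<rceil> + 1) + ln (real K + 1))\<rceil>"
    and selm: "\<forall>l Mp Ep. 2 \<le> selm l Mp Ep \<and> selm l Mp Ep \<le> 4 \<and>
       ((\<exists>m. m_rule_ok Dt \<eta> Mp Ep m) \<longrightarrow> m_rule_ok Dt \<eta> Mp Ep (selm l Mp Ep))"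
    and sele: "\<forall>l M Ep y. esprit_outputs K S y \<noteq> {} \<longrightarrow> sele l M Ep y \<in> esprit_outputs K S y"
    and selE: "\<forall>l M Ep Y. (\<exists>E. E_update_ok M Y Ep E) \<longrightarrow> E_update_ok M Y Ep (selE l M Ep Y)"
    unfolding Let_def A_def[symmetric] min_less_iff_conj by (auto simp: A_def[symmetric])
  have \<eta>0: "\<eta> > 0" using \<epsilon> by linarith
  have KDt: "real K * Dt > 4" using C by linarith
  hence Dt0: "Dt > 0" by (metis linorder_not_less mult_nonneg_nonpos of_nat_0_le_iff order.strict_trans zero_less_numeral)
  \<comment> \<open>K exceeds 4/Dt, and 1/Dt exceeds 8 S(2S - 1), hence 8S.\<close>
  have KS: "32 * real S < real K"
  proof -
    have "real S * 1 \<le> real S * (2 * real S - 1)" using S by (intro mult_left_mono) auto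
    hence "Dt * (8 * real S) \<le> Dt * (8 * real S * (2 * real S - 1))" using Dt0 by (intro mult_left_mono) auto
    also have "\<dots> < 1" using Dtu S by (simp add: field_simps)
    finally have "real K * (Dt * (8 * real S)) \<le> real K * 1" by (intro mult_left_mono) auto
    moreover have "4 * (8 * real S) < real K * Dt * (8 * real S)" using KDt S by (intro mult_strict_right_mono) auto
    ultimately show ?thesis by (simp add: mult_ac)
  qed
  note m = model[unfolded real_power_model_def]
  have \<beta>: "\<beta> > 0" "\<And>s. s < S \<Longrightarrow> \<beta> \<le> (cmod (c s))\<^sup>2" and lam: "\<And>s. s < S \<Longrightarrow> lam s \<in> {0..9/10}"
    and cres: "(cmod cres)\<^sup>2 \<le> \<omega>" using m by auto
  have \<omega>: "\<omega> \<ge> 0" using cres zero_le_power2[of "cmod cres"] by linarith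
  \<comment> \<open>The remaining two factors of \<open>A\<close> are at least 1. For the inverse
    this needs u < 1, which follows from C < 2(C - 1) and 4S < K.\<close>
  have A80: "80 * (real S)\<^sup>2 / \<beta> \<le> A"
  proof -
    define u where "u = 2 * C * real S / ((C - 1) * real K)"
    have K0: "real K > 0" using KS by linarith
    have "C * (2 * real S) \<le> ((C - 1) * 2) * (2 * real S)" using C(1) by (intro mult_right_mono) auto
    also have "\<dots> = (C - 1) * (4 * real S)" by simp
    also have "\<dots> < (C - 1) * real K" using KS S C(1) by (intro mult_strict_left_mono) auto
    finally have u: "0 \<le> u" "u < 1" using C(1) K0 by (auto simp: u_def)
    have 1: "1 \<le> inverse (1 - u)" using u by (simp add: one_le_inverse_iff)
    have "(C - 1) ^ 3 * real K \<le> C ^ 3 * (2 + real K)" using C(1) by (intro mult_mono power_mono) auto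
    hence "1 \<le> C ^ 3 * (2 + real K) / ((C - 1) ^ 3 * real K)" using C(1) K0 by simp
    hence 2: "1 \<le> sqrt (C ^ 3 * (2 + real K) / ((C - 1) ^ 3 * real K))" by simp
    have B: "0 \<le> 80 * (real S)\<^sup>2 / \<beta>" using \<beta>(1) by simp
    have "b * 1 * 1 \<le> b * r * s" if "0 \<le> b" "1 \<le> r" "1 \<le> s" for b r s :: real
      using that by (intro mult_mono) auto
    from this[OF B 2 1] show ?thesis unfolding A_def u_def by simp
  qed
  have \<alpha>\<eta>: "80 * (real S)\<^sup>2 * (\<alpha> + \<omega>) < \<eta> * \<beta>"
  proof -
    have "0 < 80 * (real S)\<^sup>2 / \<beta>" using S \<beta>(1) by simp
    hence A0: "A > 0" using A80 by linarith
    have "\<alpha> + \<omega> < \<eta> / A" using \<alpha>A by linarith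
    hence "A * (\<alpha> + \<omega>) < \<eta>" using A0 by (simp add: field_simps)
    moreover have "80 * (real S)\<^sup>2 / \<beta> * (\<alpha> + \<omega>) \<le> A * (\<alpha> + \<omega>)" using A80 \<alpha>0 \<omega> by (intro mult_right_mono) auto
    ultimately have "80 * (real S)\<^sup>2 / \<beta> * (\<alpha> + \<omega>) < \<eta>" by linarith
    thus ?thesis using \<beta>(1) by (simp add: field_simps)
  qed
  define X where "X = ln (4 / \<rho>) + ln (of_int \<lceil>log 2 (\<eta> / \<epsilon>)\<rceil> + 1) + ln (real K + 1)"
  \<comment> \<open>This makes the ceiling of the logarithm nonnegative, so that the integer
    expression in the formula for N agrees with the number of iterations.\<close>
  have "1/2 < \<eta> / \<epsilon>" using \<epsilon> by (simp add: field_simps)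
  hence "log 2 (1/2) < log 2 (\<eta> / \<epsilon>)" using \<eta>0 \<epsilon> by (subst log_less_cancel_iff) auto
  moreover have "log 2 (1/2) = - 1" by (simp add: log_divide)
  ultimately have J0: "\<lceil>log 2 (\<eta> / \<epsilon>)\<rceil> \<ge> 0" by linarith
  hence Jr: "real_of_int \<lceil>log 2 (\<eta> / \<epsilon>)\<rceil> = real (nat \<lceil>log 2 (\<eta> / \<epsilon>)\<rceil>)" by simp
  have "ln (4 / \<rho>) > 0" using \<rho> by simp
  moreover have "ln (of_int \<lceil>log 2 (\<eta> / \<epsilon>)\<rceil> + 1) \<ge> (0::real)" unfolding Jr by simp
  moreover have "ln (real K + 1) \<ge> 0" by simp
  ultimately have X0: "X > 0" unfolding X_def by linarith
  have "4 / \<alpha>\<^sup>2 * X > 0" using X0 \<alpha>0 by simp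
  hence ceil0: "\<lceil>4 / \<alpha>\<^sup>2 * X\<rceil> > 0" by simp
  have "real N = 2 * real (nat \<lceil>4 / \<alpha>\<^sup>2 * X\<rceil>)" using N ceil0 by (simp add: X_def)
  hence N2: "N div 2 = nat \<lceil>4 / \<alpha>\<^sup>2 * X\<rceil>" by linarith
  hence N0: "N div 2 > 0" using ceil0 by simp
  have "4 / \<alpha>\<^sup>2 * X \<le> real (N div 2)" unfolding N2 by linarith
  hence NX: "X \<le> real (N div 2) * \<alpha>\<^sup>2 / 4" using \<alpha>0 by (simp add: field_simps)
  have gap': "Dt \<le> dist_Z (lam s - lam t)" if "s < S" "t < S" "s \<noteq> t" for s t using gap that by (simp add: less_imp_le)
  have KSn: "32 * S < K" using KS by linarith
  have prob: "measure_pmf.prob (rmpe_output (signal H psi) K N \<eta> \<epsilon> selm sele selE)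
       {(stopped, E, Ms). stopped \<and> lam ` {..<S} \<subseteq> E \<and> E \<subseteq> ballR (lam ` {..<S}) \<epsilon>} \<ge> 1 - \<rho>"
  proof (rule rmpe_output_prob[OF S K KSn Dt0 KDt Dtu gap' lam \<beta> \<omega> \<alpha>0 \<alpha>\<eta> \<eta>0 \<eta>u \<epsilon>(1)
        signal_bounds(1)[OF model] signal_bounds(2)[OF model] N0])
    show "ln (4 / \<rho>) + ln (real (nat \<lceil>log 2 (\<eta> / \<epsilon>)\<rceil>) + 1) + ln (real K + 1) \<le> real (N div 2) * \<alpha>\<^sup>2 / 4"
      using NX unfolding X_def Jr .
  qed (use selm sele selE \<rho> in auto)
  have selm': "2 \<le> selm l Mp Ep \<and> selm l Mp Ep \<le> 4" for l Mp Ep using selm by blast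
  have "T_max K Ms \<le> 8 * \<eta> * real K / \<epsilon> \<and> T_total K N Ms \<le> 8 * \<eta> * (real K)\<^sup>2 * real N / \<epsilon>"
    if "(stopped, E, Ms) \<in> set_pmf (rmpe_output (signal H psi) K N \<eta> \<epsilon> selm sele selE)" for stopped E Ms
    using rmpe_cost[OF \<epsilon> selm' that] by simp
  with prob show ?case by blast
qed

end
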